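(* The set of weights of irreducible completely splittable modules in $\operatorname{Rep}_{\mathbb I}\mathcal H_n^{\mathrm{aff}}(q)$ is exactly the set of $\underline i=(i_1,\dots,i_n)\in\mathbb I^n$ satisfying all of the following: (1) $i_k\ne i_{k+1}$ for all $1\le k\le n-1$. (2) If $h\ge3$ is odd, then $\frac{h-1}2$ appears at most once in $\underline i$. (3) If $i_k=i_\ell=0$ for some $1\le k<\ell\le n$, then $1\in\{i_{k+1},\dots,i_{\ell-1}\}$. (4) If $h=\infty$ and $i_k=i_\ell\ge1$ for some $1\le k<\ell\le n$, then $\{i_k-1,i_k+1\}\subset\{i_{k+1},\dots,i_{\ell-1}\}$. (5) If $h\ge3$ is odd and $i_k=i_\ell\ge1$ for some $1\le k<\ell\le n$, then either of the following holds: (a) $\{i_k-1,i_k+1\}\subset\{i_{k+1},\dots,i_{\ell-1}\}$; (b) there exists a sequence of integers $k\le r_0<r_1<\cdots<r_{\frac{h-3}2-i_k}<s<t_{\frac{h-3}2-i_k}<\cdots<t_1<t_0\le\ell$ such that $i_s=\frac{h-1}2$, $i_{r_j}=i_{t_j}=i_k+j$, and $i_k+j$ does not appear between $i_{r_j}$ and $i_{t_j}$ in $\underline i$, for each $0\le j\le\frac{h-3}2-i_k$. (6) If $h\ge4$ is even and $i_k=i_\ell\ge1$ for some $1\le k<\ell\le n$, then: (a) if $i_k=i_\ell<\frac h2-1$, then $\{i_k-1,i_k+1\}\subset\{i_{k+1},\dots,i_{\ell-1}\}$; (b) if $i_k=i_\ell=\frac h2-1$, then $i_k-1\in\{i_{k+1},\dots,i_{\ell-1}\}$;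 moreover, with $m=\#\{t: i_t=\frac h2-1,\ k\le t\le\ell\}$, there exists a unique set of integers $1\le k_{a;b}\le n$ with $1\le a\le\min\{m,\frac h2\}$, $1\le b\le m-(a-1)$, such that, for all $a,b$ (whenever the indices involved lie in the stated range): (i) $i_{k_{a;b}}=\frac h2-a$; (ii) $k_{a;b}<k_{a+1;b}<k_{a;b+1}$; (iii) $\frac h2-a$ does not appear between $i_{k_{a;b}}$ and $i_{k_{a;b+1}}$ in $\underline i$, and moreover $k_{a+1;b}$ is the unique index in $\{k_{a;b},k_{a;b}+1,\dots,k_{a;b+1}\}$ such that $i_{k_{a+1;b}}=\frac h2-a-1$.
   Context: Standing assumptions: $\mathbb F$ is an algebraically closed field with $\operatorname{char}\mathbb F\ne 2$; $q\in\mathbb F^*$, $q\ne\pm1$; $\varepsilon=q-q^{-1}$. Either $q$ is not a root of unity and $h=\infty$, or $q$ is a primitive $e$-th root of unity with $e$ odd and $h=e$ (odd), or $q$ is a primitive $e$-th root of unity with $e$ divisible by $4$ and $h=e/2$ (even). Moreover $h\ge3$. (In all cases with $h$ finite, $q^2$ is a primitive $h$-th root of unity.) $\mathcal H_n^{\mathrm{aff}}(q)$ is the $\mathbb F$-superalgebra generated by even $T_1,\dots,T_{n-1},X_1^{\pm1},\dots,X_n^{\pm1}$ and odd $C_1,\dots,C_n$ with relations: $T_i^2=\varepsilon T_i+1$, $T_iT_j=T_jT_i$ ($|i-j|>1$), $T_iT_{i+1}T_i=T_{i+1}T_iT_{i+1}$; $X_iX_j=X_jX_i$, $X_iX_i^{-1}=X_i^{-1}X_i=1$;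 $C_i^2=1$, $C_iC_j=-C_jC_i$ ($i\neq j$); $T_iX_i=X_{i+1}T_i-\varepsilon(X_{i+1}+C_iC_{i+1}X_i)$, $T_iX_j=X_jT_i$ ($j\ne i,i+1$); $T_iC_i=C_{i+1}T_i$, $T_iC_{i+1}=C_iT_i-\varepsilon(C_i-C_{i+1})$, $T_iC_j=C_jT_i$ ($j\neq i,i+1$); $X_iC_i=C_iX_i^{-1}$, $X_iC_j=C_jX_i$ ($i\ne j$). Modules are $\mathbb Z_2$-graded left modules. $\mathtt q(i)=2\frac{q^{2i+1}+q^{-2i-1}}{q+q^{-1}}$; $\mathbb I=\mathbb Z_{\ge0}$ if $h=\infty$, $\{0,\dots,\frac{h-1}2\}$ if $h$ is odd, $\{0,\dots,\frac h2-1\}$ if $h$ is even. $\operatorname{Rep}_{\mathbb I}\mathcal H_n^{\mathrm{aff}}(q)$ is the category of finite dimensional modules on which all eigenvalues of every $X_j+X_j^{-1}$ lie in $\{\mathtt q(i):i\in\mathbb I\}$. For such $M$ and $\underline i\in\mathbb I^n$, $M_{\underline i}=\{z\in M:(X_k+X_k^{-1}-\mathtt q(i_k))^Nz=0\text{ for }N\gg0,\ 1\le k\le n\}$; $\underline i$ is a weight of $M$ if $M_{\underline i}\ne0$. $M$ is completely splittable if $X_1^{\pm1},\dots,X_n^{\pm1}$ act semisimply.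
   Formalization: In (6)(b) the k_{a;b} range over k..l, not 1..n: with 1..n uniqueness fails for the weight (1,0,1,0,1), h=4, k=1, l=3 (arrays 1,2,3 and 3,4,5). Modules are taken on subspaces of finitely supported sequences, which is general up to isomorphism. *)

theory Defs
  imports
    "HOL-Algebra.QuotRing"
    "HOL-Computational_Algebra.Polynomial"
    "HOL-Library.Extended_Nat"
    "HOL-Library.FuncSet"
    "HOL-Library.Poly_Mapping"
    "HOL-Library.Z2"
begin

section \<open>The quantum characteristic and the index set\<close>

definition primitive_root_of_unity :: "'a::field \<Rightarrow> nat \<Rightarrow> bool" where
  "primitive_root_of_unity q e \<longleftrightarrow> 0 < e \<and> q ^ e = 1 \<and> (\<forall>k. 0 < k \<and> k < e \<longrightarrow> q ^ k \<noteq> 1)"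

text \<open>Roots of unity of order \<open>e \<equiv> 2\<close> modulo 4 are related to no \<open>h\<close>: they are excluded
  by the standing assumptions.\<close>

definition quantum_char :: "'a::field \<Rightarrow> enat \<Rightarrow> bool" where
  "quantum_char q h \<longleftrightarrow>
     ((\<forall>e>0. q ^ e \<noteq> 1) \<and> h = \<infinity>) \<or>
     (\<exists>e. primitive_root_of_unity q e \<and> odd e \<and> h = enat e) \<or>
     (\<exists>e. primitive_root_of_unity q e \<and> 4 dvd e \<and> h = enat (e div 2))"

definition index_set :: "enat \<Rightarrow> nat set" where
  "index_set h = (case h of \<infinity> \<Rightarrow> UNIV
     | enat m \<Rightarrow> if odd m then {0..(m - 1) div 2} else {0..m div 2 - 1})"

definition qval :: "'a::field \<Rightarrow> nat \<Rightarrow> 'a" where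
  "qval q i = 2 * (q ^ (2 * i + 1) + inverse q ^ (2 * i + 1)) / (q + inverse q)"


section \<open>The affine Hecke--Clifford superalgebra\<close>

text \<open>The free associative algebra is the monoid algebra, over \<open>'a\<close>, of the free monoid of
  words: \<open>\<Rightarrow>\<^sub>0\<close> carries the convolution product, which here is concatenation of words, and the
  scalars are the multiples of the empty word.\<close>

datatype gen = GT nat | GX nat | GXinv nat | GC nat

datatype gword = Word (letters: "gen list")

instantiation gword :: monoid_add
begin
definition zero_gword :: gword where "0 = Word []"
definition plus_gword :: "gword \<Rightarrow> gword \<Rightarrow> gword" where
  "u + v = Word (letters u @ letters v)"
instance
  by standard (simp_all add: zero_gword_def plus_gword_def)
end

type_synonym 'a free = "gword \<Rightarrow>\<^sub>0 'a"

abbreviation mon :: "gen \<Rightarrow> 'a::field free" where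
  "mon g \<equiv> Poly_Mapping.single (Word [g]) 1"

abbreviation fT :: "nat \<Rightarrow> 'a::field free" where "fT i \<equiv> mon (GT i)"
abbreviation fX :: "nat \<Rightarrow> 'a::field free" where "fX i \<equiv> mon (GX i)"
abbreviation fXinv :: "nat \<Rightarrow> 'a::field free" where "fXinv i \<equiv> mon (GXinv i)"
abbreviation fC :: "nat \<Rightarrow> 'a::field free" where "fC i \<equiv> mon (GC i)"

definition scal :: "'a::field \<Rightarrow> 'a free" where
  "scal c = Poly_Mapping.single 0 c"

definition gens :: "nat \<Rightarrow> gen set" where
  "gens n = GT ` {1..<n} \<union> GX ` {1..n} \<union> GXinv ` {1..n} \<union> GC ` {1..n}"

definition free_alg :: "nat \<Rightarrow> 'a::field free ring" where
  "free_alg n = \<lparr>carrier = {p. \<forall>w \<in> Poly_Mapping.keys p. set (letters w) \<subseteq> gens n},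
     monoid.mult = (*), one = 1, zero = 0, add = (+)\<rparr>"

definition eps :: "'a::field \<Rightarrow> 'a" where
  "eps q = q - inverse q"

text \<open>A pair \<open>(l, r)\<close> stands for the defining relation \<open>l = r\<close>.\<close>

inductive_set hc_rel :: "nat \<Rightarrow> 'a::field \<Rightarrow> ('a free \<times> 'a free) set"
  for n :: nat and q :: 'a where
  T_quad: "i \<in> {1..<n} \<Longrightarrow> (fT i * fT i, scal (eps q) * fT i + 1) \<in> hc_rel n q"
| T_comm: "i \<in> {1..<n} \<Longrightarrow> j \<in> {1..<n} \<Longrightarrow> \<bar>int i - int j\<bar> > 1 \<Longrightarrow>
    (fT i * fT j, fT j * fT i) \<in> hc_rel n q"
| T_braid: "i \<in> {1..<n} \<Longrightarrow> i + 1 \<in> {1..<n} \<Longrightarrow>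
    (fT i * fT (i + 1) * fT i, fT (i + 1) * fT i * fT (i + 1)) \<in> hc_rel n q"
| X_comm: "i \<in> {1..n} \<Longrightarrow> j \<in> {1..n} \<Longrightarrow> (fX i * fX j, fX j * fX i) \<in> hc_rel n q"
| X_inv_right: "i \<in> {1..n} \<Longrightarrow> (fX i * fXinv i, 1) \<in> hc_rel n q"
| X_inv_left: "i \<in> {1..n} \<Longrightarrow> (fXinv i * fX i, 1) \<in> hc_rel n q"
| C_square: "i \<in> {1..n} \<Longrightarrow> (fC i * fC i, 1) \<in> hc_rel n q"
| C_anticomm: "i \<in> {1..n} \<Longrightarrow> j \<in> {1..n} \<Longrightarrow> i \<noteq> j \<Longrightarrow>
    (fC i * fC j, - (fC j * fC i)) \<in> hc_rel n q"
| TX_near: "i \<in> {1..<n} \<Longrightarrow>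
    (fT i * fX i,
     fX (i + 1) * fT i - scal (eps q) * (fX (i + 1) + fC i * fC (i + 1) * fX i)) \<in> hc_rel n q"
| TX_far: "i \<in> {1..<n} \<Longrightarrow> j \<in> {1..n} \<Longrightarrow> j \<noteq> i \<Longrightarrow> j \<noteq> i + 1 \<Longrightarrow>
    (fT i * fX j, fX j * fT i) \<in> hc_rel n q"
| TC_near: "i \<in> {1..<n} \<Longrightarrow> (fT i * fC i, fC (i + 1) * fT i) \<in> hc_rel n q"
| TC_next: "i \<in> {1..<n} \<Longrightarrow>
    (fT i * fC (i + 1), fC i * fT i - scal (eps q) * (fC i - fC (i + 1))) \<in> hc_rel n q"
| TC_far: "i \<in> {1..<n} \<Longrightarrow> j \<in> {1..n} \<Longrightarrow> j \<noteq> i \<Longrightarrow> j \<noteq> i + 1 \<Longrightarrow>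
    (fT i * fC j, fC j * fT i) \<in> hc_rel n q"
| XC_same: "i \<in> {1..n} \<Longrightarrow> (fX i * fC i, fC i * fXinv i) \<in> hc_rel n q"
| XC_far: "i \<in> {1..n} \<Longrightarrow> j \<in> {1..n} \<Longrightarrow> i \<noteq> j \<Longrightarrow> (fX i * fC j, fC j * fX i) \<in> hc_rel n q"

definition hc_ideal :: "nat \<Rightarrow> 'a::field \<Rightarrow> 'a free set" where
  "hc_ideal n q = Idl\<^bsub>free_alg n\<^esub> {l - r | l r. (l, r) \<in> hc_rel n q}"

definition Haff :: "nat \<Rightarrow> 'a::field \<Rightarrow> 'a free set ring" where
  "Haff n q = free_alg n Quot hc_ideal n q"

text \<open>The class in the algebra of an element of the free algebra.\<close>

definition cls :: "nat \<Rightarrow> 'a::field \<Rightarrow> 'a free \<Rightarrow> 'a free set" where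
  "cls n q p = hc_ideal n q +>\<^bsub>free_alg n\<^esub> p"

text \<open>The grading by \<open>\<int>/2\<close> (the type \<^typ>\<open>bit\<close>).  All relations are homogeneous, so the grading
  of the free algebra passes to the quotient.\<close>

fun gen_parity :: "gen \<Rightarrow> bit" where
  "gen_parity (GC i) = 1"
| "gen_parity (GT i) = 0"
| "gen_parity (GX i) = 0"
| "gen_parity (GXinv i) = 0"

definition word_parity :: "gword \<Rightarrow> bit" where
  "word_parity w = sum_list (map gen_parity (letters w))"

definition Haff_part :: "nat \<Rightarrow> 'a::field \<Rightarrow> bit \<Rightarrow> 'a free set set" where
  "Haff_part n q b =
     cls n q ` {p \<in> carrier (free_alg n). \<forall>w \<in> Poly_Mapping.keys p. word_parity w = b}"


section \<open>Supermodules\<close>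

text \<open>Modules are carried by subspaces of the space of finitely supported sequences.  Its
  dimension is countably infinite, so every finite dimensional module is isomorphic to one of
  these.\<close>

type_synonym 'a vec = "nat \<Rightarrow>\<^sub>0 'a"

definition scl :: "'a::field \<Rightarrow> 'a vec \<Rightarrow> 'a vec" where
  "scl c = Poly_Mapping.map ((*) c)"

lemma lookup_scl [simp]: "Poly_Mapping.lookup (scl c v) k = c * Poly_Mapping.lookup v k"
  by (simp add: scl_def Poly_Mapping.map.rep_eq when_def)

interpretation vsp: vector_space "scl :: 'a::field \<Rightarrow> 'a vec \<Rightarrow> 'a vec"
  by unfold_locales (simp_all add: poly_mapping_eq_iff fun_eq_iff lookup_add algebra_simps)

definition ssum :: "'v::ab_group_add set \<Rightarrow> 'v set \<Rightarrow> 'v set" where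
  "ssum U W = {u + w | u w. u \<in> U \<and> w \<in> W}"

text \<open>\<open>V 0\<close> and \<open>V 1\<close> are the even and the odd part.  Only the values of \<open>act h v\<close> with \<open>h\<close> in
  the algebra and \<open>v\<close> in the module are relevant.\<close>

type_synonym 'a action = "'a free set \<Rightarrow> 'a vec \<Rightarrow> 'a vec"

definition total :: "(bit \<Rightarrow> 'a::field vec set) \<Rightarrow> 'a vec set" where
  "total V = ssum (V 0) (V 1)"

definition supermodule ::
    "nat \<Rightarrow> 'a::field \<Rightarrow> (bit \<Rightarrow> 'a vec set) \<Rightarrow> 'a action \<Rightarrow> bool" where
  "supermodule n q V act \<longleftrightarrow>
     (\<forall>a. vsp.subspace (V a)) \<and> V 0 \<inter> V 1 = {0} \<and>
     (\<forall>a b. \<forall>h \<in> Haff_part n q b. \<forall>v \<in> V a. act h v \<in> V (b + a)) \<and>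
     (\<forall>h \<in> carrier (Haff n q). \<forall>v \<in> total V. \<forall>w \<in> total V. act h (v + w) = act h v + act h w) \<and>
     (\<forall>g \<in> carrier (Haff n q). \<forall>h \<in> carrier (Haff n q). \<forall>v \<in> total V.
        act (g \<oplus>\<^bsub>Haff n q\<^esub> h) v = act g v + act h v \<and>
        act (g \<otimes>\<^bsub>Haff n q\<^esub> h) v = act g (act h v)) \<and>
     (\<forall>v \<in> total V. act \<one>\<^bsub>Haff n q\<^esub> v = v) \<and>
     (\<forall>c. \<forall>v \<in> total V. act (cls n q (scal c)) v = scl c v)"

definition graded_submodule ::
    "nat \<Rightarrow> 'a::field \<Rightarrow> (bit \<Rightarrow> 'a vec set) \<Rightarrow> 'a action \<Rightarrow> 'a vec set \<Rightarrow> bool" where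
  "graded_submodule n q V act W \<longleftrightarrow>
     vsp.subspace W \<and> W \<subseteq> total V \<and> W = ssum (W \<inter> V 0) (W \<inter> V 1) \<and>
     (\<forall>h \<in> carrier (Haff n q). \<forall>w \<in> W. act h w \<in> W)"

definition irreducible_module ::
    "nat \<Rightarrow> 'a::field \<Rightarrow> (bit \<Rightarrow> 'a vec set) \<Rightarrow> 'a action \<Rightarrow> bool" where
  "irreducible_module n q V act \<longleftrightarrow>
     supermodule n q V act \<and> total V \<noteq> {0} \<and>
     (\<forall>W. graded_submodule n q V act W \<longrightarrow> W = {0} \<or> W = total V)"

definition semisimple_on :: "'a::field vec set \<Rightarrow> ('a vec \<Rightarrow> 'a vec) \<Rightarrow> bool" where
  "semisimple_on U f \<longleftrightarrow>
     (\<forall>W. vsp.subspace W \<and> W \<subseteq> U \<and> f ` W \<subseteq> W \<longrightarrow>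
       (\<exists>W'. vsp.subspace W' \<and> W' \<subseteq> U \<and> f ` W' \<subseteq> W' \<and> W \<inter> W' = {0} \<and> ssum W W' = U))"

definition completely_splittable ::
    "nat \<Rightarrow> 'a::field \<Rightarrow> (bit \<Rightarrow> 'a vec set) \<Rightarrow> 'a action \<Rightarrow> bool" where
  "completely_splittable n q V act \<longleftrightarrow>
     (\<forall>j \<in> {1..n}. semisimple_on (total V) (act (cls n q (fX j))) \<and>
                   semisimple_on (total V) (act (cls n q (fXinv j))))"

definition X_plus_Xinv :: "nat \<Rightarrow> 'a::field \<Rightarrow> 'a action \<Rightarrow> nat \<Rightarrow> 'a vec \<Rightarrow> 'a vec" where
  "X_plus_Xinv n q act j v = act (cls n q (fX j)) v + act (cls n q (fXinv j)) v"

definition in_RepI ::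
    "nat \<Rightarrow> 'a::field \<Rightarrow> enat \<Rightarrow> (bit \<Rightarrow> 'a vec set) \<Rightarrow> 'a action \<Rightarrow> bool" where
  "in_RepI n q h V act \<longleftrightarrow>
     supermodule n q V act \<and>
     (\<exists>B. finite B \<and> vsp.span B = total V) \<and>
     (\<forall>j \<in> {1..n}. \<forall>c. (\<exists>v \<in> total V. v \<noteq> 0 \<and> X_plus_Xinv n q act j v = scl c v) \<longrightarrow>
        c \<in> qval q ` index_set h)"

definition weight_space ::
    "nat \<Rightarrow> 'a::field \<Rightarrow> (bit \<Rightarrow> 'a vec set) \<Rightarrow> 'a action \<Rightarrow> (nat \<Rightarrow> nat) \<Rightarrow> 'a vec set" where
  "weight_space n q V act i =
     {z \<in> total V. \<forall>\<^sub>F N in sequentially. \<forall>k \<in> {1..n}.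
        ((\<lambda>v. X_plus_Xinv n q act k v - scl (qval q (i k)) v) ^^ N) z = 0}"

text \<open>Elements of \<open>\<I>\<^sup>n\<close> are the extensional functions \<open>{1..n} \<rightarrow>\<^sub>E \<I>\<close>.\<close>

definition is_weight ::
    "nat \<Rightarrow> 'a::field \<Rightarrow> enat \<Rightarrow> (bit \<Rightarrow> 'a vec set) \<Rightarrow> 'a action \<Rightarrow> (nat \<Rightarrow> nat) \<Rightarrow> bool" where
  "is_weight n q h V act i \<longleftrightarrow>
     i \<in> {1..n} \<rightarrow>\<^sub>E index_set h \<and> weight_space n q V act i \<noteq> {0}"


section \<open>Combinatorial conditions\<close>

text \<open>The index \<open>j\<close> runs over \<open>0 \<le> j \<le> (h-3)/2 - i\<^sub>k\<close>, written without subtraction of naturals.\<close>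

definition odd_sequence :: "nat \<Rightarrow> (nat \<Rightarrow> nat) \<Rightarrow> nat \<Rightarrow> nat \<Rightarrow> bool" where
  "odd_sequence h i k l \<longleftrightarrow>
     (\<exists>(r :: nat \<Rightarrow> nat) (t :: nat \<Rightarrow> nat) s.
        let J = {j. i k + j \<le> (h - 3) div 2} in
          k \<le> s \<and> s \<le> l \<and> i s = (h - 1) div 2 \<and>
          strict_mono_on J r \<and> (\<forall>a \<in> J. \<forall>b \<in> J. a < b \<longrightarrow> t b < t a) \<and>
          (\<forall>j \<in> J. k \<le> r j \<and> r j < s \<and> s < t j \<and> t j \<le> l \<and>
             i (r j) = i k + j \<and> i (t j) = i k + j \<and>
             (\<forall>u. r j < u \<and> u < t j \<longrightarrow> i u \<noteq> i k + j)))"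

text \<open>The integers \<open>k\<^bsub>a;b\<^esub>\<close> form a function \<open>\<kappa>\<close> on the admissible pairs \<open>(a, b)\<close>.  As \<open>m\<close> counts
  occurrences between positions \<open>k\<close> and \<open>l\<close>, so are the \<open>k\<^bsub>a;b\<^esub>\<close> taken in \<open>{k..l}\<close>: if they
  ranged over \<open>{1..n}\<close>, uniqueness would fail as soon as \<open>h/2 - 1\<close> occurs outside \<open>{k..l}\<close> in
  such a way that the array can be shifted, as for the weight \<open>(1,0,1,0,1)\<close> when \<open>h = 4\<close>,
  \<open>k = 1\<close>, \<open>l = 3\<close>.\<close>

definition even_index :: "nat \<Rightarrow> nat \<Rightarrow> (nat \<times> nat) set" where
  "even_index h m = {(a, b). 1 \<le> a \<and> a \<le> min m (h div 2) \<and> 1 \<le> b \<and> b \<le> m - (a - 1)}"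

definition even_array :: "nat \<Rightarrow> (nat \<Rightarrow> nat) \<Rightarrow> nat \<Rightarrow> (nat \<times> nat \<Rightarrow> nat) \<Rightarrow> bool" where
  "even_array h i m \<kappa> \<longleftrightarrow>
     (\<forall>(a, b) \<in> even_index h m.
        i (\<kappa> (a, b)) = h div 2 - a \<and>
        ((a + 1, b) \<in> even_index h m \<and> (a, b + 1) \<in> even_index h m \<longrightarrow>
           \<kappa> (a, b) < \<kappa> (a + 1, b) \<and> \<kappa> (a + 1, b) < \<kappa> (a, b + 1)) \<and>
        ((a, b + 1) \<in> even_index h m \<longrightarrow>
           (\<forall>u. \<kappa> (a, b) < u \<and> u < \<kappa> (a, b + 1) \<longrightarrow> i u \<noteq> h div 2 - a)) \<and>
        ((a + 1, b) \<in> even_index h m \<and> (a, b + 1) \<in> even_index h m \<longrightarrow>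
           (\<forall>u \<in> {\<kappa> (a, b)..\<kappa> (a, b + 1)}. i u = h div 2 - a - 1 \<longleftrightarrow> u = \<kappa> (a + 1, b))))"

definition even_unique_array :: "nat \<Rightarrow> (nat \<Rightarrow> nat) \<Rightarrow> nat \<Rightarrow> nat \<Rightarrow> bool" where
  "even_unique_array h i k l \<longleftrightarrow>
     (let m = card {t \<in> {k..l}. i t = h div 2 - 1} in
        \<exists>!\<kappa>. \<kappa> \<in> even_index h m \<rightarrow>\<^sub>E {k..l} \<and> even_array h i m \<kappa>)"

end

(* On a joint eigenvector of X_1, ..., X_n the generator T_k is an explicit operator in C_k C_(k+1)
   plus an intertwiner whose target has the eigenvalues at k and k+1 exchanged.  The intertwiner
   squares to a scalar that vanishes exactly when the weight entries i_k, i_(k+1) differ by 1.  So the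
   weights of a completely splittable module are closed under swapping neighbours that are not
   close, have no equal neighbours, and, by the braid relation applied where the intertwiners vanish,
   contain a pattern (a, b, a) only in special cases.  Induction on the distance between two
   occurrences of a value turns these closure properties into a condition on consecutive
   occurrences ("well separated"), which is equivalent to (1)-(6).

   Conversely, for a well separated i the span of C_S e_j, with j in the orbit of i under admissible
   swaps and S a subset of {1, ..., n}, is a module with the intertwiners normalised by square
   roots.  The far braid cases are forms of the Yang-Baxter equation; in the others the braid
   relation fails by a scalar that is zero for the special patterns.  A minimal graded submodule
   contains a joint eigenvector, and swapping back gives one of weight i. *)

theory Submission
  imports Defs
begin

text \<open>Swapping two entries that are not close keeps the relative order of every pair of close
  entries, and the condition on consecutive occurrences compares only values that differ by at most
  1. Hence it is invariant under admissible swaps, and an induction may move the ends of a gap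
  inwards. The array in (6) is no extra restriction in it: it is forced by the gaps. Repeated
  patterns (a, b, a) come from two degenerations. At index 0, and at the top index when h is even,
  the eigenvalue of X_k is its own inverse; at the top index when h is odd, a product of values
  becomes exceptional. These are the two factors of the braid defect. Square roots give the
  intertwiners between a weight and its swap the same factor in both directions. They then satisfy
  the braid relation exactly, their squares are the required scalars, and the braid relation for T_k
  can be compared according to the intertwiners that occur. What remains are identities for the
  Clifford parts alone.\<close>

section \<open>Arithmetic of q: coincidences and links between the values
  \<open>qval q a\<close>\<close>

definition hdvd :: "enat \<Rightarrow> nat \<Rightarrow> bool" where
  "hdvd h k = (case h of \<infinity> \<Rightarrow> k = 0 | enat m \<Rightarrow> m dvd k)"

definition index_max :: "enat \<Rightarrow> enat" where
  "index_max h = (case h of \<infinity> \<Rightarrow> \<infinity> | enat m \<Rightarrow> if odd m then enat ((m - 1) div 2) else enat (m div 2 - 1))"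

lemma index_set_iff: "a \<in> index_set h \<longleftrightarrow> enat a \<le> index_max h"
  by (auto simp: index_set_def index_max_def split: enat.splits)

lemma primitive_root_power_eq_1_iff:
  assumes "primitive_root_of_unity q e"
  shows "q ^ k = 1 \<longleftrightarrow> e dvd k"
proof
  assume "q ^ k = 1"
  have "q ^ k = (q ^ e) ^ (k div e) * q ^ (k mod e)"
    by (simp flip: power_mult power_add)
  then have "q ^ (k mod e) = 1"
    using assms \<open>q ^ k = 1\<close> by (simp add: primitive_root_of_unity_def)
  moreover have "k mod e < e"
    using assms by (simp add: primitive_root_of_unity_def)
  ultimately show "e dvd k"
    using assms by (auto simp: primitive_root_of_unity_def dvd_eq_mod_eq_0)
next
  assume "e dvd k"
  then show "q ^ k = 1"
    using assms by (auto simp: primitive_root_of_unity_def power_mult elim!: dvdE)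
qed

text \<open>Passing to the square of q keeps an odd order and halves an order divisible by 4, so in
  every finite case that square has order exactly h. This is the only link between q and h used
  below.\<close>

lemma power_double_eq_1_iff:
  assumes "quantum_char q h"
  shows "q ^ (2 * k) = 1 \<longleftrightarrow> hdvd h k"
  using assms unfolding quantum_char_def
proof (elim disjE exE conjE)
  assume "\<forall>e>0. q ^ e \<noteq> 1" "h = \<infinity>"
  then show ?thesis by (cases "k = 0") (auto simp: hdvd_def)
next
  fix e assume e: "primitive_root_of_unity q e" "odd e" "h = enat e"
  have "coprime e 2" using e(2) by simp
  then show ?thesis
    using e by (simp add: hdvd_def primitive_root_power_eq_1_iff coprime_dvd_mult_right_iff)
next
  fix e assume e: "primitive_root_of_unity q e" "4 dvd e" "h = enat (e div 2)"
  then obtain f where "e = 4 * f" by (auto elim: dvdE)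
  then show ?thesis
    using e by (auto simp: hdvd_def primitive_root_power_eq_1_iff)
qed

lemma power_double_eq_iff:
  fixes q :: "'a::field"
  assumes "quantum_char q h" "q \<noteq> 0" "x \<le> y"
  shows "q ^ (2 * x) = q ^ (2 * y) \<longleftrightarrow> hdvd h (y - x)"
proof -
  have "q ^ (2 * y) = q ^ (2 * x) * q ^ (2 * (y - x))"
    using assms(3) by (simp flip: power_add add: right_diff_distrib')
  then show ?thesis
    using power_double_eq_1_iff[OF assms(1)] assms(2) by auto
qed

lemma hdvd_small:
  assumes "hdvd h k" "enat k < 2 * h" "0 < h"
  shows "k = 0 \<or> enat k = h"
proof (cases h)
  case (enat m)
  then obtain c where c: "k = m * c" using assms by (auto simp: hdvd_def)
  have "m * c < m * 2"
    using assms(2) enat c by (simp add: numeral_eq_enat mult.commute)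
  then have "c < 2" by simp
  then show ?thesis using c enat by (auto simp: less_2_cases_iff)
qed (use assms in \<open>simp add: hdvd_def\<close>)

lemma diff_eq_mult_iff: "x - y = c * z \<Longrightarrow> c \<noteq> 0 \<Longrightarrow> x = y \<longleftrightarrow> z = (0::'a::idom)"
  by (metis eq_iff_diff_eq_0 mult_eq_0_iff)

locale quantum =
  fixes q :: "'a::alg_closed_field" and h :: enat
  assumes char: "CHAR('a) \<noteq> 2"
    and q_nz: "q \<noteq> 0" and q_n1: "q \<noteq> 1" and q_nm1: "q \<noteq> -1"
    and qc: "quantum_char q h" and h3: "3 \<le> h"
begin

lemma two_nz: "(2::'a) \<noteq> 0"
proof
  assume "(2::'a) = 0"
  then have "of_nat 2 = (0::'a)" by simp
  then have "CHAR('a) dvd 2" by (simp only: of_nat_eq_0_iff_char_dvd)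
  then have "CHAR('a) = 1 \<or> CHAR('a) = 2"
    using dvd_imp_le[of "CHAR('a)" 2] by (cases "CHAR('a)") (auto simp: le_Suc_eq numeral_2_eq_2)
  then show False using char by auto
qed

lemma four_nz: "(4::'a) \<noteq> 0"
  using two_nz mult_eq_0_iff[of "2::'a" 2] by simp

text \<open>With h written as 2p + 1 or 2p + 2 the largest index is p in both finite cases, so the
  range arguments below look alike.\<close>

lemma index_max_cases:
  obtains "h = \<infinity>" "index_max h = \<infinity>"
  | p where "1 \<le> p" "h = enat (2 * p + 1)" "index_max h = enat p"
  | p where "1 \<le> p" "h = enat (2 * p + 2)" "index_max h = enat p"
proof (cases h)
  case (enat m)
  have m: "3 \<le> m" using h3 enat by (simp add: numeral_eq_enat)
  show thesis
  proof (cases "odd m")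
    case True
    then obtain p where p: "m = 2 * p + 1" by (elim oddE)
    then show thesis using that(2)[of p] enat m by (auto simp: index_max_def)
  next
    case False
    then obtain r where "m = 2 * r" by (auto elim: evenE)
    moreover have "r \<ge> 1" using m calculation by simp
    ultimately obtain p where p: "m = 2 * p + 2" by (metis Suc_eq_plus1 add_2_eq_Suc' le_Suc_ex mult_Suc_right plus_1_eq_Suc add.commute)
    then show thesis using that(3)[of p] enat m by (auto simp: index_max_def)
  qed
qed (use that(1) in \<open>simp add: index_max_def\<close>)

text \<open>Otherwise the fourth power of q is 1, so that h divides 2, against 3 \<le> h.\<close>

lemma q_plus_inverse_nz: "q + inverse q \<noteq> 0"
proof
  assume "q + inverse q = 0"
  then have "q * q = -1" using q_nz by (simp add: field_simps eq_neg_iff_add_eq_0)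
  then have "(q * q) * (q * q) = (-1) * (-1)" by simp
  then have "q ^ (2 * 2) = 1" by (simp add: power2_eq_square power4_eq_xxxx mult.assoc)
  then have "hdvd h 2" using power_double_eq_1_iff[OF qc] by blast
  then show False using h3 
    by (cases h) (auto simp: hdvd_def numeral_eq_enat dest: dvd_imp_le)
qed

text \<open>\<open>qval q a\<close> is a fixed multiple of \<open>sv a + inverse (sv a)\<close>, so
  relations between values turn into relations between powers of q.\<close>

definition sv :: "nat \<Rightarrow> 'a" where "sv a = q ^ (2 * a + 1)"

lemma sv_nz: "sv a \<noteq> 0" using q_nz by (simp add: sv_def)

lemma qval_sv: "qval q a = 2 * (sv a + inverse (sv a)) / (q + inverse q)"
  by (simp add: qval_def sv_def power_inverse)

lemma sv_mult: "sv a * sv b = q ^ (2 * (a + b + 1))"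
  by (simp add: sv_def algebra_simps flip: power_add)

lemma qval_eq_D:
  assumes "qval q a = qval q b"
  shows "sv a = sv b \<or> sv a * sv b = 1"
proof -
  have "sv a + inverse (sv a) = sv b + inverse (sv b)"
    using assms two_nz q_plus_inverse_nz by (simp add: qval_sv del: distrib_left_numeral)
  then have "(sv a - sv b) * (sv a * sv b - 1) = 0"
    using sv_nz[of a] sv_nz[of b] by (simp add: field_simps)
  then show ?thesis by auto
qed

text \<open>Equal values mean that h divides b - a or a + b + 1. For finite h both numbers are at
  most h on the index set, and a + b + 1 = h leaves only a = b = (h - 1)/2.\<close>

lemma qval_inj_wlog:
  assumes "a \<in> index_set h" "b \<in> index_set h" "a \<le> b" "qval q a = qval q b"
  shows "a = b"
  using qval_eq_D[OF assms(4)]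
proof
  assume "sv a = sv b"
  then have "q ^ (2 * a) = q ^ (2 * b)" using q_nz by (simp add: sv_def)
  then have "hdvd h (b - a)" using power_double_eq_iff[OF qc q_nz assms(3)] by simp
  then show ?thesis using assms(1-3)
    by (cases rule: index_max_cases) (auto simp: hdvd_def index_set_iff dest: dvd_imp_le)
next
  assume "sv a * sv b = 1"
  then have "hdvd h (a + b + 1)" unfolding sv_mult power_double_eq_1_iff[OF qc] .
  then show ?thesis using assms(1-3)
    by (cases rule: index_max_cases) (auto simp: hdvd_def index_set_iff dest: dvd_imp_le)
qed

lemma qval_inj: "a \<in> index_set h \<Longrightarrow> b \<in> index_set h \<Longrightarrow> qval q a = qval q b \<Longrightarrow> a = b"
  by (cases "a \<le> b") (auto dest: qval_inj_wlog[of a b] qval_inj_wlog[of b a])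

text \<open>\<open>self_inverse_iff\<close> identifies these as the indices whose eigenvalues are
  their own inverses: the value is 2 at index 0 and -2 at the top of the even index set.\<close>

definition end_index :: "nat \<Rightarrow> bool" where
  "end_index a \<longleftrightarrow> a = 0 \<or> (\<exists>m. h = enat m \<and> even m \<and> a = m div 2 - 1)"

text \<open>The difference on the left decides whether the square of an intertwiner vanishes (see
  \<open>gg_eq\<close>). Its four factors are the ways in which s differs from t, or from the
  inverse of t, by \<open>q\<^sup>2\<close> or its inverse.\<close>

lemma link_factor:
  fixes s t :: 'a
  assumes "s \<noteq> 0" "t \<noteq> 0"
  shows "q ^ 4 * s\<^sup>2 * t\<^sup>2 *
      ((s + inverse s - (t + inverse t))\<^sup>2 -
       (eps q)\<^sup>2 * ((s + inverse s) * (t + inverse t) - (q + inverse q)\<^sup>2)) =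
    (s - t * q\<^sup>2) * (s * q\<^sup>2 - t) * (s * t - q\<^sup>2) * (s * t * q\<^sup>2 - 1)"
  using assms q_nz unfolding eps_def
  by (simp add: divide_simps power2_eq_square power4_eq_xxxx) (simp add: algebra_simps)

text \<open>The four factors say that modulo h the index a is b + 1 or b - 1, or that a + b is 0 or
  -2. The last two add nothing on the index set: a + b = 0 needs a = b, the sum a + b never reaches
  h, and a + b + 2 = h gives the two top indices when h is odd and a = b when h is even.\<close>

lemma link_iff:
  assumes "a \<in> index_set h" "b \<in> index_set h" "a \<noteq> b"
  shows "(qval q a - qval q b)\<^sup>2 = (eps q)\<^sup>2 * (qval q a * qval q b - 4) \<longleftrightarrow> b = a + 1 \<or> a = b + 1"
proof -
  define S T D where "S = sv a + inverse (sv a)" "T = sv b + inverse (sv b)" "D = q + inverse q"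
  have D: "D \<noteq> 0" using q_plus_inverse_nz by (simp add: S_T_D_def)
  have P: "qval q a = 2 * S / D" "qval q b = 2 * T / D"
    by (simp_all add: qval_sv S_T_D_def)
  have "(qval q a - qval q b)\<^sup>2 - (eps q)\<^sup>2 * (qval q a * qval q b - 4) =
      2\<^sup>2 / D\<^sup>2 * ((S - T)\<^sup>2 - (eps q)\<^sup>2 * (S * T - D\<^sup>2))"
    using D unfolding P by (simp add: field_simps power2_eq_square)
  then have "(qval q a - qval q b)\<^sup>2 = (eps q)\<^sup>2 * (qval q a * qval q b - 4) \<longleftrightarrow>
      (S - T)\<^sup>2 - (eps q)\<^sup>2 * (S * T - D\<^sup>2) = 0"
    by (rule diff_eq_mult_iff) (use D four_nz in simp)
  also have "\<dots> \<longleftrightarrow> (sv a - sv b * q\<^sup>2) * (sv a * q\<^sup>2 - sv b) *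
      (sv a * sv b - q\<^sup>2) * (sv a * sv b * q\<^sup>2 - 1) = 0"
    unfolding link_factor[OF sv_nz sv_nz, symmetric] S_T_D_def using q_nz sv_nz by simp
  also have "\<dots> \<longleftrightarrow> sv a = sv b * q\<^sup>2 \<or> sv a * q\<^sup>2 = sv b \<or> sv a * sv b = q\<^sup>2 \<or> sv a * sv b * q\<^sup>2 = 1"
    by auto
  finally have main: "(qval q a - qval q b)\<^sup>2 = (eps q)\<^sup>2 * (qval q a * qval q b - 4) \<longleftrightarrow>
      sv a = sv b * q\<^sup>2 \<or> sv a * q\<^sup>2 = sv b \<or> sv a * sv b = q\<^sup>2 \<or> sv a * sv b * q\<^sup>2 = 1" .
  have e1: "sv a = sv b * q\<^sup>2 \<longleftrightarrow> q ^ (2 * a) = q ^ (2 * (b + 1))"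
    using q_nz by (auto simp: sv_def power2_eq_square mult_ac)
  have e2: "sv a * q\<^sup>2 = sv b \<longleftrightarrow> q ^ (2 * (a + 1)) = q ^ (2 * b)"
    using q_nz by (auto simp: sv_def power2_eq_square mult_ac)
  have e3: "sv a * sv b = q\<^sup>2 \<longleftrightarrow> q ^ (2 * (a + b)) = 1"
    using q_nz unfolding sv_mult by (auto simp: power2_eq_square mult_ac)
  have e4: "sv a * sv b * q\<^sup>2 = 1 \<longleftrightarrow> q ^ (2 * (a + b + 2)) = 1"
  proof -
    have "2 * (a + b + 2) = 2 * (a + b + 1) + 2" by simp
    then show ?thesis unfolding sv_mult by (simp only: power_add)
  qed
  have e5: "(q ^ (2 * a) = q ^ (2 * (b + 1)) \<or> q ^ (2 * (a + 1)) = q ^ (2 * b) \<or>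
      q ^ (2 * (a + b)) = 1 \<or> q ^ (2 * (a + b + 2)) = 1) \<longleftrightarrow> b = a + 1 \<or> a = b + 1" (is "?L \<longleftrightarrow> ?R")
  proof
    have eqD: "\<exists>d. hdvd h d \<and> (x = y + d \<or> y = x + d)" if "q ^ (2 * x) = q ^ (2 * y)" for x y
    proof (cases "x \<le> y")
      case True
      then have "hdvd h (y - x)" using that by (simp only: power_double_eq_iff[OF qc q_nz])
      then show ?thesis using True by (intro exI[of _ "y - x"]) simp
    next
      case False
      then have "y \<le> x" by simp
      then have "hdvd h (x - y)" using that[symmetric] by (simp only: power_double_eq_iff[OF qc q_nz])
      then show ?thesis using \<open>y \<le> x\<close> by (intro exI[of _ "x - y"]) simp
    qed
    assume ?L
    then have "\<exists>d. hdvd h d \<and> (a = b + 1 + d \<or> b + 1 = a + d \<or> a + 1 = b + d \<or> b = a + 1 + d \<or>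
        d = a + b \<or> d = a + b + 2)"
      using eqD[of a "b + 1"] eqD[of "a + 1" b] power_double_eq_1_iff[OF qc, of "a + b"]
        power_double_eq_1_iff[OF qc, of "a + b + 2"] by metis
    then obtain d where d: "hdvd h d" "a = b + 1 + d \<or> b + 1 = a + d \<or> a + 1 = b + d \<or> b = a + 1 + d \<or>
        d = a + b \<or> d = a + b + 2" by blast
    show ?R
    proof (cases rule: index_max_cases)
      case 1
      then have "d = 0" using d(1) by (simp add: hdvd_def)
      then show ?thesis using d(2) assms(3) by auto
    next
      case (2 p)
      have ab: "a \<le> p" "b \<le> p" using assms(1,2) 2 by (auto simp: index_set_iff)
      \<comment> \<open>Every alternative keeps d below 2h, so d can only be 0 or h.\<close>
      then have "d \<le> 2 * p + 2" using d(2) 2(1) by auto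
      then have "d = 0 \<or> d = 2 * p + 1"
        using hdvd_small[OF d(1)] 2 by (auto simp: numeral_eq_enat zero_enat_def)
      then show ?thesis
        using d(2) ab assms(3) 2(1) by auto
    next
      case (3 p)
      have ab: "a \<le> p" "b \<le> p" using assms(1,2) 3 by (auto simp: index_set_iff)
      then have "d \<le> 2 * p + 2" using d(2) 3(1) by auto
      then have "d = 0 \<or> d = 2 * p + 2"
        using hdvd_small[OF d(1)] 3 by (auto simp: numeral_eq_enat zero_enat_def)
      then show ?thesis
        using d(2) ab assms(3) 3(1) by auto
    qed
  qed auto
  show ?thesis unfolding main e1 e2 e3 e4 e5 ..
qed

text \<open>Clearing denominators turns the difference of the two sides into
  (\<open>q\<^sup>2\<close> + 1)(st - 1)(tt - 1). The clearing factor depends on which of s and t is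
  \<open>q\<^sup>2\<close> times the other.\<close>

lemma special_factor:
  fixes s t :: 'a
  assumes "s \<noteq> 0" "t \<noteq> 0" "t = s * q\<^sup>2 \<or> s = t * q\<^sup>2"
  shows "(t + inverse t) * (s + inverse s + t + inverse t) = 2 * (q + inverse q)\<^sup>2 \<longleftrightarrow>
    s * t = 1 \<or> t\<^sup>2 = 1"
proof -
  have q2: "q\<^sup>2 + 1 \<noteq> 0"
    using q_plus_inverse_nz q_nz by (auto simp: field_simps power2_eq_square)
  have "\<exists>c. c \<noteq> 0 \<and> c * ((t + inverse t) * (s + inverse s + t + inverse t) - 2 * (q + inverse q)\<^sup>2) =
      (q\<^sup>2 + 1) * (s * t - 1) * (t\<^sup>2 - 1)"
    using assms(3)
  proof
    assume t: "t = s * q\<^sup>2"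
    show ?thesis
      by (rule exI[of _ "s * t * q\<^sup>2"]) (use assms(1) q_nz t in \<open>simp add: field_simps power2_eq_square\<close>)
  next
    assume s: "s = t * q\<^sup>2"
    show ?thesis
      by (rule exI[of _ "s * t"]) (use assms(2) q_nz s in \<open>simp add: field_simps power2_eq_square\<close>)
  qed
  then have "(t + inverse t) * (s + inverse s + t + inverse t) - 2 * (q + inverse q)\<^sup>2 = 0 \<longleftrightarrow>
      (q\<^sup>2 + 1) * (s * t - 1) * (t\<^sup>2 - 1) = 0"
    by (metis mult_eq_0_iff)
  then show ?thesis using q2 by auto
qed

definition odd_special :: "nat \<Rightarrow> nat \<Rightarrow> bool" where
  "odd_special a b \<longleftrightarrow> b = a + 1 \<and> (\<exists>m. h = enat m \<and> odd m \<and> b = (m - 1) div 2)"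

text \<open>This equation is the second way in which the braid defect can vanish (see
  \<open>defect_factor\<close>). It needs h to divide a + b + 1 or 2b + 1. For adjacent indices the
  former never happens, by parity when h is odd and by size when h is even; the latter means b = (h
  - 1)/2.\<close>

lemma special_iff:
  assumes "a \<in> index_set h" "b \<in> index_set h" "b = a + 1 \<or> a = b + 1"
  shows "qval q b * (qval q a + qval q b) = 8 \<longleftrightarrow> odd_special a b"
proof -
  define S T D where "S = sv a + inverse (sv a)" "T = sv b + inverse (sv b)" "D = q + inverse q"
  have D: "D \<noteq> 0" using q_plus_inverse_nz by (simp add: S_T_D_def)
  have P: "qval q a = 2 * S / D" "qval q b = 2 * T / D"
    by (simp_all add: qval_sv S_T_D_def)
  have "qval q b * (qval q a + qval q b) - 8 = 2\<^sup>2 / D\<^sup>2 * (T * (S + T) - 2 * D\<^sup>2)"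
    using D unfolding P by (simp add: field_simps power2_eq_square)
  then have "qval q b * (qval q a + qval q b) = 8 \<longleftrightarrow> T * (S + T) - 2 * D\<^sup>2 = 0"
    by (rule diff_eq_mult_iff) (use D four_nz in simp)
  also have "\<dots> \<longleftrightarrow> sv a * sv b = 1 \<or> (sv b)\<^sup>2 = 1"
  proof -
    have "sv b = sv a * q\<^sup>2 \<or> sv a = sv b * q\<^sup>2"
      using assms(3) by (auto simp: sv_def power2_eq_square)
    from special_factor[OF sv_nz sv_nz this] show ?thesis
      by (simp add: S_T_D_def add.assoc)
  qed
  also have "sv a * sv b = 1 \<longleftrightarrow> hdvd h (a + b + 1)"
    by (simp only: sv_mult power_double_eq_1_iff[OF qc])
  also have "(sv b)\<^sup>2 = 1 \<longleftrightarrow> hdvd h (2 * b + 1)"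
    using sv_mult[of b b] power_double_eq_1_iff[OF qc, of "2 * b + 1"]
    by (simp add: power2_eq_square mult_2)
  also have "hdvd h (a + b + 1) \<or> hdvd h (2 * b + 1) \<longleftrightarrow> odd_special a b"
    unfolding odd_special_def
  proof (cases rule: index_max_cases)
    case 1
    then show "hdvd h (a + b + 1) \<or> hdvd h (2 * b + 1) \<longleftrightarrow>
      b = a + 1 \<and> (\<exists>m. h = enat m \<and> odd m \<and> b = (m - 1) div 2)"
      by (simp add: hdvd_def)
  next
    case (2 p)
    have "hdvd h k \<longleftrightarrow> k = 2 * p + 1" if "k \<le> 2 * p + 1" "k > 0" for k
      using that 2(2) dvd_imp_le[of "2 * p + 1" k] by (auto simp: hdvd_def)
    moreover have "a \<le> p" "b \<le> p" using assms(1,2) 2 by (auto simp: index_set_iff)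
    ultimately have "hdvd h (a + b + 1) \<longleftrightarrow> a + b = 2 * p" "hdvd h (2 * b + 1) \<longleftrightarrow> b = p"
      by simp_all
    then show "hdvd h (a + b + 1) \<or> hdvd h (2 * b + 1) \<longleftrightarrow>
      b = a + 1 \<and> (\<exists>m. h = enat m \<and> odd m \<and> b = (m - 1) div 2)"
      using assms(3) 2(2) \<open>a \<le> p\<close> \<open>b \<le> p\<close> by auto
  next
    case (3 p)
    have "hdvd h k \<longleftrightarrow> k = 2 * p + 2" if "k \<le> 2 * p + 2" "k > 0" for k
      using that 3(2) dvd_imp_le[of "2 * p + 2" k] by (auto simp: hdvd_def)
    moreover have "a \<le> p" "b \<le> p" using assms(1,2) 3 by (auto simp: index_set_iff)
    ultimately have "hdvd h (a + b + 1) \<longleftrightarrow> a + b + 1 = 2 * p + 2" "hdvd h (2 * b + 1) \<longleftrightarrow> 2 * b + 1 = 2 * p + 2"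
      by simp_all
    then show "hdvd h (a + b + 1) \<or> hdvd h (2 * b + 1) \<longleftrightarrow>
      b = a + 1 \<and> (\<exists>m. h = enat m \<and> odd m \<and> b = (m - 1) div 2)"
      using assms(3) 3(2) \<open>a \<le> p\<close> \<open>b \<le> p\<close> by auto
  qed
  finally show ?thesis .
qed

lemma qval_0: "qval q 0 = 2"
  using q_plus_inverse_nz by (simp add: qval_def del: distrib_left_numeral)

lemma zero_index: "0 \<in> index_set h"
  by (cases rule: index_max_cases) (auto simp: index_set_iff zero_enat_def[symmetric])

text \<open>The value -2 occurs when \<open>q ^ (2 * k) = - 1\<close> for k = a or k = a + 1. Then h
  divides 2k but not k, and in the index range this leaves only a + 1 = h/2.\<close>

lemma qval_eq_neg2_iff:
  assumes "a \<in> index_set h"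
  shows "qval q a = - 2 \<longleftrightarrow> (\<exists>m. h = enat m \<and> even m \<and> a = m div 2 - 1)"
proof -
  have neg1: "(1::'a) \<noteq> -1" using two_nz by (metis add.right_inverse one_add_one)
  have "qval q a + 2 = 2 * ((sv a + q) * (sv a * q + 1)) / (sv a * q * (q + inverse q))"
    using q_plus_inverse_nz q_nz sv_nz[of a] unfolding qval_sv
    by (simp add: divide_simps) (simp add: algebra_simps)
  then have "qval q a = - 2 \<longleftrightarrow> sv a = - q \<or> sv a * q = - 1"
    using two_nz q_plus_inverse_nz q_nz sv_nz[of a]
    by (simp add: eq_neg_iff_add_eq_0)
  also have "sv a = - q \<longleftrightarrow> q ^ (2 * a) = - 1"
    using q_nz mult_left_cancel[of q "q ^ (2 * a)" "- 1"] by (simp add: sv_def)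
  also have "sv a * q = - 1 \<longleftrightarrow> q ^ (2 * (a + 1)) = - 1"
    by (simp add: sv_def mult.commute)
  also have "q ^ (2 * a) = - 1 \<or> q ^ (2 * (a + 1)) = - 1 \<longleftrightarrow>
      (\<exists>m. h = enat m \<and> even m \<and> a = m div 2 - 1)" (is "?L \<longleftrightarrow> ?R")
  proof
    have neg: "hdvd h (2 * k) \<and> \<not> hdvd h k" if "q ^ (2 * k) = - 1" for k
    proof -
      have "q ^ (2 * (2 * k)) = (q ^ (2 * k))\<^sup>2" by (simp add: power2_eq_square flip: power_add)
      then show ?thesis
        using that neg1 power_double_eq_1_iff[OF qc, of k] power_double_eq_1_iff[OF qc, of "2 * k"] by auto
    qed
    assume ?L
    then have *: "hdvd h (2 * a) \<and> \<not> hdvd h a \<or> hdvd h (2 * (a + 1)) \<and> \<not> hdvd h (a + 1)"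
      using neg by blast
    show ?R
    proof (cases rule: index_max_cases)
      case 1
      then show ?thesis using * by (auto simp: hdvd_def)
    next
      case (2 p)
      have "coprime (2 * p + 1) 2" by simp
      then have "2 * p + 1 dvd 2 * k \<longleftrightarrow> 2 * p + 1 dvd k" for k
        by (rule coprime_dvd_mult_right_iff)
      then show ?thesis using * 2(2) by (simp only: hdvd_def enat.case) blast
    next
      case (3 p)
      have "a \<le> p" using assms 3 by (auto simp: index_set_iff)
      have "k = 0 \<or> k = 2 * p + 2" if "hdvd h k" "k \<le> 2 * p + 2" for k
        using that 3(2) dvd_imp_le[of "2 * p + 2" k] by (auto simp: hdvd_def)
      from this[of "2 * a"] this[of "2 * (a + 1)"] have "a = 0 \<or> a = p"
        using * \<open>a \<le> p\<close> by auto
      moreover have "a \<noteq> 0 \<or> p = 0"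
        using * 3(2) by (cases "a = 0") (auto simp: hdvd_def dest: dvd_imp_le)
      ultimately show ?thesis
        using 3(2) by (intro exI[of _ "2 * p + 2"]) auto
    qed
  next
    assume ?R
    then obtain p where p: "h = enat (2 * p + 2)" "a = p" 
      by (cases rule: index_max_cases) auto
    have "q ^ (2 * (2 * (p + 1))) = 1"
      by (subst power_double_eq_1_iff[OF qc]) (simp add: p hdvd_def)
    then have "(q ^ (2 * (p + 1)))\<^sup>2 = 1" by (simp only: power_mult[symmetric] mult_ac)
    moreover have "q ^ (2 * (p + 1)) \<noteq> 1"
      by (subst power_double_eq_1_iff[OF qc]) (auto simp: p hdvd_def dest: dvd_imp_le)
    ultimately show ?L using p(2) by (auto simp: power2_eq_1_iff)
  qed
  finally show ?thesis .
qed

lemma self_inverse_iff: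
  assumes "a \<in> index_set h" "x \<noteq> 0" "x + inverse x = qval q a"
  shows "inverse x = x \<longleftrightarrow> end_index a"
proof -
  have "inverse x = x \<longleftrightarrow> x = 1 \<or> x = -1"
  proof -
    have "inverse x = x \<longleftrightarrow> (x - 1) * (x + 1) = 0"
      using assms(2) by (auto simp: field_simps)
    then show ?thesis by (auto simp: eq_neg_iff_add_eq_0)
  qed
  also have "x = 1 \<longleftrightarrow> qval q a = 2"
  proof -
    have "qval q a - 2 = (x - 1)\<^sup>2 / x"
      using assms(2) unfolding assms(3)[symmetric] by (simp add: field_simps power2_eq_square)
    then show ?thesis using assms(2) by (metis divide_eq_0_iff right_minus_eq zero_eq_power2)
  qed
  also have "x = - 1 \<longleftrightarrow> qval q a = - 2"
  proof -
    have "qval q a + 2 = (x + 1)\<^sup>2 / x"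
      using assms(2) unfolding assms(3)[symmetric] by (simp add: field_simps power2_eq_square)
    then show ?thesis using assms(2) by (metis divide_eq_0_iff eq_neg_iff_add_eq_0 zero_eq_power2)
  qed
  also have "qval q a = 2 \<longleftrightarrow> a = 0"
    using qval_inj[OF assms(1) zero_index] qval_0 by auto
  finally show ?thesis
    using qval_eq_neg2_iff[OF assms(1)] by (simp add: end_index_def)
qed

lemma qval_root: "\<exists>x. x \<noteq> 0 \<and> x + inverse x = qval q a"
proof -
  have "degree [:1, - qval q a, 1:] > 0" by simp
  then obtain x where x: "poly [:1, - qval q a, 1:] x = 0"
    using alg_closed_imp_poly_has_root by blast
  then have "x \<noteq> 0" by auto
  with x show ?thesis by (intro exI[of _ x]) (auto simp: field_simps)
qed

end

section \<open>Combinatorics of the weights\<close>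

definition consecutive :: "nat \<Rightarrow> (nat \<Rightarrow> nat) \<Rightarrow> nat \<Rightarrow> nat \<Rightarrow> bool" where
  "consecutive n i k l \<longleftrightarrow> 1 \<le> k \<and> k < l \<and> l \<le> n \<and> i k = i l \<and> (\<forall>u. k < u \<and> u < l \<longrightarrow> i u \<noteq> i k)"

text \<open>Condition (5b) of the theorem for consecutive occurrences of a value, with \<open>p = (h-1)/2\<close>.\<close>

inductive chain :: "nat \<Rightarrow> nat \<Rightarrow> (nat \<Rightarrow> nat) \<Rightarrow> nat \<Rightarrow> nat \<Rightarrow> bool" for n p i where
  base: "consecutive n i k l \<Longrightarrow> i k + 1 = p \<Longrightarrow> k < s \<Longrightarrow> s < l \<Longrightarrow> i s = p \<Longrightarrow> chain n p i k l"
| step: "consecutive n i k l \<Longrightarrow> chain n p i k' l' \<Longrightarrow> k < k' \<Longrightarrow> l' < l \<Longrightarrow> i k' = i k + 1 \<Longrightarrow>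
    chain n p i k l"

abbreviation (input) both_between :: "(nat \<Rightarrow> nat) \<Rightarrow> nat \<Rightarrow> nat \<Rightarrow> bool" where
  "both_between i k l \<equiv> {i k - 1, i k + 1} \<subseteq> i ` {k<..<l}"

text \<open>What (2) to (6) amount to for a consecutive pair: (2) becomes the exclusion of the top
  value in the odd case and (5b) becomes \<open>chain\<close>. The array in (6b) is absent because
  it follows from the rest, see \<open>even_unique_array\<close>. Condition (1) follows as well, see
  \<open>well_separated_distinct\<close>.\<close>

definition separated :: "enat \<Rightarrow> nat \<Rightarrow> (nat \<Rightarrow> nat) \<Rightarrow> nat \<Rightarrow> nat \<Rightarrow> bool" where
  "separated h n i k l \<longleftrightarrow>
     (i k = 0 \<longrightarrow> 1 \<in> i ` {k<..<l}) \<and>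
     (1 \<le> i k \<longrightarrow> (case h of \<infinity> \<Rightarrow> both_between i k l
        | enat m \<Rightarrow> if odd m then i k \<noteq> (m - 1) div 2 \<and> (both_between i k l \<or> chain n ((m - 1) div 2) i k l)
            else if i k = m div 2 - 1 then i k - 1 \<in> i ` {k<..<l} else both_between i k l))"

definition well_separated :: "enat \<Rightarrow> nat \<Rightarrow> (nat \<Rightarrow> nat) \<Rightarrow> bool" where
  "well_separated h n i \<longleftrightarrow> (\<forall>k l. consecutive n i k l \<longrightarrow> separated h n i k l)"

text \<open>Closeness is equality or linkage of values; only entries that are not close are
  swapped.\<close>

definition close :: "nat \<Rightarrow> nat \<Rightarrow> bool" where
  "close a b \<longleftrightarrow> a \<le> b + 1 \<and> b \<le> a + 1"

lemma chain_less: "chain n p i k l \<Longrightarrow> k < l"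
  by (induction rule: chain.induct) (auto simp: consecutive_def)

lemma chain_consecutive: "chain n p i k l \<Longrightarrow> consecutive n i k l"
  by (cases rule: chain.cases) auto

lemma chain_between: "chain n p i k l \<Longrightarrow> i k + 1 \<in> i ` {k<..<l}"
proof (induction rule: chain.induct)
  case (base k l s)
  then show ?case by (intro image_eqI[of _ _ s]) auto
next
  case (step k l k' l')
  then show ?case using chain_less[OF step(2)] by (intro image_eqI[of _ _ k']) auto
qed

text \<open>\<open>mono\<close> preserves the order of any two positions with close values. Since
  \<open>consecutive\<close>, \<open>chain\<close> and \<open>separated\<close> compare only such
  values, f transports them. The instance used below is a swap of two neighbours that are not
  close.\<close>

locale reindexing =
  fixes n :: nat and f :: "nat \<Rightarrow> nat" and i i' :: "nat \<Rightarrow> nat"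
  assumes maps: "x \<in> {1..n} \<Longrightarrow> f x \<in> {1..n}"
    and invol: "x \<in> {1..n} \<Longrightarrow> f (f x) = x"
    and i': "x \<in> {1..n} \<Longrightarrow> i' x = i (f x)"
    and mono: "x \<in> {1..n} \<Longrightarrow> y \<in> {1..n} \<Longrightarrow> x \<noteq> y \<Longrightarrow> close (i' x) (i' y) \<Longrightarrow> x < y \<longleftrightarrow> f x < f y"
begin

lemma i: "x \<in> {1..n} \<Longrightarrow> i x = i' (f x)"
  using i'[of "f x"] maps invol by simp

lemma mono': "x \<in> {1..n} \<Longrightarrow> y \<in> {1..n} \<Longrightarrow> close (i x) (i y) \<Longrightarrow> x < y \<longleftrightarrow> f x < f y"
proof (cases "x = y")
  case False
  assume xy: "x \<in> {1..n}" "y \<in> {1..n}" "close (i x) (i y)"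
  then have "f x \<noteq> f y" using False invol by metis
  then show ?thesis
    using mono[OF maps[OF xy(1)] maps[OF xy(2)]] xy by (simp add: invol flip: i)
qed simp

lemma flip: "reindexing n f i' i"
  using mono' by unfold_locales (use maps invol i in blast)+

lemma between:
  assumes "1 \<le> k" "l \<le> n" "k < u" "u < l" "i l = i k" "close (i u) (i k)"
  shows "f k < f u \<and> f u < f l"
  using mono'[of k u] mono'[of u l] assms by (auto simp: close_def)

lemma consecutive_reindex:
  assumes "consecutive n i k l"
  shows "consecutive n i' (f k) (f l)"
proof -
  have kl: "k \<in> {1..n}" "l \<in> {1..n}" "i k = i l" "k < l"
    using assms by (auto simp: consecutive_def)
  have "i' u \<noteq> i' (f k)" if "f k < u" "u < f l" for u
  proof
    assume eq: "i' u = i' (f k)"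
    have u: "u \<in> {1..n}" using that maps[OF kl(1)] maps[OF kl(2)] by auto
    interpret r: reindexing n f i' i by (rule flip)
    have "k < f u \<and> f u < l"
      using r.between[of "f k" "f l" u] that eq maps[OF kl(1)] maps[OF kl(2)] invol kl i
      by (auto simp: close_def)
    then show False using assms eq i'[OF u] i[OF kl(1)] by (auto simp: consecutive_def)
  qed
  moreover have "f k < f l" using mono'[of k l] kl by (simp add: close_def)
  ultimately show ?thesis
    using maps[OF kl(1)] maps[OF kl(2)] kl i by (auto simp: consecutive_def)
qed

lemma value_between:
  assumes "consecutive n i k l" "b \<in> i ` {k<..<l}" "close b (i k)"
  shows "b \<in> i' ` {f k<..<f l}"
proof -
  from assms(2) obtain u where u: "b = i u" "k < u" "u < l" by auto
  have kl: "1 \<le> k" "l \<le> n" "i l = i k" using assms(1) by (auto simp: consecutive_def)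
  have "f k < f u \<and> f u < f l"
    by (rule between) (use kl u assms(3) in auto)
  moreover have "i' (f u) = b" using i[of u] u kl by simp
  ultimately show ?thesis by force
qed

lemma chain_reindex: "chain n p i k l \<Longrightarrow> chain n p i' (f k) (f l)"
proof (induction rule: chain.induct)
  case (base k l s)
  have "p \<in> i' ` {f k<..<f l}"
    by (rule value_between[OF base(1)]) (use base in \<open>auto simp: close_def intro!: image_eqI[of _ _ s]\<close>)
  moreover have "i' (f k) = i k" using base(1) i[of k] by (simp add: consecutive_def)
  ultimately show ?case using chain.base[OF consecutive_reindex[OF base(1)]] base(2) by auto
next
  case (step k l k' l')
  have kl: "1 \<le> k" "l \<le> n" "i l = i k" using step(1) by (auto simp: consecutive_def)
  have k'l': "1 \<le> k'" "k' < l'" "l' \<le> n" "i l' = i k'"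
    using chain_consecutive[OF step(2)] by (auto simp: consecutive_def)
  have "f k < f k'" using between[of k l k'] kl k'l' step by (auto simp: close_def)
  moreover have "f l' < f l" using between[of k l l'] kl k'l' step by (auto simp: close_def)
  moreover have "i' (f k') = i' (f k) + 1"
    using i[of k] i[of k'] kl k'l' step by auto
  ultimately show ?case
    using chain.step[OF consecutive_reindex[OF step(1)] step.IH] by blast
qed

lemma separated_reindex:
  assumes "consecutive n i k l" "separated h n i k l"
  shows "separated h n i' (f k) (f l)"
proof -
  have ik: "i' (f k) = i k" using assms(1) i[of k] by (simp add: consecutive_def)
  note vb = value_between[OF assms(1)]
  have up: "i k + 1 \<in> i ` {k<..<l} \<Longrightarrow> i k + 1 \<in> i' ` {f k<..<f l}"
    and down: "i k - 1 \<in> i ` {k<..<l} \<Longrightarrow> i k - 1 \<in> i' ` {f k<..<f l}"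
    using vb[of "i k + 1"] vb[of "i k - 1"] by (simp_all add: close_def le_diff_conv)
  \<comment> \<open>Monotonicity of the case distinction in its variable parts, proved once for
    arbitrary propositions.\<close>
  have aux: "case h of \<infinity> \<Rightarrow> B' | enat m \<Rightarrow> if odd m then X m \<and> (B' \<or> C' m) else if Y m then D' else B'"
    if "case h of \<infinity> \<Rightarrow> B | enat m \<Rightarrow> if odd m then X m \<and> (B \<or> C m) else if Y m then D else B"
      "B \<Longrightarrow> B'" "D \<Longrightarrow> D'" "\<And>m. C m \<Longrightarrow> C' m" for B B' D D' X Y C C'
    using that by (cases h) (auto split: if_splits)
  show ?thesis
    unfolding separated_def ik
  proof (intro conjI impI)
    assume "i k = 0"
    then show "1 \<in> i' ` {f k<..<f l}" using assms(2) up by (simp add: separated_def)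
  next
    assume "1 \<le> i k"
    then have "case h of \<infinity> \<Rightarrow> both_between i k l
        | enat m \<Rightarrow> if odd m then i k \<noteq> (m - 1) div 2 \<and> (both_between i k l \<or> chain n ((m - 1) div 2) i k l)
            else if i k = m div 2 - 1 then i k - 1 \<in> i ` {k<..<l} else both_between i k l"
      using assms(2) by (simp only: separated_def)
    then show "case h of \<infinity> \<Rightarrow> {i k - 1, i k + 1} \<subseteq> i' ` {f k<..<f l}
        | enat m \<Rightarrow> if odd m then i k \<noteq> (m - 1) div 2 \<and>
              ({i k - 1, i k + 1} \<subseteq> i' ` {f k<..<f l} \<or> chain n ((m - 1) div 2) i' (f k) (f l))
            else if i k = m div 2 - 1 then i k - 1 \<in> i' ` {f k<..<f l}
            else {i k - 1, i k + 1} \<subseteq> i' ` {f k<..<f l}"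
      by (rule aux) (use up down chain_reindex in blast)+
  qed
qed

lemma well_separated_reindex:
  assumes "well_separated h n i"
  shows "well_separated h n i'"
  unfolding well_separated_def
proof (intro allI impI)
  fix k l assume c: "consecutive n i' k l"
  interpret r: reindexing n f i' i by (rule flip)
  have kl: "k \<in> {1..n}" "l \<in> {1..n}" using c by (auto simp: consecutive_def)
  have c': "consecutive n i (f k) (f l)" by (rule r.consecutive_reindex[OF c])
  then have "separated h n i (f k) (f l)" using assms by (simp add: well_separated_def)
  from separated_reindex[OF c' this] show "separated h n i' k l"
    using kl by (simp add: invol)
qed

end

definition adj_swap :: "nat \<Rightarrow> nat \<Rightarrow> nat" where
  "adj_swap k x = (if x = k then k + 1 else if x = k + 1 then k else x)"

lemma adj_swap_simps [simp]:
  "adj_swap k k = Suc k" "adj_swap k (Suc k) = k"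
  "x \<noteq> k \<Longrightarrow> x \<noteq> Suc k \<Longrightarrow> adj_swap k x = x"
  by (auto simp: adj_swap_def)

lemma adj_swap_invol [simp]: "adj_swap k (adj_swap k x) = x"
  by (auto simp: adj_swap_def)

lemma adj_swap_reindexing:
  assumes "1 \<le> k" "k < n" "\<not> close (i k) (i (k + 1))"
  shows "reindexing n (adj_swap k) i (i \<circ> adj_swap k)"
proof
  fix x y assume "x \<in> {1..n}" "y \<in> {1..n}" "x \<noteq> y" "close ((i \<circ> adj_swap k) x) ((i \<circ> adj_swap k) y)"
  then show "x < y \<longleftrightarrow> adj_swap k x < adj_swap k y"
    using assms by (auto simp: adj_swap_def close_def split: if_splits)
qed (use assms in \<open>auto simp: adj_swap_def\<close>)

lemma well_separated_swap:
  assumes "well_separated h n i" "1 \<le> k" "k < n" "\<not> close (i k) (i (k + 1))"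
  shows "well_separated h n (i \<circ> adj_swap k)"
  using reindexing.well_separated_reindex[OF adj_swap_reindexing[OF assms(2-4)] assms(1)] .

text \<open>The patterns \<open>(a, b, a)\<close> that weights may contain in three consecutive positions.\<close>

definition tight :: "enat \<Rightarrow> nat \<Rightarrow> nat \<Rightarrow> bool" where
  "tight h a b \<longleftrightarrow> a = 0 \<and> b = 1 \<or>
     (\<exists>m. h = enat m \<and> odd m \<and> b = a + 1 \<and> b = (m - 1) div 2) \<or>
     (\<exists>m. h = enat m \<and> even m \<and> a = m div 2 - 1 \<and> a = b + 1)"

lemma obtain_consecutive:
  assumes "1 \<le> k" "k < l" "l \<le> n" "i k = i l"
  obtains l' where "consecutive n i k l'" "l' \<le> l"
proof -
  define l' where "l' = (LEAST u. k < u \<and> i u = i k)"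
  have l': "k < l' \<and> i l' = i k"
    unfolding l'_def by (rule LeastI[of _ l]) (use assms in auto)
  have "l' \<le> l" unfolding l'_def by (rule Least_le) (use assms in auto)
  moreover have "i u \<noteq> i k" if "k < u" "u < l'" for u
    using not_less_Least[of u "\<lambda>u. k < u \<and> i u = i k"] that unfolding l'_def by blast
  ultimately show thesis using that[of l'] l' assms by (auto simp: consecutive_def)
qed

text \<open>The one-sided readings of \<open>separated\<close> drive the induction below: a missing
  lower neighbour forces a chain, and by \<open>separated_up\<close> a missing upper one forces the
  top index of the even case.\<close>

lemma separated_down:
  assumes "separated h n i k l" "1 \<le> i k"
  shows "i k - 1 \<in> i ` {k<..<l} \<or>
    (\<exists>m. h = enat m \<and> odd m \<and> chain n ((m - 1) div 2) i k l \<and> i k \<noteq> (m - 1) div 2)"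
proof (cases h)
  case (enat m)
  then show ?thesis using assms unfolding separated_def by (cases "odd m") (simp_all split: if_splits, blast)
qed (use assms in \<open>simp add: separated_def\<close>)

lemma separated_up:
  assumes "separated h n i k l"
  shows "i k + 1 \<in> i ` {k<..<l} \<or> (\<exists>m. h = enat m \<and> even m \<and> i k = m div 2 - 1 \<and> 1 \<le> i k)"
proof (cases "i k = 0")
  case True
  then show ?thesis using assms by (simp add: separated_def)
next
  case False
  show ?thesis
  proof (cases h)
    case (enat m)
    then show ?thesis
      using assms False chain_between[of n "(m - 1) div 2" i k l] unfolding separated_def
      by (cases "odd m") (simp_all split: if_splits, blast)
  qed (use assms False in \<open>simp add: separated_def\<close>)
qed

context quantum
begin

text \<open>Induction on the length of the gap. If the entry next to one of its ends is not close to
  that end, a swap shortens the gap. Otherwise the entries next to the ends are a - 1 or a + 1,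
  where a is the repeated value. If they differ, both values occur. If they are the same entry,
  \<open>triple\<close> applies. If they are two occurrences of one value b, the inner gap between
  consecutive occurrences of b is separated by induction but contains no a, which only a chain
  permits.\<close>

lemma well_separated_if_closed:
  assumes idx: "\<And>i x. i \<in> W \<Longrightarrow> x \<in> {1..n} \<Longrightarrow> i x \<in> index_set h"
    and distinct: "\<And>i k. i \<in> W \<Longrightarrow> 1 \<le> k \<Longrightarrow> k < n \<Longrightarrow> i k \<noteq> i (k + 1)"
    and swap: "\<And>i k. i \<in> W \<Longrightarrow> 1 \<le> k \<Longrightarrow> k < n \<Longrightarrow> \<not> close (i k) (i (k + 1)) \<Longrightarrow> i \<circ> adj_swap k \<in> W"
    and triple: "\<And>i k. i \<in> W \<Longrightarrow> 1 \<le> k \<Longrightarrow> k + 2 \<le> n \<Longrightarrow> i k = i (k + 2) \<Longrightarrow> close (i k) (i (k + 1)) \<Longrightarrow>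
      tight h (i k) (i (k + 1))"
    and "i \<in> W"
  shows "well_separated h n i"
proof -
  have "consecutive n i k l \<Longrightarrow> separated h n i k l" if "i \<in> W" for i k l
    using that
  proof (induction "l - k" arbitrary: i k l rule: less_induct)
    case less
    note c = less.prems(1)
    have kl: "1 \<le> k" "k < l" "l \<le> n" "i l = i k" and gap: "\<And>u. k < u \<Longrightarrow> u < l \<Longrightarrow> i u \<noteq> i k"
      using c by (auto simp: consecutive_def)
    have "l \<noteq> k + 1" using distinct[OF less.prems(2), of k] kl by auto
    then have l2: "k + 2 \<le> l" using kl by simp
    show ?case
    proof (cases "close (i k) (i (k + 1))")
      case False
      interpret r: reindexing n "adj_swap k" i "i \<circ> adj_swap k"
        by (rule adj_swap_reindexing) (use kl False l2 in auto)
      have "consecutive n (i \<circ> adj_swap k) (k + 1) l"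
        using r.consecutive_reindex[OF c] l2 by simp
      moreover have "i \<circ> adj_swap k \<in> W" by (rule swap) (use less.prems kl False l2 in auto)
      ultimately have "separated h n (i \<circ> adj_swap k) (k + 1) l"
        using less.hyps[of l "k + 1"] kl by simp
      from reindexing.separated_reindex[OF r.flip \<open>consecutive n (i \<circ> adj_swap k) (k + 1) l\<close> this]
      show ?thesis using l2 by simp
    next
      case up: True
      show ?thesis
      proof (cases "close (i (l - 1)) (i l)")
        case False
        have l1: "l - 1 + 1 = l" using l2 by simp
        interpret r: reindexing n "adj_swap (l - 1)" i "i \<circ> adj_swap (l - 1)"
          by (rule adj_swap_reindexing) (use kl False l2 l1 in auto)
        have s: "adj_swap (l - 1) k = k" "adj_swap (l - 1) l = l - 1" "adj_swap (l - 1) (l - 1) = l"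
          using l2 by (auto simp: adj_swap_def)
        have c': "consecutive n (i \<circ> adj_swap (l - 1)) k (l - 1)"
          using r.consecutive_reindex[OF c] s by simp
        moreover have "i \<circ> adj_swap (l - 1) \<in> W" by (rule swap) (use less.prems kl False l2 l1 in auto)
        ultimately have "separated h n (i \<circ> adj_swap (l - 1)) k (l - 1)"
          using less.hyps[of "l - 1" k] kl by simp
        from reindexing.separated_reindex[OF r.flip c' this] show ?thesis using s by simp
      next
        case down: True
        define a where "a = i k"
        have k1: "i (k + 1) \<noteq> a" "i (l - 1) \<noteq> a"
          using gap[of "k + 1"] gap[of "l - 1"] l2 by (auto simp: a_def)
        have bds: "a \<in> index_set h" "i (k + 1) \<in> index_set h" "i (l - 1) \<in> index_set h"
        proof -
          have "k \<in> {1..n}" "k + 1 \<in> {1..n}" "l - 1 \<in> {1..n}" using l2 kl(1,3) by (simp, simp, simp, linarith)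
          then show "a \<in> index_set h" "i (k + 1) \<in> index_set h" "i (l - 1) \<in> index_set h"
            using idx[OF less.prems(2)] by (auto simp only: a_def)
        qed
        have mem: "i (k + 1) \<in> i ` {k<..<l}" "i (l - 1) \<in> i ` {k<..<l}" using l2 by auto
        \<comment> \<open>The occurrence of a + 1 also shows that a is not the top index, as the odd
          case requires.\<close>
        have both: "separated h n i k l" if "{a - 1, a + 1} \<subseteq> i ` {k<..<l}" "1 \<le> a"
        proof -
          from that have "a + 1 \<in> i ` {k<..<l}" by simp
          then obtain u where u: "a + 1 = i u" "u \<in> {k<..<l}" by (rule imageE)
          then have "a + 1 \<in> index_set h" using idx[OF less.prems(2), of u] kl by simp
          with that show ?thesis
            by (cases rule: index_max_cases) (simp_all add: separated_def a_def[symmetric] index_set_iff)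
        qed
        consider "l = k + 2" | "k + 2 < l" "i (k + 1) \<noteq> i (l - 1)" | "k + 2 < l" "i (k + 1) = i (l - 1)"
          using l2 by linarith
        then show ?thesis
        proof cases
          case 1
          then have "tight h a (i (k + 1))"
            using triple[OF less.prems(2), of k] kl up by (simp add: a_def)
          then show ?thesis unfolding tight_def
          proof (elim disjE exE conjE)
            assume "a = 0" "i (k + 1) = 1"
            then show ?thesis using mem(1) by (simp add: separated_def a_def)
          next
            fix m assume m: "h = enat m" "odd m" "i (k + 1) = a + 1" "i (k + 1) = (m - 1) div 2"
            have "chain n ((m - 1) div 2) i k l"
              by (rule chain.base[OF c, of _ "k + 1"]) (use m 1 in \<open>auto simp: a_def\<close>)
            then show ?thesis using m mem(1) by (auto simp: separated_def a_def)
          next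
            fix m assume m: "h = enat m" "even m" "a = m div 2 - 1" "a = i (k + 1) + 1"
            then show ?thesis using mem(1) by (auto simp: separated_def a_def)
          qed
        next
          case 2
          then have "{a - 1, a + 1} = {i (k + 1), i (l - 1)}" "1 \<le> a"
            using up down k1 kl(4) by (auto simp: close_def a_def[symmetric])
          then show ?thesis using both mem by simp
        next
          case 3
          define b where "b = i (k + 1)"
          obtain l' where l': "consecutive n i (k + 1) l'" "l' \<le> l - 1"
            by (rule obtain_consecutive[of "k + 1" "l - 1" n i]) (use 3 kl in auto)
          have sep: "separated h n i (k + 1) l'"
            by (rule less.hyps) (use l' kl less.prems in auto)
          \<comment> \<open>The inner gap lies inside the gap between k and l, where a does not
            occur.\<close>
          have na: "a \<notin> i ` {k + 1<..<l'}"
          proof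
            assume "a \<in> i ` {k + 1<..<l'}"
            then obtain u where u: "a = i u" "u \<in> {k + 1<..<l'}" by (rule imageE)
            then have "k < u" "u < l" using l'(2) kl(2) by auto
            then show False using gap[of u] u(1) by (simp add: a_def)
          qed
          have "b \<le> a + 1" "a \<le> b + 1" "b \<noteq> a"
            using up k1(1) by (simp_all add: close_def b_def flip: a_def)
          then consider "b = a + 1" | "a = b + 1" by linarith
          then show ?thesis
          proof cases
            case 1
            \<comment> \<open>The lower neighbour a of b is missing in the inner gap, so that gap is
              a chain, and the pair k, l adds one more link outside.\<close>
            then obtain m where m: "h = enat m" "odd m" "chain n ((m - 1) div 2) i (k + 1) l'" "b \<noteq> (m - 1) div 2"
              using separated_down[OF sep] na by (auto simp: b_def)
            have "chain n ((m - 1) div 2) i k l"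
              by (rule chain.step[OF c m(3)]) (use l' \<open>k + 2 < l\<close> 1 in \<open>auto simp: a_def b_def\<close>)
            moreover have "b \<le> (m - 1) div 2"
              using bds(2) m(1,2) by (simp add: index_set_iff index_max_def b_def)
            then have "a \<noteq> (m - 1) div 2" using 1 by linarith
            moreover have "a + 1 \<in> i ` {k<..<l}" using mem(1) 1 by (simp add: b_def)
            ultimately show ?thesis using m(1,2)
              by (cases "a = 0") (simp_all add: separated_def flip: a_def)
          next
            case 2
            \<comment> \<open>The missing upper neighbour makes b the top index, which is impossible
              because a = b + 1 is an index too.\<close>
            then obtain m where m: "h = enat m" "even m" "b = m div 2 - 1"
              using separated_up[OF sep] na by (auto simp: b_def)
            then show ?thesis using bds(1) 2 by (simp add: index_set_iff index_max_def)
          qed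
        qed
      qed
    qed
  qed
  then show ?thesis using \<open>i \<in> W\<close> by (auto simp: well_separated_def)
qed

text \<open>Every alternative of \<open>separated\<close> asks for a value strictly between the two
  positions.\<close>

lemma well_separated_distinct:
  assumes "well_separated h n i" "1 \<le> k" "k < n"
  shows "i k \<noteq> i (k + 1)"
proof
  assume "i k = i (k + 1)"
  then have "consecutive n i k (k + 1)" using assms by (simp add: consecutive_def)
  then have "separated h n i k (k + 1)" using assms by (simp add: well_separated_def)
  moreover have "{k<..<k + 1} = {}" by auto
  moreover have "\<not> chain n p i k (k + 1)" for p using chain_between[of n p i k "k + 1"] by auto
  ultimately show False
    by (cases "i k = 0") (auto simp: separated_def split: enat.splits if_splits)
qed

text \<open>A single position in between cannot carry two different values, and a chain around it
  can only be of the innermost kind; \<open>tight\<close> lists what is left.\<close>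

lemma well_separated_triple:
  assumes "well_separated h n i" "1 \<le> k" "k + 2 \<le> n" "i k = i (k + 2)"
  shows "tight h (i k) (i (k + 1))"
proof -
  have "consecutive n i k (k + 2)"
    using assms well_separated_distinct[OF assms(1), of k]
    by (auto simp: consecutive_def dest!: Suc_leI less_antisym simp: less_Suc_eq_le)
  then have sep: "separated h n i k (k + 2)" using assms by (simp add: well_separated_def)
  have int: "{k<..<Suc (Suc k)} = {Suc k}" by auto
  have chain: "i k + 1 = p \<and> i (k + 1) = p" if "chain n p i k (k + 2)" for p
  proof -
    have "i k + 1 = p \<and> (\<exists>s. k < s \<and> s < k + 2 \<and> i s = p)"
      using that by cases (auto dest: chain_less)
    moreover have "s = k + 1" if "k < s" "s < k + 2" for s using that by simp
    ultimately show ?thesis by blast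
  qed
  show ?thesis
  proof (cases "i k = 0")
    case True
    then have "1 \<in> i ` {k<..<k + 2}" using sep by (simp only: separated_def simp_thms)
    then obtain v where "1 = i v" "v \<in> {k<..<k + 2}" by (rule imageE)
    from this(2) have "v = k + 1" by simp
    have "i (k + 1) = 1" using \<open>1 = i v\<close> unfolding \<open>v = k + 1\<close> by (rule sym)
    with True show ?thesis by (simp add: tight_def)
  next
    case False
    then show ?thesis
      using sep chain by (cases rule: index_max_cases)
        (auto simp: separated_def int tight_def split: if_splits)
  qed
qed

end

section \<open>Chains and the sequences of condition (5b)\<close>

lemma chain_sequence:
  assumes "chain n p i k l"
  shows "\<exists>r t s. r 0 = k \<and> t 0 = l \<and> i k < p \<and> i s = p \<and>
    (\<forall>j. i k + j < p \<longrightarrow> r j < s \<and> s < t j \<and> i (r j) = i k + j \<and> i (t j) = i k + j \<and>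
      (\<forall>u. r j < u \<and> u < t j \<longrightarrow> i u \<noteq> i k + j)) \<and>
    (\<forall>j. i k + j + 1 < p \<longrightarrow> r j < r (j + 1) \<and> t (j + 1) < t j)"
  using assms
proof (induction rule: chain.induct)
  case (base k l s)
  then show ?case
    by - (rule exI[of _ "\<lambda>_. k"], rule exI[of _ "\<lambda>_. l"], rule exI[of _ s], auto simp: consecutive_def)
next
  case (step k l k' l')
  then obtain r t s where IH: "r 0 = k'" "t 0 = l'" "i k' < p" "i s = p"
    "\<forall>j. i k' + j < p \<longrightarrow> r j < s \<and> s < t j \<and> i (r j) = i k' + j \<and> i (t j) = i k' + j \<and>
      (\<forall>u. r j < u \<and> u < t j \<longrightarrow> i u \<noteq> i k' + j)"
    "\<forall>j. i k' + j + 1 < p \<longrightarrow> r j < r (j + 1) \<and> t (j + 1) < t j"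
    by blast
  \<comment> \<open>A new outermost link is prepended, which shifts the inner sequences by
    one.\<close>
  let ?r = "\<lambda>j. case j of 0 \<Rightarrow> k | Suc j \<Rightarrow> r j"
  let ?t = "\<lambda>j. case j of 0 \<Rightarrow> l | Suc j \<Rightarrow> t j"
  have "r 0 < s \<and> s < t 0" using IH(3,5) by (metis add.right_neutral)
  then have s: "k < s" "s < l" using step IH(1,2) by auto
  show ?case
  proof (rule exI[of _ ?r], rule exI[of _ ?t], rule exI[of _ s], intro conjI allI impI)
    fix j assume j: "i k + j + 1 < p"
    show "?r j < ?r (j + 1)" "?t (j + 1) < ?t j"
      using j IH(1,2,6) step by (auto split: nat.split)
  next
    fix j assume j: "i k + j < p"
    show "?r j < s" "s < ?t j" "i (?r j) = i k + j" "i (?t j) = i k + j"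
      using j IH(5) step(1,5) s by (auto split: nat.split simp: consecutive_def)
    fix u assume "?r j < u \<and> u < ?t j"
    then show "i u \<noteq> i k + j" using j IH(5) step(1,5) by (cases j) (auto simp: consecutive_def)
  qed (use IH step in auto)
qed

lemma chain_odd_sequence:
  assumes "chain n p i k l"
  shows "odd_sequence (2 * p + 1) i k l"
proof -
  from chain_sequence[OF assms] obtain r t s where rts: "r 0 = k" "t 0 = l" "i k < p" "i s = p"
    "\<And>j. i k + j < p \<Longrightarrow> r j < s \<and> s < t j \<and> i (r j) = i k + j \<and> i (t j) = i k + j \<and>
      (\<forall>u. r j < u \<and> u < t j \<longrightarrow> i u \<noteq> i k + j)"
    "\<And>j. i k + j + 1 < p \<Longrightarrow> r j < r (j + 1) \<and> t (j + 1) < t j"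
    by blast
  have mono: "r a < r b \<and> t b < t a" if "a < b" "i k + b < p" for a b
    using that
  proof (induction b)
    case (Suc b)
    then show ?case using rts(6)[of b] by (cases "a = b") auto
  qed simp
  have ends: "k \<le> r j \<and> t j \<le> l" if "i k + j < p" for j
    using mono[of 0 j] that rts(1,2) by (cases "j = 0") auto
  \<comment> \<open>The bound (h - 3)/2 is p - 1, and \<open>i k < p\<close> keeps the subtraction
    of naturals from truncating.\<close>
  have J: "i k + j \<le> (2 * p + 1 - 3) div 2 \<longleftrightarrow> i k + j < p" for j
    using rts(3) by auto
  have s: "k < s" "s < l" using rts(5)[of 0] rts(1-3) by auto
  show ?thesis
    unfolding odd_sequence_def Let_def J
    by (rule exI[of _ r], rule exI[of _ t], rule exI[of _ s])
      (use mono ends rts(4,5) s in \<open>auto simp: strict_mono_on_def\<close>)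
qed

lemma odd_sequence_mono:
  assumes "odd_sequence m i k l'" "l' \<le> l"
  shows "odd_sequence m i k l"
proof -
  let ?J = "{j. i k + j \<le> (m - 3) div 2}"
  from assms(1) obtain r t s where A: "k \<le> s" "s \<le> l'" "i s = (m - 1) div 2"
    "strict_mono_on ?J r" "\<forall>a\<in>?J. \<forall>b\<in>?J. a < b \<longrightarrow> t b < t a"
    and B: "\<forall>j\<in>?J. k \<le> r j \<and> r j < s \<and> s < t j \<and> t j \<le> l' \<and> i (r j) = i k + j \<and> i (t j) = i k + j \<and>
      (\<forall>u. r j < u \<and> u < t j \<longrightarrow> i u \<noteq> i k + j)"
    unfolding odd_sequence_def Let_def by (elim exE conjE)
  have C: "\<forall>j\<in>?J. k \<le> r j \<and> r j < s \<and> s < t j \<and> t j \<le> l \<and> i (r j) = i k + j \<and> i (t j) = i k + j \<and>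
      (\<forall>u. r j < u \<and> u < t j \<longrightarrow> i u \<noteq> i k + j)"
    using B order_trans[OF _ assms(2)] by blast
  show ?thesis
    unfolding odd_sequence_def Let_def
    by (rule exI[of _ r], rule exI[of _ t], rule exI[of _ s],
        intro conjI A(1,3,4,5) C order_trans[OF A(2) assms(2)])
qed

text \<open>The links are assembled from the innermost pair outwards. Since k and l are consecutive
  occurrences, the outermost pair of the sequence can only be k and l themselves.\<close>

lemma odd_sequence_chain:
  assumes c: "consecutive n i k l" and "odd_sequence (2 * p + 1) i k l" "i k < p"
  shows "chain n p i k l"
proof -
  have J: "i k + j \<le> (2 * p + 1 - 3) div 2 \<longleftrightarrow> i k + j < p" for j
    using assms(3) by auto
  from assms(2) obtain r t s where s: "i s = (2 * p + 1 - 1) div 2"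
    and mono: "strict_mono_on {j. i k + j < p} r"
      "\<forall>a\<in>{j. i k + j < p}. \<forall>b\<in>{j. i k + j < p}. a < b \<longrightarrow> t b < t a"
    and rt': "\<forall>j\<in>{j. i k + j < p}. k \<le> r j \<and> r j < s \<and> s < t j \<and> t j \<le> l \<and>
             i (r j) = i k + j \<and> i (t j) = i k + j \<and>
             (\<forall>u. r j < u \<and> u < t j \<longrightarrow> i u \<noteq> i k + j)"
    unfolding odd_sequence_def Let_def J by (elim exE conjE)
  have mono: "r a < r b \<and> t b < t a" if "i k + a < p" "i k + b < p" "a < b" for a b
    using mono that by (simp add: strict_mono_on_def)
  have rt: "k \<le> r j \<and> r j < s \<and> s < t j \<and> t j \<le> l \<and>
             i (r j) = i k + j \<and> i (t j) = i k + j \<and>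
             (\<forall>u. r j < u \<and> u < t j \<longrightarrow> i u \<noteq> i k + j)" if "i k + j < p" for j
    using rt' that by blast
  have s: "i s = p" using s by simp
  have cj: "consecutive n i (r j) (t j)" if "i k + j < p" for j
    using rt[OF that] c unfolding consecutive_def by auto
  have "chain n p i (r j) (t j)" if "i k + j < p" for j
    using that
  proof (induction "p - (i k + j)" arbitrary: j)
    case (Suc d)
    show ?case
    proof (cases "i k + j + 1 = p")
      case True
      then show ?thesis using chain.base[OF cj[OF Suc(3)], of p s] rt[OF Suc(3)] s by auto
    next
      case False
      then have j: "i k + (j + 1) < p" using Suc(3) by simp
      have "chain n p i (r (j + 1)) (t (j + 1))" using Suc j by simp
      then show ?thesis
        using chain.step[OF cj[OF Suc(3)]] mono[OF Suc(3) j] rt[OF j] rt[OF Suc(3)] by simp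
    qed
  qed simp
  from this[of 0] have "chain n p i (r 0) (t 0)" using assms(3) by simp
  moreover
  have 0: "k \<le> r 0" "r 0 < t 0" "t 0 \<le> l" "i (r 0) = i k" "i (t 0) = i k"
    using rt[of 0] assms(3) by auto
  have gap: "i u \<noteq> i k" if "k < u" "u < l" for u
    using c that unfolding consecutive_def by blast
  have "r 0 = k" using gap[of "r 0"] 0 by (cases "k < r 0") auto
  moreover have "t 0 = l" using gap[of "t 0"] 0 by (cases "t 0 < l") auto
  ultimately show ?thesis by simp
qed

text \<open>In the even case every row of the array lists consecutive occurrences of its value, and
  between two of them the next lower value occurs exactly once.\<close>

lemma unique_below:
  assumes "well_separated h n i" and h: "h = enat (2 * p + 2)"
    and idx: "\<And>x. x \<in> {1..n} \<Longrightarrow> i x \<in> index_set h"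
    and c: "consecutive n i k l" and "1 \<le> i k"
  shows "\<exists>!u. k < u \<and> u < l \<and> i u = i k - 1"
proof -
  have sep: "separated h n i k l" using assms by (simp add: well_separated_def)
  have kl: "1 \<le> k" "l \<le> n" and gap: "\<And>u. k < u \<Longrightarrow> u < l \<Longrightarrow> i u \<noteq> i k"
    using c by (auto simp: consecutive_def)
  have p: "i k \<le> p" using idx[of k] c h by (auto simp: consecutive_def index_set_iff index_max_def)
  have "i k - 1 \<in> i ` {k<..<l}"
    using separated_down[OF sep assms(5)] h by auto
  then obtain u where u: "i k - 1 = i u" "u \<in> {k<..<l}" by (rule imageE)
  \<comment> \<open>Two occurrences of \<open>i k - 1\<close> would enclose an \<open>i k\<close>,
    because \<open>i k - 1\<close> is not the top index and so needs its upper neighbour; but the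
    gap contains none.\<close>
  have no: False if xy: "k < x" "x < y" "y < l" "i x = i k - 1" "i y = i k - 1" for x y
  proof -
    obtain y' where y': "consecutive n i x y'" "y' \<le> y"
      by (rule obtain_consecutive[of x y n i]) (use xy kl in auto)
    then have "separated h n i x y'" using assms(1) by (simp add: well_separated_def)
    moreover have "i x \<noteq> p" using xy(4) p assms(5) by simp
    ultimately have "i x + 1 \<in> i ` {x<..<y'}"
      using separated_up[of h n i x y'] h by auto
    then obtain v where "i x + 1 = i v" "v \<in> {x<..<y'}" by (rule imageE)
    then show False using gap[of v] xy y'(2) assms(5) by simp
  qed
  show ?thesis
  proof (rule ex1I[of _ u])
    show "k < u \<and> u < l \<and> i u = i k - 1" using u by simp
    fix v assume v: "k < v \<and> v < l \<and> i v = i k - 1"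
    show "v = u"
    proof (rule ccontr)
      assume "v \<noteq> u"
      then consider "v < u" | "u < v" by linarith
      then show False using no[of v u] no[of u v] u v by cases auto
    qed
  qed
qed

text \<open>Both functions enumerate all of P increasingly, so \<open>f b\<close> and
  \<open>g b\<close> have exactly b - 1 elements of P below them; elements of equal rank
  coincide.\<close>

lemma strict_mono_enum_unique:
  fixes f g :: "nat \<Rightarrow> nat"
  assumes fin: "finite P" and m: "card P = m"
    and f: "\<And>b. 1 \<le> b \<Longrightarrow> b \<le> m \<Longrightarrow> f b \<in> P" "\<And>b. 1 \<le> b \<Longrightarrow> b < m \<Longrightarrow> f b < f (b + 1)"
    and g: "\<And>b. 1 \<le> b \<Longrightarrow> b \<le> m \<Longrightarrow> g b \<in> P" "\<And>b. 1 \<le> b \<Longrightarrow> b < m \<Longrightarrow> g b < g (b + 1)"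
    and b: "1 \<le> b" "b \<le> m"
  shows "f b = g b"
proof -
  have count: "card {u \<in> P. u < f b} = b - 1"
    if f: "\<And>b. 1 \<le> b \<Longrightarrow> b \<le> m \<Longrightarrow> f b \<in> P" "\<And>b. 1 \<le> b \<Longrightarrow> b < m \<Longrightarrow> f b < f (b + 1)" for f :: "nat \<Rightarrow> nat"
  proof -
    have mono: "f x < f y" if "1 \<le> x" "x < y" "y \<le> m" for x y
      using that
    proof (induction y)
      case (Suc y)
      then show ?case using f(2)[of y] by (cases "x = y") auto
    qed simp
    have inj: "inj_on f {1..m}"
      by (rule inj_onI) (metis atLeastAtMost_iff less_irrefl linorder_neqE_nat mono)
    have img: "f ` {1..m} = P"
    proof (rule card_subset_eq[OF fin])
      show "f ` {1..m} \<subseteq> P" using f(1) by auto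
      show "card (f ` {1..m}) = card P" unfolding card_image[OF inj] using m by simp
    qed
    have "{u \<in> P. u < f b} = f ` {1..<b}"
    proof (intro equalityI subsetI)
      fix u assume "u \<in> {u \<in> P. u < f b}"
      then obtain x where x: "u = f x" "x \<in> {1..m}" "f x < f b" using img by auto
      then have "x < b" using mono[of b x] b by (cases "x = b"; cases "b < x") auto
      then show "u \<in> f ` {1..<b}" using x by simp
    qed (use mono f(1) b in auto)
    moreover have "{1..<b} \<subseteq> {1..m}" using b by auto
    ultimately show ?thesis
      using card_image[OF inj_on_subset[OF inj]] by simp
  qed
  have "card {u \<in> P. u < f b} = card {u \<in> P. u < g b}"
    using count[of f, OF f(1) f(2)] count[of g, OF g(1) g(2)] by simp
  moreover have "card {u \<in> P. u < x} < card {u \<in> P. u < y}" if "x \<in> P" "x < y" for x y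
    by (rule psubset_card_mono) (use fin that in auto)
  ultimately have "\<not> f b < g b" "\<not> g b < f b"
    using f(1)[OF b] g(1)[OF b] by fastforce+
  then show ?thesis by simp
qed

lemma even_array_iff:
  "even_array h i m \<kappa> \<longleftrightarrow> (\<forall>a b. (a, b) \<in> even_index h m \<longrightarrow>
     i (\<kappa> (a, b)) = h div 2 - a \<and>
     ((a + 1, b) \<in> even_index h m \<and> (a, b + 1) \<in> even_index h m \<longrightarrow>
        \<kappa> (a, b) < \<kappa> (a + 1, b) \<and> \<kappa> (a + 1, b) < \<kappa> (a, b + 1)) \<and>
     ((a, b + 1) \<in> even_index h m \<longrightarrow>
        (\<forall>u. \<kappa> (a, b) < u \<and> u < \<kappa> (a, b + 1) \<longrightarrow> i u \<noteq> h div 2 - a)) \<and>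
     ((a + 1, b) \<in> even_index h m \<and> (a, b + 1) \<in> even_index h m \<longrightarrow>
        (\<forall>u \<in> {\<kappa> (a, b)..\<kappa> (a, b + 1)}. i u = h div 2 - a - 1 \<longleftrightarrow> u = \<kappa> (a + 1, b))))"
  unfolding even_array_def by (simp only: Ball_def split_paired_All prod.case)

context
  fixes h :: enat and n p :: nat and i :: "nat \<Rightarrow> nat" and k l :: nat
  assumes ws: "well_separated h n i" and h: "h = enat (2 * p + 2)" and p: "1 \<le> p"
    and idx: "\<And>x. x \<in> {1..n} \<Longrightarrow> i x \<in> index_set h"
    and kl: "1 \<le> k" "k < l" "l \<le> n" "i k = p" "i l = p"
begin

private definition P where "P = {t \<in> {k..l}. i t = p}"
private definition m where "m = card P"

text \<open>Row \<open>Suc a\<close> of this array, counted from 1, is row \<open>a + 1\<close> in the numbering of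
  \<^const>\<open>even_array\<close>; the value in it is \<open>p - a\<close>.\<close>

private primrec row :: "nat \<Rightarrow> nat \<Rightarrow> nat" where
  "row 0 = (\<lambda>b. sorted_list_of_set P ! (b - 1))"
| "row (Suc a) = (\<lambda>b. THE u. row a b < u \<and> u < row a (b + 1) \<and> i u = p - Suc a)"

private lemma finP: "finite P" by (simp add: P_def)

private lemma row_0:
  assumes "1 \<le> b" "b \<le> m"
  shows "row 0 b \<in> P" "b < m \<Longrightarrow> consecutive n i (row 0 b) (row 0 (b + 1))"
proof -
  have len: "length (sorted_list_of_set P) = m" by (simp add: m_def)
  have set: "set (sorted_list_of_set P) = P" using finP by simp
  show bP: "row 0 b \<in> P"
    using nth_mem[of "b - 1" "sorted_list_of_set P"] assms len set by simp
  assume "b < m"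
  have b1P: "row 0 (b + 1) \<in> P"
    using nth_mem[of b "sorted_list_of_set P"] \<open>b < m\<close> len set by simp
  have srt: "sorted_wrt (<) (sorted_list_of_set P)" by simp
  have less: "sorted_list_of_set P ! x < sorted_list_of_set P ! y" if "x < y" "y < m" for x y
    using sorted_wrt_nth_less[OF srt that(1)] that len by simp
  have "i u \<noteq> p" if u: "row 0 b < u" "u < row 0 (b + 1)" for u
  proof
    assume "i u = p"
    then have "u \<in> set (sorted_list_of_set P)" using u bP b1P set by (auto simp: P_def)
    then obtain x where x: "u = sorted_list_of_set P ! x" "x < m" using len by (metis in_set_conv_nth)
    have "b - 1 < m" using assms by linarith
    then have "\<not> x \<le> b - 1" using less[of x "b - 1"] x u assms by (cases "x = b - 1") auto
    moreover have "\<not> b \<le> x" using less[of b x] x u by (cases "x = b") auto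
    ultimately show False by simp
  qed
  moreover have "row 0 b < row 0 (b + 1)" using less[of "b - 1" b] assms \<open>b < m\<close> by simp
  moreover have "k \<le> row 0 b" "i (row 0 b) = p" "row 0 (b + 1) \<le> l" "i (row 0 (b + 1)) = p"
    using bP b1P unfolding P_def mem_Collect_eq atLeastAtMost_iff by blast+
  ultimately have *: "k \<le> row 0 b" "i (row 0 b) = p" "row 0 (b + 1) \<le> l" "i (row 0 (b + 1)) = p"
    "row 0 b < row 0 (b + 1)" "\<And>u. row 0 b < u \<Longrightarrow> u < row 0 (b + 1) \<Longrightarrow> i u \<noteq> p"
    by blast+
  have "consecutive n i x y"
    if "1 \<le> x" "x < y" "y \<le> n" "i x = p" "i y = p" "\<And>u. x < u \<Longrightarrow> u < y \<Longrightarrow> i u \<noteq> p" for x y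
    using that by (simp add: consecutive_def)
  from this[OF order_trans[OF kl(1) *(1)] *(5) order_trans[OF *(3) kl(3)] *(2,4,6)]
  show "consecutive n i (row 0 b) (row 0 (b + 1))" .
qed

private lemma row_Suc_step:
  assumes "a < p" "consecutive n i (row a b) (row a (b + 1))" "i (row a b) = p - a"
  shows "row a b < row (Suc a) b \<and> row (Suc a) b < row a (b + 1) \<and> i (row (Suc a) b) = p - Suc a"
    "\<And>u. row a b < u \<Longrightarrow> u < row a (b + 1) \<Longrightarrow> i u = p - Suc a \<Longrightarrow> u = row (Suc a) b"
proof -
  have ex: "\<exists>!u. row a b < u \<and> u < row a (b + 1) \<and> i u = p - Suc a"
    using unique_below[OF ws h idx assms(2)] assms(1,3) by simp
  show "row a b < row (Suc a) b \<and> row (Suc a) b < row a (b + 1) \<and> i (row (Suc a) b) = p - Suc a"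
    using theI'[OF ex] by simp
  fix u assume "row a b < u" "u < row a (b + 1)" "i u = p - Suc a"
  then show "u = row (Suc a) b" using the1_equality[OF ex, of u] by simp
qed

text \<open>Neighbouring entries of row \<open>Suc a\<close> lie in neighbouring gaps of row a. Each
  of these gaps holds the value \<open>p - Suc a\<close> exactly once, and the entry of row a
  between them has another value, so the two entries are consecutive occurrences.\<close>

private lemma row_props:
  assumes "a \<le> p" "1 \<le> b" "b + a \<le> m"
  shows "row a b \<in> {k..l} \<and> i (row a b) = p - a \<and>
    (b + a < m \<longrightarrow> consecutive n i (row a b) (row a (b + 1)))"
  using assms
proof (induction a arbitrary: b)
  case 0
  then show ?case using row_0[of b] by (auto simp: P_def)
next
  case (Suc a)
  have IH: "row a b' \<in> {k..l} \<and> i (row a b') = p - a \<and>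
      (b' + a < m \<longrightarrow> consecutive n i (row a b') (row a (b' + 1)))" if "1 \<le> b'" "b' + a \<le> m" for b'
    using Suc.IH[of b'] Suc.prems(1) that by simp
  have b: "consecutive n i (row a b) (row a (b + 1))" using IH[of b] Suc.prems by simp
  have ap: "a < p" using Suc.prems by simp
  note st = row_Suc_step[OF ap b]
  have ib: "i (row a b) = p - a" using IH[of b] Suc.prems by simp
  note s1 = st(1)[OF ib] and s2 = st(2)[OF ib]
  have in1: "row a b \<in> {k..l}" "row a (b + 1) \<in> {k..l}"
    using IH[of b] IH[of "b + 1"] Suc.prems by auto
  have "consecutive n i (row (Suc a) b) (row (Suc a) (b + 1))" if lt: "b + Suc a < m"
  proof -
    have b1: "consecutive n i (row a (b + 1)) (row a (b + 1 + 1))" "i (row a (b + 1)) = p - a"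
      using IH[of "b + 1"] lt by auto
    note t1 = row_Suc_step(1)[OF ap b1] and t2 = row_Suc_step(2)[OF ap b1]
    have in2: "row a (b + 1 + 1) \<in> {k..l}" using IH[of "b + 1 + 1"] lt by auto
    have "i u \<noteq> i (row (Suc a) b)" if u: "row (Suc a) b < u" "u < row (Suc a) (b + 1)" for u
    proof
      assume eq: "i u = i (row (Suc a) b)"
      consider "u < row a (b + 1)" | "u = row a (b + 1)" | "row a (b + 1) < u" by linarith
      then show False
      proof cases
        case 1
        then have "u = row (Suc a) b" using s2[of u] s1 u eq by simp
        then show False using u by simp
      next
        case 2
        then show False using eq s1 b1(2) ap by simp
      next
        case 3
        then have "u = row (Suc a) (b + 1)" using t2[of u] t1 s1 u eq by simp
        then show False using u by simp
      qed
    qed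
    then show ?thesis using s1 t1 in1 in2 kl by (auto simp: consecutive_def)
  qed
  then show ?case using s1 in1 by auto
qed

lemma even_unique_array: "even_unique_array (2 * p + 2) i k l"
proof -
  have hd: "(2 * p + 2) div 2 = p + 1" by simp
  have P: "{t \<in> {k..l}. i t = (2 * p + 2) div 2 - 1} = P" by (simp add: P_def)
  define EE where "EE = even_index (2 * p + 2) m"
  have E: "(Suc a, b) \<in> EE \<longleftrightarrow> a \<le> p \<and> 1 \<le> b \<and> b + a \<le> m" for a b
    by (auto simp: even_index_def EE_def)
  have E0: "(0, b) \<notin> EE" for b by (simp add: even_index_def EE_def)
  define \<kappa> where "\<kappa> = restrict (\<lambda>(a, b). row (a - 1) b) EE"
  have \<kappa>: "\<kappa> (Suc a, b) = row a b" if "(Suc a, b) \<in> EE" for a b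
    using that by (simp add: \<kappa>_def)
  have \<kappa>E: "\<kappa> \<in> EE \<rightarrow>\<^sub>E {k..l}"
    unfolding \<kappa>_def
  proof (rule restrict_PiE_iff[THEN iffD2], rule ballI, clarify)
    fix a b assume ab: "(a, b) \<in> EE"
    then obtain a' where "a = Suc a'" using E0 by (cases a) auto
    then have "a' \<le> p \<and> 1 \<le> b \<and> b + a' \<le> m" using ab by (simp only: E)
    then show "row (a - 1) b \<in> {k..l}" using row_props[of a' b] \<open>a = Suc a'\<close> by simp
  qed
  have arr: "even_array (2 * p + 2) i m \<kappa>"
    unfolding even_array_iff EE_def[symmetric]
  proof (intro allI impI)
    fix a b assume ab: "(a, b) \<in> EE"
    then obtain a' where a: "a = Suc a'" using E0 by (cases a) auto
    have r: "a' \<le> p" "1 \<le> b" "b + a' \<le> m" using ab E[of a' b] by (simp_all add: a)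
    note rp = row_props[OF r]
    have 1: "i (\<kappa> (a, b)) = (2 * p + 2) div 2 - a" using rp \<kappa>[of a' b] ab a by simp
    have 2: "\<kappa> (a, b) < \<kappa> (a + 1, b) \<and> \<kappa> (a + 1, b) < \<kappa> (a, b + 1) \<and>
        (\<forall>u \<in> {\<kappa> (a, b)..\<kappa> (a, b + 1)}. i u = (2 * p + 2) div 2 - a - 1 \<longleftrightarrow> u = \<kappa> (a + 1, b))"
      if ab': "(a + 1, b) \<in> EE" "(a, b + 1) \<in> EE"
    proof -
      have r': "a' < p" "b + a' < m"
        using ab' E[of "Suc a'" b] E[of a' "b + 1"] by (simp_all add: a)
      have c: "consecutive n i (row a' b) (row a' (b + 1))" "i (row a' b) = p - a'"
        using rp r' by auto
      have eqs: "\<kappa> (a, b) = row a' b" "\<kappa> (a + 1, b) = row (Suc a') b" "\<kappa> (a, b + 1) = row a' (b + 1)"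
        using \<kappa>[of a' b] \<kappa>[of "Suc a'" b] \<kappa>[of a' "b + 1"] ab ab' a by auto
      note s1 = row_Suc_step(1)[OF r'(1) c] and s2 = row_Suc_step(2)[OF r'(1) c]
      have e: "i (row a' (b + 1)) = p - a'" using c by (simp add: consecutive_def)
      have "i u = (2 * p + 2) div 2 - a - 1 \<longleftrightarrow> u = row (Suc a') b"
        if u: "u \<in> {row a' b..row a' (b + 1)}" for u
      proof
        assume iu: "i u = (2 * p + 2) div 2 - a - 1"
        then have "u \<noteq> row a' b" "u \<noteq> row a' (b + 1)" using c(2) e r'(1) a by auto
        then show "u = row (Suc a') b" using s2[of u] u iu a by auto
      qed (use s1 a in simp)
      then show ?thesis using s1 unfolding eqs by blast
    qed
    have 3: "\<forall>u. \<kappa> (a, b) < u \<and> u < \<kappa> (a, b + 1) \<longrightarrow> i u \<noteq> (2 * p + 2) div 2 - a"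
      if ab': "(a, b + 1) \<in> EE"
    proof -
      have "b + a' < m" using ab' E[of a' "b + 1"] by (simp add: a)
      then have "consecutive n i (row a' b) (row a' (b + 1))" "i (row a' b) = p - a'" using rp by auto
      then show ?thesis
        using \<kappa>[of a' b] \<kappa>[of a' "b + 1"] ab ab' a by (auto simp: consecutive_def)
    qed
    show "i (\<kappa> (a, b)) = (2 * p + 2) div 2 - a \<and>
        ((a + 1, b) \<in> EE \<and> (a, b + 1) \<in> EE \<longrightarrow>
           \<kappa> (a, b) < \<kappa> (a + 1, b) \<and> \<kappa> (a + 1, b) < \<kappa> (a, b + 1)) \<and>
        ((a, b + 1) \<in> EE \<longrightarrow>
           (\<forall>u. \<kappa> (a, b) < u \<and> u < \<kappa> (a, b + 1) \<longrightarrow> i u \<noteq> (2 * p + 2) div 2 - a)) \<and>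
        ((a + 1, b) \<in> EE \<and> (a, b + 1) \<in> EE \<longrightarrow>
           (\<forall>u \<in> {\<kappa> (a, b)..\<kappa> (a, b + 1)}. i u = (2 * p + 2) div 2 - a - 1 \<longleftrightarrow> u = \<kappa> (a + 1, b)))"
      using 1 2 3 by blast
  qed
  \<comment> \<open>The top row must list the m occurrences of p in increasing order; every further
    row is then determined gap by gap.\<close>
  have uniq: "\<mu> = \<kappa>" if \<mu>: "\<mu> \<in> EE \<rightarrow>\<^sub>E {k..l}" "even_array (2 * p + 2) i m \<mu>" for \<mu>
  proof -
    have A: "i (\<mu> (a, b)) = (2 * p + 2) div 2 - a"
      "(a + 1, b) \<in> EE \<Longrightarrow> (a, b + 1) \<in> EE \<Longrightarrow> \<mu> (a, b) < \<mu> (a + 1, b) \<and> \<mu> (a + 1, b) < \<mu> (a, b + 1)"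
      if "(a, b) \<in> EE" for a b
      using \<mu>(2)[unfolded even_array_iff EE_def[symmetric]] that by simp_all
    have "\<mu> (Suc a, b) = row a b" if "(Suc a, b) \<in> EE" for a b
      using that
    proof (induction a arbitrary: b)
      case 0
      show ?case
      proof (rule strict_mono_enum_unique[where f = "\<lambda>b. \<mu> (Suc 0, b)" and g = "row 0",
            OF finP m_def[symmetric]])
        fix b assume b: "1 \<le> b" "b \<le> m"
        then have bE: "(Suc 0, b) \<in> EE" unfolding E by simp
        then show "\<mu> (Suc 0, b) \<in> P" using A(1)[OF bE] PiE_mem[OF \<mu>(1) bE] by (simp add: P_def)
        show "row 0 b \<in> P" using row_0(1)[OF b] .
      next
        fix b assume b: "1 \<le> b" "b < m"
        \<comment> \<open>The order within the top row is only given through an entry of the row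
          below, which exists because 1 \<le> p.\<close>
        then have bE: "(Suc 0, b) \<in> EE" "(Suc 0, b + 1) \<in> EE" "(Suc 0 + 1, b) \<in> EE"
          using p E[of 0 b] E[of 0 "b + 1"] E[of "Suc 0" b] by simp_all
        show "\<mu> (Suc 0, b) < \<mu> (Suc 0, b + 1)" using A(2)[OF bE(1) bE(3) bE(2)] by simp
        show "row 0 b < row 0 (b + 1)" using row_0(2)[of b] b by (simp add: consecutive_def)
      qed (use 0 in \<open>auto simp: E\<close>)
    next
      case (Suc a)
      have r: "a < p" "1 \<le> b" "b + a < m" using Suc.prems E[of "Suc a" b] by simp_all
      then have bE: "(Suc a, b) \<in> EE" "(Suc a, b + 1) \<in> EE"
        using E[of a b] E[of a "b + 1"] by simp_all
      have c: "consecutive n i (row a b) (row a (b + 1))" "i (row a b) = p - a"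
        using row_props[of a b] r by auto
      have "row a b < \<mu> (Suc (Suc a), b)" "\<mu> (Suc (Suc a), b) < row a (b + 1)"
        using A(2)[OF bE(1) _ bE(2)] Suc.prems Suc.IH[OF bE(1)] Suc.IH[OF bE(2)] by auto
      then show ?case
        using row_Suc_step(2)[OF r(1) c, of "\<mu> (Suc (Suc a), b)"] A(1)[OF Suc.prems] by simp
    qed
    then have "\<mu> (a, b) = \<kappa> (a, b)" if "(a, b) \<in> EE" for a b
      using that \<kappa> E0 by (cases a) auto
    then show "\<mu> = \<kappa>"
      by (intro PiE_ext[OF \<mu>(1) \<kappa>E]) auto
  qed
  show ?thesis
    unfolding even_unique_array_def P Let_def m_def[symmetric] EE_def[symmetric]
    by (rule ex1I[of _ \<kappa>], rule conjI[OF \<kappa>E arr], elim conjE, rule uniq)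
qed

end

section \<open>Equivalence of conditions (1) to (6) with well separatedness\<close>

definition weight_conditions :: "enat \<Rightarrow> nat \<Rightarrow> (nat \<Rightarrow> nat) \<Rightarrow> bool" where
  "weight_conditions h n i \<longleftrightarrow>
       (\<forall>k. 1 \<le> k \<and> k + 1 \<le> n \<longrightarrow> i k \<noteq> i (k + 1)) \<and>
       (\<forall>m. h = enat m \<and> odd m \<longrightarrow> card {k \<in> {1..n}. i k = (m - 1) div 2} \<le> 1) \<and>
       (\<forall>k l. 1 \<le> k \<and> k < l \<and> l \<le> n \<and> i k = 0 \<and> i l = 0 \<longrightarrow> 1 \<in> i ` {k<..<l}) \<and>
       (h = \<infinity> \<longrightarrow>
          (\<forall>k l. 1 \<le> k \<and> k < l \<and> l \<le> n \<and> i k = i l \<and> 1 \<le> i k \<longrightarrow>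
             {i k - 1, i k + 1} \<subseteq> i ` {k<..<l})) \<and>
       (\<forall>m. h = enat m \<and> odd m \<longrightarrow>
          (\<forall>k l. 1 \<le> k \<and> k < l \<and> l \<le> n \<and> i k = i l \<and> 1 \<le> i k \<longrightarrow>
             {i k - 1, i k + 1} \<subseteq> i ` {k<..<l} \<or> odd_sequence m i k l)) \<and>
       (\<forall>m. h = enat m \<and> even m \<longrightarrow>
          (\<forall>k l. 1 \<le> k \<and> k < l \<and> l \<le> n \<and> i k = i l \<and> 1 \<le> i k \<longrightarrow>
             (i k < m div 2 - 1 \<longrightarrow> {i k - 1, i k + 1} \<subseteq> i ` {k<..<l}) \<and>
             (i k = m div 2 - 1 \<longrightarrow>
                i k - 1 \<in> i ` {k<..<l} \<and> even_unique_array m i k l)))"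

lemma weight_conditionsI:
  assumes "\<And>k. 1 \<le> k \<Longrightarrow> k < n \<Longrightarrow> i k \<noteq> i (k + 1)"
    and "\<And>m. h = enat m \<Longrightarrow> odd m \<Longrightarrow> card {k \<in> {1..n}. i k = (m - 1) div 2} \<le> 1"
    and "\<And>k l. 1 \<le> k \<Longrightarrow> k < l \<Longrightarrow> l \<le> n \<Longrightarrow> i k = 0 \<Longrightarrow> i l = 0 \<Longrightarrow> 1 \<in> i ` {k<..<l}"
    and "\<And>k l. h = \<infinity> \<Longrightarrow> 1 \<le> k \<Longrightarrow> k < l \<Longrightarrow> l \<le> n \<Longrightarrow> i k = i l \<Longrightarrow> 1 \<le> i k \<Longrightarrow> both_between i k l"
    and "\<And>m k l. h = enat m \<Longrightarrow> odd m \<Longrightarrow> 1 \<le> k \<Longrightarrow> k < l \<Longrightarrow> l \<le> n \<Longrightarrow> i k = i l \<Longrightarrow> 1 \<le> i k \<Longrightarrow>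
      both_between i k l \<or> odd_sequence m i k l"
    and "\<And>m k l. h = enat m \<Longrightarrow> even m \<Longrightarrow> 1 \<le> k \<Longrightarrow> k < l \<Longrightarrow> l \<le> n \<Longrightarrow> i k = i l \<Longrightarrow> 1 \<le> i k \<Longrightarrow>
      (i k < m div 2 - 1 \<longrightarrow> both_between i k l) \<and>
      (i k = m div 2 - 1 \<longrightarrow> i k - 1 \<in> i ` {k<..<l} \<and> even_unique_array m i k l)"
  shows "weight_conditions h n i"
  unfolding weight_conditions_def
  apply (intro conjI)
       apply (use assms(1) in \<open>simp only: Suc_le_eq Suc_eq_plus1[symmetric], blast\<close>)
      apply (use assms(2) in blast)
     apply (use assms(3) in blast)
    apply (use assms(4) in blast)
   apply (use assms(5) in blast)
  apply (use assms(6) in blast)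
  done

context quantum
begin

text \<open>Applied to consecutive pairs, the conditions are nearly \<open>separated\<close> itself.
  In the odd case, (2) excludes the top value, and then the sequences of (5b) form a chain.\<close>

lemma well_separated_if_conditions:
  assumes idx: "\<And>x. x \<in> {1..n} \<Longrightarrow> i x \<in> index_set h"
    and wc: "weight_conditions h n i"
  shows "well_separated h n i"
proof -
  note w = wc[unfolded weight_conditions_def]
  note w_card = w[THEN conjunct2, THEN conjunct1, rule_format]
    and w_zero = w[THEN conjunct2, THEN conjunct2, THEN conjunct1, rule_format]
    and w_inf = w[THEN conjunct2, THEN conjunct2, THEN conjunct2, THEN conjunct1, rule_format]
    and w_odd = w[THEN conjunct2, THEN conjunct2, THEN conjunct2, THEN conjunct2, THEN conjunct1, rule_format]
    and w_even = w[THEN conjunct2, THEN conjunct2, THEN conjunct2, THEN conjunct2, THEN conjunct2, rule_format]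
  have "separated h n i k l" if c: "consecutive n i k l" for k l
  proof -
  have kl: "1 \<le> k" "k < l" "l \<le> n" "i k = i l" using c by (auto simp: consecutive_def)
  have ik: "i k \<in> index_set h" using idx[of k] kl by simp
  have zero: "1 \<in> i ` {k<..<l}" if "i k = 0"
    by (rule w_zero) (use kl that in simp)
  show "separated h n i k l"
  proof (cases "i k = 0")
    case True
    with zero show ?thesis by (simp add: separated_def)
  next
    case False
    then have i1: "1 \<le> i k" by simp
    show ?thesis
    proof (cases rule: index_max_cases)
      case 1
      then have "both_between i k l"
        using w_inf[OF 1(1)] kl i1 by blast
      then show ?thesis using 1 False unfolding separated_def by simp
    next
      case (2 p)
      have odd: "odd (2 * p + 1)" by simp
      have "card {k \<in> {1..n}. i k = (2 * p + 1 - 1) div 2} \<le> 1"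
        by (rule w_card) (use 2(2) odd in simp)
      moreover have "(2 * p + 1 - 1) div 2 = p" by simp
      ultimately have card: "card {k \<in> {1..n}. i k = p} \<le> 1" by simp
      have ne: "i k \<noteq> p"
      proof
        assume "i k = p"
        then have "{k, l} \<subseteq> {k \<in> {1..n}. i k = p}" using kl by auto
        then have "card {k, l} \<le> card {k \<in> {1..n}. i k = p}" by (intro card_mono) auto
        then show False using card kl by simp
      qed
      then have lt: "i k < p" using ik 2 by (simp add: index_set_iff)
      have "both_between i k l \<or> odd_sequence (2 * p + 1) i k l"
        using w_odd[of "2 * p + 1" k l] kl i1 2(2) odd by blast
      then have "both_between i k l \<or> chain n p i k l"
        using odd_sequence_chain[OF c _ lt] by blast
      then show ?thesis using 2(2) False ne unfolding separated_def by simp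
    next
      case (3 p)
      have ev: "even (2 * p + 2)" "(2 * p + 2) div 2 - 1 = p" by simp_all
      have "i k \<le> p" using ik 3 by (simp add: index_set_iff)
      moreover have "i k < p \<Longrightarrow> both_between i k l" "i k = p \<Longrightarrow> i k - 1 \<in> i ` {k<..<l}"
        using w_even[of "2 * p + 2" k l] kl i1 3(2) ev by simp_all
      ultimately show ?thesis using 3(2) False unfolding separated_def by simp
    qed
  qed
  qed
  then show ?thesis by (simp add: well_separated_def)
qed

text \<open>A pair k < l with equal entries is shrunk to the consecutive pair that starts at k;
  whatever lies inside the smaller interval lies inside the larger one.\<close>

lemma conditions_if_well_separated:
  assumes idx: "\<And>x. x \<in> {1..n} \<Longrightarrow> i x \<in> index_set h"
    and ws: "well_separated h n i"
  shows "weight_conditions h n i"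
proof -
  have sep: "\<exists>l'. l' \<le> l \<and> consecutive n i k l' \<and> separated h n i k l'"
    if kl: "1 \<le> k" "k < l" "l \<le> n" "i k = i l" for k l
  proof -
    obtain l' where "consecutive n i k l'" "l' \<le> l" by (rule obtain_consecutive[OF kl])
    then show ?thesis using ws by (auto simp: well_separated_def)
  qed
  have up: "b \<in> i ` {k<..<l'} \<Longrightarrow> l' \<le> l \<Longrightarrow> b \<in> i ` {k<..<l}" for b k l l'
    by auto
  have c3: "1 \<in> i ` {k<..<l}" if kl: "1 \<le> k" "k < l" "l \<le> n" "i k = 0" "i l = 0" for k l
  proof -
    obtain l' where l': "l' \<le> l" "separated h n i k l'" using sep[of k l] kl by auto
    then have "1 \<in> i ` {k<..<l'}" using kl(4) unfolding separated_def by blast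
    then show ?thesis using up[OF _ l'(1)] by blast
  qed
  show ?thesis
  proof (cases rule: index_max_cases)
    case 1
    have "both_between i k l" if kl: "1 \<le> k" "k < l" "l \<le> n" "i k = i l" "1 \<le> i k" for k l
    proof -
      obtain l' where l': "l' \<le> l" "separated h n i k l'" using sep[OF kl(1-4)] by blast
      then have "both_between i k l'" using 1 kl(5) by (simp add: separated_def)
      then show ?thesis using up[OF _ l'(1)] by blast
    qed
    with 1(1) show ?thesis
      by (intro weight_conditionsI c3 well_separated_distinct[OF ws]) simp_all
  next
    case (2 p)
    have main: "i k \<noteq> p \<and> (both_between i k l \<or> odd_sequence (2 * p + 1) i k l)"
      if kl: "1 \<le> k" "k < l" "l \<le> n" "i k = i l" "1 \<le> i k" for k l
    proof -
      obtain l' where l': "l' \<le> l" "separated h n i k l'" using sep[OF kl(1-4)] by blast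
      then have "i k \<noteq> p" "both_between i k l' \<or> chain n p i k l'"
        using 2 kl(5) by (simp_all add: separated_def)
      then show ?thesis using up[OF _ l'(1)] odd_sequence_mono[OF chain_odd_sequence l'(1)] by blast
    qed
    have "card {k \<in> {1..n}. i k = p} \<le> 1"
    proof -
      have "x = y" if "x \<in> {1..n}" "y \<in> {1..n}" "i x = p" "i y = p" for x y
      proof (rule ccontr)
        assume "x \<noteq> y"
        then show False using main[of x y] main[of y x] 2(1) that by (cases "x < y") auto
      qed
      then have "card {k \<in> {1..n}. i k = p} \<le> Suc 0"
        by (subst card_le_Suc0_iff_eq) auto
      then show ?thesis by simp
    qed
    with 2(2) main show ?thesis
      by (intro weight_conditionsI c3 well_separated_distinct[OF ws]) simp_all
  next
    case (3 p)
    have main: "if i k = p then i k - 1 \<in> i ` {k<..<l} else both_between i k l"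
      if kl: "1 \<le> k" "k < l" "l \<le> n" "i k = i l" "1 \<le> i k" for k l
    proof -
      obtain l' where l': "l' \<le> l" "separated h n i k l'" using sep[OF kl(1-4)] by blast
      then have "if i k = p then i k - 1 \<in> i ` {k<..<l'} else both_between i k l'"
        using 3 kl(5) by (simp add: separated_def)
      then show ?thesis using up[OF _ l'(1)] by (cases "i k = p") auto
    qed
    have array: "even_unique_array (2 * p + 2) i k l"
      if "1 \<le> k" "k < l" "l \<le> n" "i k = i l" "i k = p" for k l
      by (rule even_unique_array[OF ws 3(2,1) idx]) (use that in auto)
    show ?thesis
    proof (rule weight_conditionsI[OF well_separated_distinct[OF ws] _ c3])
      fix m k l assume m: "h = enat m" "even m"
        and kl: "1 \<le> k" "k < l" "l \<le> n" "i k = i l" "1 \<le> i k"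
      have mp: "m = 2 * p + 2" "m div 2 - 1 = p" using m(1) 3(2) by simp_all
      show "(i k < m div 2 - 1 \<longrightarrow> both_between i k l) \<and>
          (i k = m div 2 - 1 \<longrightarrow> i k - 1 \<in> i ` {k<..<l} \<and> even_unique_array m i k l)"
        using main[OF kl] array[OF kl(1-4)] unfolding mp by (cases "i k = p") simp_all
    qed (use 3(2) in auto)
  qed
qed

end

section \<open>Weight vectors and intertwiners\<close>

definition lin_on :: "'a::field vec set \<Rightarrow> ('a vec \<Rightarrow> 'a vec) \<Rightarrow> bool" where
  "lin_on U f \<longleftrightarrow> (\<forall>v\<in>U. f v \<in> U) \<and> (\<forall>v\<in>U. \<forall>w\<in>U. f (v + w) = f v + f w) \<and>
     (\<forall>c. \<forall>v\<in>U. f (scl c v) = scl c (f v))"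

lemma scl_simps:
  "scl (a::'a::field) (v + w) = scl a v + scl a w" "scl a (v - w) = scl a v - scl a w"
  "scl a (- v) = - scl a v" "scl a (scl b v) = scl (a * b) v"
  "scl 1 v = v" "scl 0 v = 0" "scl a 0 = 0"
  by (simp_all add: vsp.scale_right_distrib vsp.scale_right_diff_distrib)

lemma vec_eqI: "(\<And>m. Poly_Mapping.lookup v m = Poly_Mapping.lookup w m) \<Longrightarrow> v = (w :: 'a::field vec)"
  by (rule poly_mapping_eqI)

lemmas lookup_simps = lookup_add lookup_minus lookup_uminus lookup_scl lookup_zero

text \<open>The coefficients are dictated by \<open>eig_sg\<close>: after subtraction of E (aa + bb
  C_k C_(k+1)), what is left of T_k exchanges the two eigenvalues. Solving for them gives poles
  exactly at x = y and xy = 1.\<close>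

definition aa :: "'a::field \<Rightarrow> 'a \<Rightarrow> 'a" where "aa x y = y / (y - x)"
definition bb :: "'a::field \<Rightarrow> 'a \<Rightarrow> 'a" where "bb x y = x * y / (1 - x * y)"

text \<open>Applying C_j to an eigenvector inverts the j-th eigenvalue, so these rules give the
  coefficients on Clifford translates in terms of those on the original vector.\<close>

lemma aa_bb_inverse:
  fixes x y :: "'a::field"
  assumes "x \<noteq> 0" "y \<noteq> 0" "x \<noteq> y" "x * y \<noteq> 1"
  shows "aa y x = 1 - aa x y"
    "aa (inverse x) (inverse y) = 1 - aa x y" "aa (inverse x) y = - bb x y" "aa x (inverse y) = 1 + bb x y"
    "bb (inverse x) (inverse y) = - 1 - bb x y" "bb (inverse x) y = - aa x y" "bb x (inverse y) = aa x y - 1"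
    "bb y x = bb x y"
proof -
  have nz: "y - x \<noteq> 0" "x - y \<noteq> 0" "1 - x * y \<noteq> 0" "x * y - 1 \<noteq> 0" using assms by auto
  show "aa y x = 1 - aa x y" "aa (inverse x) (inverse y) = 1 - aa x y"
    "aa (inverse x) y = - bb x y" "aa x (inverse y) = 1 + bb x y"
    "bb (inverse x) (inverse y) = - 1 - bb x y" "bb (inverse x) y = - aa x y" "bb x (inverse y) = aa x y - 1"
    "bb y x = bb x y"
    using assms nz by (simp_all add: aa_def bb_def divide_simps) (simp_all add: algebra_simps)
qed

section \<open>Clifford generators and the braid defect\<close>

locale clifford =
  fixes U :: "'a::field vec set" and J :: "nat set" and C :: "nat \<Rightarrow> 'a vec \<Rightarrow> 'a vec"
  assumes subU: "vsp.subspace U"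
    and C_lin: "j \<in> J \<Longrightarrow> lin_on U (C j)"
    and C_sq [simp]: "j \<in> J \<Longrightarrow> v \<in> U \<Longrightarrow> C j (C j v) = v"
    and C_anti: "i \<in> J \<Longrightarrow> j \<in> J \<Longrightarrow> i \<noteq> j \<Longrightarrow> v \<in> U \<Longrightarrow> C i (C j v) = - C j (C i v)"
begin

lemma U_closed [simp]: "v \<in> U \<Longrightarrow> w \<in> U \<Longrightarrow> v + w \<in> U" "v \<in> U \<Longrightarrow> scl c v \<in> U"
    "v \<in> U \<Longrightarrow> w \<in> U \<Longrightarrow> v - w \<in> U" "v \<in> U \<Longrightarrow> - v \<in> U" "0 \<in> U"
  using subU vsp.subspace_add vsp.subspace_scale vsp.subspace_diff vsp.subspace_neg vsp.subspace_0 by blast+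

lemma lin_onD:
  assumes "lin_on U f"
  shows "v \<in> U \<Longrightarrow> f v \<in> U" "v \<in> U \<Longrightarrow> w \<in> U \<Longrightarrow> f (v + w) = f v + f w"
    "v \<in> U \<Longrightarrow> f (scl c v) = scl c (f v)" "v \<in> U \<Longrightarrow> w \<in> U \<Longrightarrow> f (v - w) = f v - f w"
    "v \<in> U \<Longrightarrow> f (- v) = - f v" "f 0 = 0"
proof -
  show *: "v \<in> U \<Longrightarrow> f v \<in> U" "v \<in> U \<Longrightarrow> w \<in> U \<Longrightarrow> f (v + w) = f v + f w"
    "v \<in> U \<Longrightarrow> f (scl c v) = scl c (f v)" for v w c
    using assms by (auto simp: lin_on_def)
  show neg: "v \<in> U \<Longrightarrow> f (- v) = - f v" for v using *(3)[of v "- 1"] by simp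
  show "v \<in> U \<Longrightarrow> w \<in> U \<Longrightarrow> f (v - w) = f v - f w"
    using *(2)[of v "- w"] neg[of w] by simp
  show "f 0 = 0" using *(3)[of 0 0] by simp
qed

lemmas C_simps [simp] = lin_onD[OF C_lin]

text \<open>On a joint eigenvector of the \<open>X\<^sub>j\<close> with eigenvalues \<open>x j\<close>, \<open>T\<^sub>k\<close> is \<open>Aop (eps q) k (k+1) x\<close>
  plus an intertwiner that exchanges the eigenvalues at \<open>k\<close> and \<open>k + 1\<close>, and whose square is the
  scalar \<open>gg\<close> below.\<close>

definition Aop :: "'a \<Rightarrow> nat \<Rightarrow> nat \<Rightarrow> (nat \<Rightarrow> 'a) \<Rightarrow> 'a vec \<Rightarrow> 'a vec" where
  "Aop E p r x v = scl (E * aa (x p) (x r)) v + scl (E * bb (x p) (x r)) (C p (C r v))"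

text \<open>The braid relation on a weight vector whose outer two eigenvalues coincide up to inversion,
  in a situation where the generators act only through \<^const>\<open>Aop\<close>: it fails by a scalar.\<close>

lemma braid_defect:
  fixes P :: "(nat \<Rightarrow> 'a) \<Rightarrow> 'a vec \<Rightarrow> bool"
  assumes pqr: "p \<in> J" "q \<in> J" "r \<in> J" "p \<noteq> q" "q \<noteq> r" "p \<noteq> r"
    and S: "lin_on U S" and T: "lin_on U T"
    and PU: "\<And>x v. P x v \<Longrightarrow> v \<in> U"
    and PC: "\<And>x v j. P x v \<Longrightarrow> j \<in> J \<Longrightarrow> P (x(j := inverse (x j))) (C j v)"
    and SA: "\<And>x v. P x v \<Longrightarrow> S v = Aop E p q x v" and TA: "\<And>x v. P x v \<Longrightarrow> T v = Aop E q r x v"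
    and v: "P x v" and x: "x p \<noteq> 0" "x q \<noteq> 0" "x p \<noteq> x q" "x p * x q \<noteq> 1"
    and K: "a = aa (x p) (x q)" "d = bb (x p) (x q)"
      "K = E ^ 3 * (a * (1 - a) * (2 * a - 1) - (1 + d) * d * (2 * d + 1))"
  shows "x r = x p \<Longrightarrow> S (T (S v)) - T (S (T v)) = scl K v"
    and "x r = inverse (x p) \<Longrightarrow> S (T (S v)) - T (S (T v)) = scl K (C p (C r v))"
proof -
  note ab = aa_bb_inverse[OF x]
  note [simp] = pqr pqr(4-6)[symmetric] lin_onD[OF S] lin_onD[OF T]
  \<comment> \<open>The eigenvalues on \<open>C p (C q v)\<close>, \<open>C q (C r v)\<close> and
    \<open>C p (C r v)\<close>. Together with v these vectors span a space that S and T preserve, so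
    the claim is a computation with four vectors.\<close>
  define y1 where "y1 = x(q := inverse (x q), p := inverse (x p))"
  define y2 where "y2 = x(r := inverse (x r), q := inverse (x q))"
  define y3 where "y3 = x(r := inverse (x r), p := inverse (x p))"
  have vU: "v \<in> U" using PU[OF v] .
  have comm: "C q (C p w) = - C p (C q w)" "C r (C p w) = - C p (C r w)" "C r (C q w) = - C q (C r w)"
    if "w \<in> U" for w
    by (rule C_anti; use that in simp)+
  have P1: "P y1 (C p (C q v))" using PC[OF PC[OF v pqr(2)] pqr(1)] by (simp add: y1_def)
  have P2: "P y2 (C q (C r v))" using PC[OF PC[OF v pqr(3)] pqr(2)] by (simp add: y2_def)
  have P3: "P y3 (C p (C r v))" using PC[OF PC[OF v pqr(3)] pqr(1)] by (simp add: y3_def)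
  note ST = SA[OF v] TA[OF v] SA[OF P1] TA[OF P1] SA[OF P2] TA[OF P2] SA[OF P3] TA[OF P3]
  have ba: "aa (inverse s) (inverse t) = aa t s" "aa (inverse s) t = - bb s t" "aa s (inverse t) = 1 + bb s t"
    "bb (inverse s) (inverse t) = - 1 - bb s t" "bb (inverse s) t = - aa s t" "bb s (inverse t) = aa s t - 1"
    if "s = x p \<and> t = x q \<or> s = x q \<and> t = x p" for s t
  proof -
    have "s \<noteq> 0" "t \<noteq> 0" "s \<noteq> t" "s * t \<noteq> 1" using x that by (auto simp: mult.commute)
    note st = aa_bb_inverse[OF this]
    show "aa (inverse s) (inverse t) = aa t s" by (simp only: st(1,2))
    show "aa (inverse s) t = - bb s t" "aa s (inverse t) = 1 + bb s t"
      "bb (inverse s) (inverse t) = - 1 - bb s t" "bb (inverse s) t = - aa s t" "bb s (inverse t) = aa s t - 1"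
      by (fact st)+
  qed
  note e = ba[of "x p" "x q", simplified] ba[of "x q" "x p", simplified] ab(1,8)
  {
    assume r: "x r = x p"
    have coeffs: "aa (x p) (x q) = a" "bb (x p) (x q) = d" "aa (x q) (x r) = 1 - a" "bb (x q) (x r) = d"
      "aa (y1 p) (y1 q) = 1 - a" "bb (y1 p) (y1 q) = - 1 - d" "aa (y1 q) (y1 r) = - d" "bb (y1 q) (y1 r) = a - 1"
      "aa (y2 p) (y2 q) = 1 + d" "bb (y2 p) (y2 q) = a - 1" "aa (y2 q) (y2 r) = a" "bb (y2 q) (y2 r) = - 1 - d"
      "aa (y3 p) (y3 q) = - d" "bb (y3 p) (y3 q) = - a" "aa (y3 q) (y3 r) = 1 + d" "bb (y3 q) (y3 r) = - a"
      unfolding K(1,2) by (simp_all add: y1_def y2_def y3_def r e)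
    have 1: "S v = scl (E * a) v + scl (E * d) (C p (C q v))"
      "T v = scl (E * (1 - a)) v + scl (E * d) (C q (C r v))"
      "S (C p (C q v)) = scl (E * (1 - a)) (C p (C q v)) - scl (E * (- 1 - d)) v"
      "T (C p (C q v)) = scl (E * - d) (C p (C q v)) - scl (E * (a - 1)) (C p (C r v))"
      "S (C q (C r v)) = scl (E * (1 + d)) (C q (C r v)) + scl (E * (a - 1)) (C p (C r v))"
      "T (C q (C r v)) = scl (E * a) (C q (C r v)) - scl (E * (- 1 - d)) v"
      "S (C p (C r v)) = scl (E * - d) (C p (C r v)) - scl (E * - a) (C q (C r v))"
      "T (C p (C r v)) = scl (E * (1 + d)) (C p (C r v)) + scl (E * - a) (C p (C q v))"
      unfolding ST Aop_def coeffs using vU by (simp_all add: comm)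
    show "S (T (S v)) - T (S (T v)) = scl K v"
      by (rule vec_eqI, simp only: vU 1 U_closed C_simps pqr lin_onD[OF S] lin_onD[OF T] scl_simps
          lookup_simps K(3)) (simp add: power3_eq_cube algebra_simps)
  }
  {
    assume r: "x r = inverse (x p)"
    have coeffs: "aa (x p) (x q) = a" "bb (x p) (x q) = d" "aa (x q) (x r) = 1 + d" "bb (x q) (x r) = - a"
      "aa (y1 p) (y1 q) = 1 - a" "bb (y1 p) (y1 q) = - 1 - d" "aa (y1 q) (y1 r) = a" "bb (y1 q) (y1 r) = - 1 - d"
      "aa (y2 p) (y2 q) = 1 + d" "bb (y2 p) (y2 q) = a - 1" "aa (y2 q) (y2 r) = - d" "bb (y2 q) (y2 r) = a - 1"
      "aa (y3 p) (y3 q) = - d" "bb (y3 p) (y3 q) = - a" "aa (y3 q) (y3 r) = 1 - a" "bb (y3 q) (y3 r) = d"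
      unfolding K(1,2) by (simp_all add: y1_def y2_def y3_def r e)
    have 1: "S v = scl (E * a) v + scl (E * d) (C p (C q v))"
      "T v = scl (E * (1 + d)) v + scl (E * - a) (C q (C r v))"
      "S (C p (C q v)) = scl (E * (1 - a)) (C p (C q v)) - scl (E * (- 1 - d)) v"
      "T (C p (C q v)) = scl (E * a) (C p (C q v)) - scl (E * (- 1 - d)) (C p (C r v))"
      "S (C q (C r v)) = scl (E * (1 + d)) (C q (C r v)) + scl (E * (a - 1)) (C p (C r v))"
      "T (C q (C r v)) = scl (E * - d) (C q (C r v)) - scl (E * (a - 1)) v"
      "S (C p (C r v)) = scl (E * - d) (C p (C r v)) - scl (E * - a) (C q (C r v))"
      "T (C p (C r v)) = scl (E * (1 - a)) (C p (C r v)) + scl (E * d) (C p (C q v))"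
      unfolding ST Aop_def coeffs using vU by (simp_all add: comm)
    show "S (T (S v)) - T (S (T v)) = scl K (C p (C r v))"
      by (rule vec_eqI, simp only: vU 1 U_closed C_simps pqr lin_onD[OF S] lin_onD[OF T] scl_simps
          lookup_simps K(3)) (simp add: power3_eq_cube algebra_simps)
  }
qed

end

text \<open>Over the common denominator of A and B the numerator splits. One factor says that x is
  its own inverse; the other contains only the sums x + inverse x and y + inverse y, that is, the
  values \<open>qval\<close>, and is treated in \<open>special_iff\<close>.\<close>

lemma defect_factor:
  fixes x y :: "'a::field"
  assumes "x \<noteq> 0" "y \<noteq> 0" "x \<noteq> y" "x * y \<noteq> 1"
  shows "aa x y * (1 - aa x y) * (2 * aa x y - 1) - (1 + bb x y) * bb x y * (2 * bb x y + 1) = 0 \<longleftrightarrow>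
    x * x = 1 \<or> (y + inverse y) * (x + inverse x + (y + inverse y)) = 8"
proof -
  have nz: "y - x \<noteq> 0" "1 - x * y \<noteq> 0" using assms by auto
  define A where "A = aa x y * (1 - aa x y) * (2 * aa x y - 1)"
  define B where "B = (1 + bb x y) * bb x y * (2 * bb x y + 1)"
  have a: "1 - aa x y = - x / (y - x)" "2 * aa x y - 1 = (x + y) / (y - x)"
    and b: "1 + bb x y = 1 / (1 - x * y)" "2 * bb x y + 1 = (1 + x * y) / (1 - x * y)"
    using nz by (simp_all add: aa_def bb_def field_simps)
  have A: "A = - (x * y * (x + y)) / (y - x) ^ 3"
    unfolding A_def a unfolding aa_def by (simp add: power3_eq_cube)
  have B: "B = x * y * (1 + x * y) / (1 - x * y) ^ 3"
    unfolding B_def b unfolding bb_def by (simp add: power3_eq_cube)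
  have AB: "A - B = - (x * y * ((x + y) * (1 - x * y) ^ 3 + (1 + x * y) * (y - x) ^ 3)) /
      ((y - x) ^ 3 * (1 - x * y) ^ 3)"
  proof -
    have "- n1 / u - n2 / w = - (n1 * w + n2 * u) / (u * w)" if "u \<noteq> 0" "w \<noteq> 0" for n1 n2 u w :: 'a
      using that by (simp add: field_simps)
    moreover have "x * y * (x + y) * w + x * y * (1 + x * y) * u = x * y * ((x + y) * w + (1 + x * y) * u)" for u w
      by (simp add: algebra_simps)
    ultimately show ?thesis unfolding A B using nz by (metis power_not_zero)
  qed
  have "(x + y) * (1 - x * y) ^ 3 + (1 + x * y) * (y - x) ^ 3 =
      - (x * y\<^sup>2 * (x * x - 1) * ((y + inverse y) * (x + inverse x + (y + inverse y)) - 8))"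
    using assms(1,2) by (simp add: field_simps power2_eq_square power3_eq_cube)
  then have "A - B = 0 \<longleftrightarrow> (x * x - 1) * ((y + inverse y) * (x + inverse x + (y + inverse y)) - 8) = 0"
    unfolding AB using nz assms(1,2) by simp
  then show ?thesis unfolding A_def B_def by (simp del: mult_eq_0_iff) simp
qed

definition gg :: "'a::field \<Rightarrow> 'a \<Rightarrow> 'a \<Rightarrow> 'a" where
  "gg E x y = 1 + E\<^sup>2 * (aa x y * (1 - aa x y) - bb x y * (1 + bb x y))"

text \<open>The scalar sees x and y only through their sums with their inverses, so it is the same
  on all Clifford translates. By \<open>link_iff\<close> it vanishes exactly for linked
  indices.\<close>

lemma gg_eq:
  fixes x y E :: "'a::field"
  assumes "x \<noteq> 0" "y \<noteq> 0" "x \<noteq> y" "x * y \<noteq> 1"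
  shows "gg E x y = 1 - E\<^sup>2 * ((x + inverse x) * (y + inverse y) - 4) / (x + inverse x - (y + inverse y))\<^sup>2"
proof -
  have nz: "y - x \<noteq> 0" "1 - x * y \<noteq> 0" using assms by auto
  have d: "x + inverse x - (y + inverse y) = (y - x) * (1 - x * y) / (x * y)"
    using assms by (simp add: field_simps)
  have n: "(x + inverse x) * (y + inverse y) - 4 = ((1 - x * y)\<^sup>2 + (y - x)\<^sup>2) / (x * y)"
    using assms by (simp add: field_simps power2_eq_square)
  have s1: "aa x y * (1 - aa x y) = - (x * y / (y - x)\<^sup>2)"
    using nz by (simp add: aa_def field_simps power2_eq_square)
  have s2: "bb x y * (1 + bb x y) = x * y / (1 - x * y)\<^sup>2"
    using nz by (simp add: bb_def field_simps power2_eq_square)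
  have s3: "((x + inverse x) * (y + inverse y) - 4) / (x + inverse x - (y + inverse y))\<^sup>2 =
      x * y / (y - x)\<^sup>2 + x * y / (1 - x * y)\<^sup>2"
  proof -
    have "((w\<^sup>2 + u\<^sup>2) / t) / (u * w / t)\<^sup>2 = t / u\<^sup>2 + t / w\<^sup>2" if "u \<noteq> 0" "w \<noteq> 0" "t \<noteq> 0" for u w t :: 'a
      using that by (simp add: field_simps power2_eq_square)
    then show ?thesis unfolding d n using assms nz by simp
  qed
  show ?thesis
    unfolding gg_def s1 s2 times_divide_eq_right[symmetric] s3 by (simp only: ring_distribs) simp
qed

lemma sum_inverse_eq_iff:
  fixes x y :: "'a::field"
  assumes "x \<noteq> 0" "y \<noteq> 0"
  shows "x + inverse x = y + inverse y \<longleftrightarrow> x = y \<or> x * y = 1"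
proof -
  have "x + inverse x - (y + inverse y) = (y - x) * (1 - x * y) / (x * y)"
    using assms by (simp add: field_simps)
  then have "x + inverse x = y + inverse y \<longleftrightarrow> (y - x) * (1 - x * y) = 0"
    using assms by (metis divide_eq_0_iff eq_iff_diff_eq_0 mult_eq_0_iff)
  then show ?thesis by auto
qed

section \<open>The defining relations as identities of operators, and the intertwiners\<close>

locale hc_module = clifford U "{1..n}" C for U :: "'a::field vec set" and n :: nat and C +
  fixes q :: 'a and T X Y :: "nat \<Rightarrow> 'a vec \<Rightarrow> 'a vec"
  assumes T_lin: "i \<in> {1..<n} \<Longrightarrow> lin_on U (T i)"
    and X_lin: "i \<in> {1..n} \<Longrightarrow> lin_on U (X i)" and Y_lin: "i \<in> {1..n} \<Longrightarrow> lin_on U (Y i)"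
    and T_quad: "i \<in> {1..<n} \<Longrightarrow> v \<in> U \<Longrightarrow> T i (T i v) = scl (eps q) (T i v) + v"
    and T_comm: "i \<in> {1..<n} \<Longrightarrow> j \<in> {1..<n} \<Longrightarrow> \<bar>int i - int j\<bar> > 1 \<Longrightarrow> v \<in> U \<Longrightarrow> T i (T j v) = T j (T i v)"
    and T_braid: "i \<in> {1..<n} \<Longrightarrow> Suc i \<in> {1..<n} \<Longrightarrow> v \<in> U \<Longrightarrow>
      T i (T (Suc i) (T i v)) = T (Suc i) (T i (T (Suc i) v))"
    and X_comm: "i \<in> {1..n} \<Longrightarrow> j \<in> {1..n} \<Longrightarrow> v \<in> U \<Longrightarrow> X i (X j v) = X j (X i v)"
    and XY: "i \<in> {1..n} \<Longrightarrow> v \<in> U \<Longrightarrow> X i (Y i v) = v"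
    and YX: "i \<in> {1..n} \<Longrightarrow> v \<in> U \<Longrightarrow> Y i (X i v) = v"
    and TX_near: "i \<in> {1..<n} \<Longrightarrow> v \<in> U \<Longrightarrow>
      T i (X i v) = X (Suc i) (T i v) - scl (eps q) (X (Suc i) v + C i (C (Suc i) (X i v)))"
    and TX_far: "i \<in> {1..<n} \<Longrightarrow> j \<in> {1..n} \<Longrightarrow> j \<noteq> i \<Longrightarrow> j \<noteq> Suc i \<Longrightarrow> v \<in> U \<Longrightarrow> T i (X j v) = X j (T i v)"
    and TC_near: "i \<in> {1..<n} \<Longrightarrow> v \<in> U \<Longrightarrow> T i (C i v) = C (Suc i) (T i v)"
    and TC_next: "i \<in> {1..<n} \<Longrightarrow> v \<in> U \<Longrightarrow>
      T i (C (Suc i) v) = C i (T i v) - scl (eps q) (C i v - C (Suc i) v)"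
    and TC_far: "i \<in> {1..<n} \<Longrightarrow> j \<in> {1..n} \<Longrightarrow> j \<noteq> i \<Longrightarrow> j \<noteq> Suc i \<Longrightarrow> v \<in> U \<Longrightarrow> T i (C j v) = C j (T i v)"
    and XC_same: "i \<in> {1..n} \<Longrightarrow> v \<in> U \<Longrightarrow> X i (C i v) = C i (Y i v)"
    and XC_far: "i \<in> {1..n} \<Longrightarrow> j \<in> {1..n} \<Longrightarrow> i \<noteq> j \<Longrightarrow> v \<in> U \<Longrightarrow> X i (C j v) = C j (X i v)"
begin

abbreviation "E \<equiv> eps q"

lemmas T_simps [simp] = lin_onD[OF T_lin]
lemmas X_simps [simp] = lin_onD[OF X_lin]
lemmas Y_simps [simp] = lin_onD[OF Y_lin]

text \<open>The defining relation for T_k X_k, applied to T_k v and combined with the quadratic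
  relation, expresses X_(k+1) v through w = X_k T_k v. Applying T_k to that expression gives the
  formula.\<close>

lemma TX_next:
  assumes k: "k \<in> {1..<n}" and v: "v \<in> U"
  shows "T k (X (Suc k) v) = X k (T k v) + scl E (X (Suc k) v - C k (C (Suc k) (X (Suc k) v)))"
proof -
  have k': "k \<in> {1..n}" "Suc k \<in> {1..n}" using k by auto
  have [simp]: "C (Suc k) (C k w) = - C k (C (Suc k) w)" if "w \<in> U" for w
    by (rule C_anti) (use k' that in auto)
  define w where "w = X k (T k v)"
  have wU: "w \<in> U" using k k' v by (simp add: w_def)
  have Z: "T k w = X (Suc k) v - scl E (C k (C (Suc k) w))"
    unfolding w_def using k k' v by (simp add: TX_near T_quad scl_simps)
  then have X': "X (Suc k) v = T k w + scl E (C k (C (Suc k) w))" by simp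
  have Tc: "T k (C k (C (Suc k) w)) = - C k (C (Suc k) (T k w)) + scl E (C k (C (Suc k) w)) + scl E w"
    using k k' wU by (simp add: TC_near TC_next scl_simps)
  have "T k (X (Suc k) v) = scl E (T k w) + w + scl E (T k (C k (C (Suc k) w)))"
    unfolding X' using k k' wU by (simp add: T_quad)
  also have "\<dots> = w + scl E (X (Suc k) v - C k (C (Suc k) (X (Suc k) v)))"
    unfolding Tc unfolding X' using k k' wU by (simp add: scl_simps)
  finally show ?thesis unfolding w_def .
qed

definition eig :: "(nat \<Rightarrow> 'a) \<Rightarrow> 'a vec \<Rightarrow> bool" where
  "eig x v \<longleftrightarrow> v \<in> U \<and> (\<forall>j\<in>{1..n}. x j \<noteq> 0 \<and> X j v = scl (x j) v)"

lemma eigD: "eig x v \<Longrightarrow> v \<in> U" "eig x v \<Longrightarrow> j \<in> {1..n} \<Longrightarrow> X j v = scl (x j) v"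
  "eig x v \<Longrightarrow> j \<in> {1..n} \<Longrightarrow> x j \<noteq> 0"
  by (auto simp: eig_def)

lemma eig_Y:
  assumes "eig x v" "j \<in> {1..n}"
  shows "Y j v = scl (inverse (x j)) v"
proof -
  note e = eigD[OF assms(1)]
  have "v = scl (x j) (Y j v)" using YX[OF assms(2) e(1)] e assms(2) by simp
  then have "scl (inverse (x j)) v = scl (inverse (x j)) (scl (x j) (Y j v))" by (rule arg_cong)
  then show ?thesis using e(3)[OF assms(2)] by simp
qed

lemma eig_C:
  assumes "eig x v" "j \<in> {1..n}"
  shows "eig (x(j := inverse (x j))) (C j v)"
  unfolding eig_def
proof (intro conjI ballI)
  note e = eigD[OF assms(1)]
  show "C j v \<in> U" using e assms by simp
  fix l assume l: "l \<in> {1..n}"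
  show "(x(j := inverse (x j))) l \<noteq> 0" using e(3)[OF l] e(3)[OF assms(2)] by auto
  show "X l (C j v) = scl ((x(j := inverse (x j))) l) (C j v)"
    using XC_same[OF assms(2) e(1)] XC_far[OF l assms(2) _ e(1)] eig_Y[OF assms] e(1,2) l assms(2)
    by (cases "l = j") simp_all
qed

definition sg :: "nat \<Rightarrow> (nat \<Rightarrow> 'a) \<Rightarrow> 'a vec \<Rightarrow> 'a vec" where
  "sg k x v = T k v - Aop E k (Suc k) x v"

lemma X_T_eig:
  assumes k: "k \<in> {1..<n}" and v: "eig x v"
  shows "X k (T k v) = scl (x (Suc k)) (T k v) - scl (E * x (Suc k)) v + scl (E * x (Suc k)) (C k (C (Suc k) v))"
    "X (Suc k) (T k v) = scl (x k) (T k v) + scl (E * x (Suc k)) v + scl (E * x k) (C k (C (Suc k) v))"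
proof -
  have k': "k \<in> {1..n}" "Suc k \<in> {1..n}" using k by auto
  note e = eigD[OF v]
  show "X k (T k v) = scl (x (Suc k)) (T k v) - scl (E * x (Suc k)) v + scl (E * x (Suc k)) (C k (C (Suc k) v))"
    using TX_next[OF k e(1)] k k' e by (simp add: scl_simps algebra_simps)
  show "X (Suc k) (T k v) = scl (x k) (T k v) + scl (E * x (Suc k)) v + scl (E * x k) (C k (C (Suc k) v))"
    using TX_near[OF k e(1)] k k' e by (simp add: scl_simps algebra_simps)
qed

lemma X_CC_eig:
  assumes k: "k \<in> {1..<n}" and v: "eig x v"
  shows "X k (C k (C (Suc k) v)) = scl (inverse (x k)) (C k (C (Suc k) v))"
    "X (Suc k) (C k (C (Suc k) v)) = scl (inverse (x (Suc k))) (C k (C (Suc k) v))"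
proof -
  have k': "k \<in> {1..n}" "Suc k \<in> {1..n}" using k by auto
  have "eig (x(Suc k := inverse (x (Suc k)), k := inverse (x k))) (C k (C (Suc k) v))"
    using eig_C[OF eig_C[OF v k'(2)] k'(1)] by simp
  from eigD(2)[OF this k'(1)] eigD(2)[OF this k'(2)]
  show "X k (C k (C (Suc k) v)) = scl (inverse (x k)) (C k (C (Suc k) v))"
    "X (Suc k) (C k (C (Suc k) v)) = scl (inverse (x (Suc k))) (C k (C (Suc k) v))"
    by simp_all
qed

lemma eig_sg:
  assumes k: "k \<in> {1..<n}" and v: "eig x v" and ne: "x k \<noteq> x (Suc k)" "x k * x (Suc k) \<noteq> 1"
  shows "eig (x \<circ> adj_swap k) (sg k x v)"
  unfolding eig_def
proof (intro conjI ballI)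
  have k': "k \<in> {1..n}" "Suc k \<in> {1..n}" using k by auto
  note e = eigD[OF v]
  show "sg k x v \<in> U" using e(1) k k' by (simp add: sg_def Aop_def)
  fix l assume l: "l \<in> {1..n}"
  then have "adj_swap k l \<in> {1..n}" using k by (auto simp: adj_swap_def)
  then show "(x \<circ> adj_swap k) l \<noteq> 0" using e(3) by simp
  define s t where "s = x k" "t = x (Suc k)"
  have st: "s \<noteq> 0" "t \<noteq> 0" "t - s \<noteq> 0" "1 - s * t \<noteq> 0"
    using e(3) k' ne by (auto simp: s_t_def)
  \<comment> \<open>These identities are the defining property of the coefficients: they cancel v
    and C_k C_(k+1) v in the eigenvalue equations for X_k and X_(k+1).\<close>
  have c1: "t * aa s t - s * aa s t = t" "bb s t * inverse s - t * bb s t = t"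
    "bb s t * inverse t - s * bb s t = s"
    using st by (simp_all add: aa_def bb_def divide_simps) (simp_all add: algebra_simps)
  consider "l = k" | "l = Suc k" | "l \<noteq> k" "l \<noteq> Suc k" by blast
  then show "X l (sg k x v) = scl ((x \<circ> adj_swap k) l) (sg k x v)"
  proof cases
    case 1
    have "- E * t * m1 + E * t * m2 - s * (E * aa s t) * m1 - inverse s * (E * bb s t) * m2 =
        - t * (E * aa s t) * m1 - t * (E * bb s t) * m2" for m1 m2
    proof -
      have "- E * t * m1 + E * t * m2 - s * (E * aa s t) * m1 - inverse s * (E * bb s t) * m2 +
        t * (E * aa s t) * m1 + t * (E * bb s t) * m2 =
        E * m1 * ((t * aa s t - s * aa s t) - t) + E * m2 * (t - (bb s t * inverse s - t * bb s t))"
        by (simp add: algebra_simps)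
      also have "\<dots> = 0" unfolding c1 by simp
      finally show ?thesis by (simp add: algebra_simps)
    qed
    note m = this
    show ?thesis unfolding 1
    proof (rule vec_eqI)
      fix m
      show "Poly_Mapping.lookup (X k (sg k x v)) m = Poly_Mapping.lookup (scl ((x \<circ> adj_swap k) k) (sg k x v)) m"
        using k k' e m[of "Poly_Mapping.lookup v m" "Poly_Mapping.lookup (C k (C (Suc k) v)) m"]
        by (simp add: sg_def Aop_def X_T_eig[OF k v] X_CC_eig[OF k v] lookup_simps s_t_def[symmetric] algebra_simps)
    qed
  next
    case 2
    have m: "E * t * m1 + E * s * m2 - t * (E * aa s t) * m1 - inverse t * (E * bb s t) * m2 =
        - s * (E * aa s t) * m1 - s * (E * bb s t) * m2" for m1 m2
    proof -
      have "E * t * m1 + E * s * m2 - t * (E * aa s t) * m1 - inverse t * (E * bb s t) * m2 +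
        s * (E * aa s t) * m1 + s * (E * bb s t) * m2 =
        E * m1 * (t - (t * aa s t - s * aa s t)) + E * m2 * (s - (bb s t * inverse t - s * bb s t))"
        by (simp add: algebra_simps)
      also have "\<dots> = 0" unfolding c1 by simp
      finally show ?thesis by (simp add: algebra_simps)
    qed
    show ?thesis unfolding 2
    proof (rule vec_eqI)
      fix m'
      show "Poly_Mapping.lookup (X (Suc k) (sg k x v)) m' = Poly_Mapping.lookup (scl ((x \<circ> adj_swap k) (Suc k)) (sg k x v)) m'"
        using k k' e m[of "Poly_Mapping.lookup v m'" "Poly_Mapping.lookup (C k (C (Suc k) v)) m'"]
        by (simp add: sg_def Aop_def X_T_eig[OF k v] X_CC_eig[OF k v] lookup_simps s_t_def[symmetric] algebra_simps)
    qed
  next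
    case 3
    then show ?thesis
      using k k' l e TX_far[OF k l, of v, symmetric]
      by (simp add: sg_def Aop_def XC_far scl_simps mult.commute)
  qed
qed

text \<open>In the expansion the terms containing T_k cancel because aa x y + aa y x = 1 and bb is
  symmetric. The constant from the quadratic relation and the product of the Clifford parts remain
  and add up to \<open>gg\<close>.\<close>

lemma sg_sg:
  assumes k: "k \<in> {1..<n}" and v: "eig x v" and ne: "x k \<noteq> x (Suc k)" "x k * x (Suc k) \<noteq> 1"
  shows "sg k (x \<circ> adj_swap k) (sg k x v) = scl (gg E (x k) (x (Suc k))) v"
proof -
  have k': "k \<in> {1..n}" "Suc k \<in> {1..n}" using k by auto
  note e = eigD[OF v]
  have anti: "C (Suc k) (C k w) = - C k (C (Suc k) w)" if "w \<in> U" for w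
    by (rule C_anti) (use k' that in auto)
  have ab: "aa (x (Suc k)) (x k) = 1 - aa (x k) (x (Suc k))" "bb (x (Suc k)) (x k) = bb (x k) (x (Suc k))"
    using aa_bb_inverse[OF e(3)[OF k'(1)] e(3)[OF k'(2)] ne] by simp_all
  have Tc: "T k (C k (C (Suc k) v)) = - C k (C (Suc k) (T k v)) + scl E (C k (C (Suc k) v)) + scl E v"
    using k k' e(1) by (simp add: TC_near TC_next scl_simps anti)
  show ?thesis
    by (rule vec_eqI)
      (use k k' e(1) in \<open>simp add: sg_def Aop_def ab Tc anti T_quad gg_def lookup_simps power2_eq_square algebra_simps\<close>)
qed

end

section \<open>Weights of completely splittable modules\<close>

text \<open>Semisimplicity enters as \<open>ss\<close>: a vector killed by the square of X_j - c is
  already killed by X_j - c.\<close>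

locale cs_module = hc_module U n C q T X Y + quantum q h
  for U :: "'a::alg_closed_field vec set" and n C q T X Y h +
  assumes ss: "j \<in> {1..n} \<Longrightarrow> v \<in> U \<Longrightarrow> X j (X j v - scl c v) - scl c (X j v - scl c v) = 0 \<Longrightarrow> X j v = scl c v"
begin

lemma E_nz: "E \<noteq> 0"
proof
  assume "E = 0"
  then have "(q - 1) * (q + 1) = 0" using q_nz by (simp add: eps_def field_simps)
  then show False using q_n1 q_nm1 by (auto simp: eq_neg_iff_add_eq_0)
qed

text \<open>With equal eigenvalues s at k and k + 1, X_(k+1) maps T_k u to s T_k u + E s (u + C_k
  C_(k+1) u). This produces a generalised eigenvector that is not an eigenvector, against
  semisimplicity. The two cases differ in whether C_k C_(k+1) u also has eigenvalue s.\<close>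

lemma eig_distinct:
  assumes k: "k \<in> {1..<n}" and v: "eig x v" "v \<noteq> 0"
  shows "x k + inverse (x k) \<noteq> x (Suc k) + inverse (x (Suc k))"
proof
  assume eq: "x k + inverse (x k) = x (Suc k) + inverse (x (Suc k))"
  have k': "k \<in> {1..n}" "Suc k \<in> {1..n}" using k by auto
  have anti: "C (Suc k) (C k w) = - C k (C (Suc k) w)" if "w \<in> U" for w
    by (rule C_anti) (use k' that in auto)
  \<comment> \<open>If the two eigenvalues are inverse to each other, C_(k+1) makes them
    equal.\<close>
  have "\<exists>y u. eig y u \<and> u \<noteq> 0 \<and> y (Suc k) = y k"
  proof (cases "x k = x (Suc k)")
    case False
    then have "x k * x (Suc k) = 1"
      using sum_inverse_eq_iff eq eigD(3)[OF v(1)] k' by blast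
    then have "inverse (x (Suc k)) = x k" by (metis inverse_unique mult.commute)
    moreover have "C (Suc k) v \<noteq> 0"
    proof
      assume "C (Suc k) v = 0"
      then have "C (Suc k) (C (Suc k) v) = 0" using lin_onD(6)[OF C_lin[OF k'(2)]] by simp
      then show False using k' eigD(1)[OF v(1)] v(2) by simp
    qed
    ultimately show ?thesis
      using eig_C[OF v(1) k'(2)]
      by (intro exI[of _ "x(Suc k := inverse (x (Suc k)))"] exI[of _ "C (Suc k) v"]) simp
  next
    case True
    then show ?thesis using v by (intro exI[of _ x] exI[of _ v]) simp
  qed
  then obtain y u where u: "eig y u" "u \<noteq> 0" and y: "y (Suc k) = y k" by blast
  note e = eigD[OF u(1)]
  define s where "s = y k"
  have s: "s \<noteq> 0" "y k = s" "y (Suc k) = s" using e(3) k' y by (auto simp: s_def)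
  note XT = X_T_eig(2)[OF k u(1)] and XC = X_CC_eig(2)[OF k u(1)]
  define c where "c = C k (C (Suc k) u)"
  have cU: "c \<in> U" and Xc: "X (Suc k) c = scl (inverse s) c" and Xu: "X (Suc k) u = scl s u"
    and XTu: "X (Suc k) (T k u) = scl s (T k u) + scl (E * s) u + scl (E * s) c"
    using XT XC e k' by (simp_all add: c_def s(2,3))
  have TU: "T k u \<in> U" using k e(1) by simp
  show False
  proof (cases "inverse s = s")
    case True
    have "X (Suc k) (T k u) = scl s (T k u)"
      by (rule ss) (use k' TU cU e(1) in \<open>simp_all add: XTu Xc Xu True scl_simps mult.commute\<close>)
    then have "scl (E * s) (u + c) = 0" by (simp add: XTu scl_simps)
    then have uc: "u + c = 0" using E_nz s(1) by simp
    then have cu: "c = - u" by (simp add: eq_neg_iff_add_eq_0 add.commute)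
    \<comment> \<open>C_k C_(k+1) squares to -1, so it cannot send u to -u unless 2u = 0.\<close>
    have "C k (C (Suc k) c) = - u" unfolding c_def using k' e(1) by (simp add: anti)
    then have "u = - u" unfolding cu using k' e(1) by (simp flip: c_def add: cu)
    then have "scl 2 u = 0" by (metis add.right_inverse one_add_one vsp.scale_left_distrib vsp.scale_one)
    then show False using two_nz u(2) by simp
  next
    case False
    \<comment> \<open>Subtracting the multiple by \<open>inverse s\<close> removes the component
      along c and leaves a vector in the generalised eigenspace of s.\<close>
    define t where "t = X (Suc k) (T k u) - scl (inverse s) (T k u)"
    have tU: "t \<in> U" using TU k' by (simp add: t_def)
    have Xt: "X (Suc k) t - scl s t = scl ((s - inverse s) * (E * s)) u"
      by (rule vec_eqI) (use k' TU cU e(1) in \<open>simp add: t_def XTu Xc Xu lookup_simps algebra_simps\<close>)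
    have "X (Suc k) t = scl s t"
      by (rule ss) (use k' tU e(1) in \<open>simp_all add: Xt Xu mult.commute\<close>)
    then have "scl ((s - inverse s) * (E * s)) u = 0" using Xt by simp
    then show False using False E_nz s(1) u(2) by simp
  qed
qed

text \<open>A weight witnessed by a joint eigenvector instead of a generalised one. In the
  completely splittable case it agrees with \<open>is_weight\<close>, by
  \<open>eigen_weight_if_weight\<close> and \<open>weight_if_eigen_weight\<close>.\<close>

definition eigen_weight :: "(nat \<Rightarrow> nat) \<Rightarrow> bool" where
  "eigen_weight i \<longleftrightarrow> i \<in> {1..n} \<rightarrow>\<^sub>E index_set h \<and>
     (\<exists>x v. eig x v \<and> v \<noteq> 0 \<and> (\<forall>j\<in>{1..n}. x j + inverse (x j) = qval q (i j)))"

lemma eigen_weight_distinct: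
  assumes "eigen_weight i" "1 \<le> k" "k < n"
  shows "i k \<noteq> i (k + 1)"
proof -
  obtain x v where "eig x v" "v \<noteq> 0" "\<forall>j\<in>{1..n}. x j + inverse (x j) = qval q (i j)"
    using assms(1) by (auto simp: eigen_weight_def)
  then show ?thesis using eig_distinct[of k x v] assms(2,3) by auto
qed

lemma sg_zero: "k \<in> {1..<n} \<Longrightarrow> sg k x 0 = 0"
  by (simp add: sg_def Aop_def lin_onD(6)[OF C_lin] lin_onD(6)[OF T_lin])

lemma eigen_weight_swap:
  assumes "eigen_weight i" "1 \<le> k" "k < n" "\<not> close (i k) (i (k + 1))"
  shows "eigen_weight (i \<circ> adj_swap k)"
proof -
  have k: "k \<in> {1..<n}" "k \<in> {1..n}" "Suc k \<in> {1..n}" using assms by auto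
  obtain x v where v: "eig x v" "v \<noteq> 0" and x: "\<And>j. j \<in> {1..n} \<Longrightarrow> x j + inverse (x j) = qval q (i j)"
    and i: "i \<in> {1..n} \<rightarrow>\<^sub>E index_set h"
    using assms(1) by (auto simp: eigen_weight_def)
  note nz = eigD(3)[OF v(1)]
  have swp: "adj_swap k j \<in> {1..n}" if "j \<in> {1..n}" for j
    using that assms(2,3) by (auto simp: adj_swap_def)
  have ik: "i k \<in> index_set h" "i (k + 1) \<in> index_set h" "i k \<noteq> i (k + 1)"
    using i k assms(4) by (auto simp: close_def)
  have sum: "x k + inverse (x k) \<noteq> x (Suc k) + inverse (x (Suc k))"
    by (rule eig_distinct[OF k(1) v])
  then have ne: "x k \<noteq> x (Suc k)" "x k * x (Suc k) \<noteq> 1"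
    using sum_inverse_eq_iff[OF nz[OF k(2)] nz[OF k(3)]] by auto
  have "gg E (x k) (x (Suc k)) \<noteq> 0"
  proof
    assume "gg E (x k) (x (Suc k)) = 0"
    then have "(qval q (i k) - qval q (i (k + 1)))\<^sup>2 = E\<^sup>2 * (qval q (i k) * qval q (i (k + 1)) - 4)"
      using gg_eq[OF nz[OF k(2)] nz[OF k(3)] ne, of E] sum x[OF k(2)] x[OF k(3)]
      by (simp add: divide_simps split: if_splits)
    then show False using link_iff[OF ik] assms(4) by (auto simp: close_def)
  qed
  then have "sg k (x \<circ> adj_swap k) (sg k x v) \<noteq> 0" using sg_sg[OF k(1) v(1) ne] v(2) by simp
  then have "sg k x v \<noteq> 0" using sg_zero[OF k(1)] by metis
  moreover have "i \<circ> adj_swap k \<in> {1..n} \<rightarrow>\<^sub>E index_set h"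
    using i swp assms(2,3) by (auto simp: PiE_iff extensional_def adj_swap_def)
  ultimately show ?thesis
    using eig_sg[OF k(1) v(1) ne] x swp unfolding eigen_weight_def
    by (intro conjI exI[of _ "x \<circ> adj_swap k"] exI[of _ "sg k x v"]) auto
qed

text \<open>From the pattern (a, b, a) a nonzero intertwined vector would have two equal
  neighbouring entries, which \<open>eig_distinct\<close> excludes. So both generators act through
  \<open>Aop\<close> alone on all eigenvectors of this weight, and the scalar in
  \<open>braid_defect\<close> must be zero.\<close>

lemma eigen_weight_triple:
  assumes "eigen_weight i" "1 \<le> k" "k + 2 \<le> n" "i k = i (k + 2)" "close (i k) (i (k + 1))"
  shows "tight h (i k) (i (k + 1))"
proof -
  have k: "k \<in> {1..n}" "Suc k \<in> {1..n}" "Suc (Suc k) \<in> {1..n}" "k \<in> {1..<n}" "Suc k \<in> {1..<n}"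
    using assms by auto
  obtain x v where v: "eig x v" "v \<noteq> 0" and x: "\<And>j. j \<in> {1..n} \<Longrightarrow> x j + inverse (x j) = qval q (i j)"
    and i: "i \<in> {1..n} \<rightarrow>\<^sub>E index_set h"
    using assms(1) by (auto simp: eigen_weight_def)
  note nz = eigD(3)[OF v(1)]
  define P where "P y u \<longleftrightarrow> eig y u \<and> (\<forall>j\<in>{1..n}. y j + inverse (y j) = qval q (i j))" for y u
  have sum: "x k + inverse (x k) \<noteq> x (Suc k) + inverse (x (Suc k))"
    by (rule eig_distinct[OF k(4) v])
  then have ne: "x k \<noteq> x (Suc k)" "x k * x (Suc k) \<noteq> 1"
    using sum_inverse_eq_iff[OF nz[OF k(1)] nz[OF k(2)]] by auto
  have ii: "i (Suc (Suc k)) = i k" using assms(4) by simp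
  have qne: "qval q (i k) \<noteq> qval q (i (Suc k))" using sum x[OF k(1)] x[OF k(2)] by simp
  have PC: "P (y(j := inverse (y j))) (C j u)" if "P y u" "j \<in> {1..n}" for y u j
    using that eig_C[of y u j] by (auto simp: P_def add.commute)
  have TA: "T k u = Aop E k (Suc k) y u" "T (Suc k) u = Aop E (Suc k) (Suc (Suc k)) y u" if Pu: "P y u" for y u
  proof -
    have u: "eig y u" and y: "\<And>j. j \<in> {1..n} \<Longrightarrow> y j + inverse (y j) = qval q (i j)"
      using Pu by (auto simp: P_def)
    note nzy = eigD(3)[OF u]
    have ney: "y k \<noteq> y (Suc k)" "y k * y (Suc k) \<noteq> 1"
      using sum_inverse_eq_iff[OF nzy[OF k(1)] nzy[OF k(2)]] y[OF k(1)] y[OF k(2)] qne by auto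
    have ney': "y (Suc k) \<noteq> y (Suc (Suc k))" "y (Suc k) * y (Suc (Suc k)) \<noteq> 1"
      using sum_inverse_eq_iff[OF nzy[OF k(2)] nzy[OF k(3)]] y[OF k(2)] y[OF k(3)] qne ii by auto
    have "sg k y u = 0"
    proof (rule ccontr)
      assume "sg k y u \<noteq> 0"
      from eig_distinct[OF k(5) eig_sg[OF k(4) u ney] this]
      show False using y[OF k(1)] y[OF k(3)] ii by simp
    qed
    then show "T k u = Aop E k (Suc k) y u" by (simp add: sg_def)
    have "sg (Suc k) y u = 0"
    proof (rule ccontr)
      assume "sg (Suc k) y u \<noteq> 0"
      from eig_distinct[OF k(4) eig_sg[OF k(5) u ney'] this]
      show False using y[OF k(1)] y[OF k(3)] ii by simp
    qed
    then show "T (Suc k) u = Aop E (Suc k) (Suc (Suc k)) y u" by (simp add: sg_def)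
  qed
  define K where "K = E ^ 3 * (aa (x k) (x (Suc k)) * (1 - aa (x k) (x (Suc k))) * (2 * aa (x k) (x (Suc k)) - 1) -
    (1 + bb (x k) (x (Suc k))) * bb (x k) (x (Suc k)) * (2 * bb (x k) (x (Suc k)) + 1))"
  have Pv: "P x v" using v x by (simp add: P_def)
  have PU: "u \<in> U" if "P y u" for y u using that by (auto simp: P_def eig_def)
  have neq: "k \<noteq> Suc k" "Suc k \<noteq> Suc (Suc k)" "k \<noteq> Suc (Suc k)" by auto
  have defect: "x (Suc (Suc k)) = x k \<Longrightarrow> T k (T (Suc k) (T k v)) - T (Suc k) (T k (T (Suc k) v)) = scl K v"
    "x (Suc (Suc k)) = inverse (x k) \<Longrightarrow>
      T k (T (Suc k) (T k v)) - T (Suc k) (T k (T (Suc k) v)) = scl K (C k (C (Suc (Suc k)) v))"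
    by (rule braid_defect[where P = P and x = x and p = k and q = "Suc k" and r = "Suc (Suc k)"
          and E = E, OF k(1-3) neq T_lin[OF k(4)] T_lin[OF k(5)]];
        (assumption | rule refl K_def Pv nz k ne PC TA | erule PU)+)+
  have br: "T k (T (Suc k) (T k v)) - T (Suc k) (T k (T (Suc k) v)) = 0"
    using T_braid[OF k(4,5) eigD(1)[OF v(1)]] by simp
  have "x (Suc (Suc k)) = x k \<or> x (Suc (Suc k)) = inverse (x k)"
    using sum_inverse_eq_iff[OF nz[OF k(1)] nz[OF k(3)]] x[OF k(1)] x[OF k(3)] ii by (auto simp: inverse_unique)
  then have "K = 0"
  proof
    assume "x (Suc (Suc k)) = x k"
    from defect(1)[OF this] show ?thesis using br v(2) by simp
  next
    assume "x (Suc (Suc k)) = inverse (x k)"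
    from defect(2)[OF this] have "scl K (C k (C (Suc (Suc k)) v)) = 0" using br by simp
    \<comment> \<open>The Clifford generators square to 1, so they can be stripped off.\<close>
    then have "C (Suc (Suc k)) (C k (scl K (C k (C (Suc (Suc k)) v)))) = C (Suc (Suc k)) (C k 0)"
      by (simp only:)
    then have "scl K v = 0"
      using k eigD(1)[OF v(1)] lin_onD(6)[OF C_lin[OF k(1)]] lin_onD(6)[OF C_lin[OF k(3)]]
      by (simp del: scl_simps vsp.scale_eq_0_iff)
    then show ?thesis using v(2) by simp
  qed
  then have "x k * x k = 1 \<or> qval q (i (Suc k)) * (qval q (i k) + qval q (i (Suc k))) = 8"
    using defect_factor[OF nz[OF k(1)] nz[OF k(2)] ne] E_nz x[OF k(1)] x[OF k(2)] by (simp add: K_def)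
  moreover have ik: "i k \<in> index_set h" "i (Suc k) \<in> index_set h" using i k by auto
  moreover have adj: "i (Suc k) = i k + 1 \<or> i k = i (Suc k) + 1"
    using assms(5) qne by (auto simp: close_def le_Suc_eq)
  moreover have "x k * x k = 1 \<Longrightarrow> end_index (i k)"
    using self_inverse_iff[OF ik(1) nz[OF k(1)] x[OF k(1)]] by (simp add: inverse_unique)
  ultimately have "end_index (i k) \<or> odd_special (i k) (i (Suc k))"
    using special_iff[OF ik adj] by blast
  then show ?thesis
  proof
    assume "odd_special (i k) (i (Suc k))"
    then show ?thesis by (auto simp: odd_special_def tight_def)
  next
    assume "end_index (i k)"
    then consider "i k = 0" | m where "h = enat m" "even m" "i k = m div 2 - 1" by (auto simp: end_index_def)
    then show ?thesis
    proof cases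
      case 1
      then show ?thesis using adj by (auto simp: tight_def)
    next
      case (2 m)
      \<comment> \<open>At the top index the linked neighbour can only lie below.\<close>
      then have "i (Suc k) \<le> i k" using ik(2) by (simp add: index_set_iff index_max_def)
      then show ?thesis using adj 2 by (auto simp: tight_def)
    qed
  qed
qed

theorem eigen_weight_conditions:
  assumes "eigen_weight i"
  shows "weight_conditions h n i"
proof (rule conditions_if_well_separated)
  show "i x \<in> index_set h" if "x \<in> {1..n}" for x
    using assms that by (auto simp: eigen_weight_def)
  show "well_separated h n i"
    by (rule well_separated_if_closed[where W = "Collect eigen_weight"])
      (use assms eigen_weight_distinct eigen_weight_swap eigen_weight_triple in \<open>auto simp: eigen_weight_def\<close>)
qed

end

section \<open>From supermodules to operators\<close>

lemma letters_simps [simp]: "letters (u + v) = letters u @ letters v" "letters 0 = []"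
  by (simp_all add: plus_gword_def zero_gword_def)

lemma free_alg_simps [simp]:
  "p \<otimes>\<^bsub>free_alg n\<^esub> r = p * r" "p \<oplus>\<^bsub>free_alg n\<^esub> r = p + r" "\<one>\<^bsub>free_alg n\<^esub> = 1" "\<zero>\<^bsub>free_alg n\<^esub> = 0"
  by (simp_all add: free_alg_def)

lemma free_alg_carrier_iff:
  "p \<in> carrier (free_alg n) \<longleftrightarrow> (\<forall>w \<in> Poly_Mapping.keys p. set (letters w) \<subseteq> gens n)"
  by (simp add: free_alg_def)

lemma free_alg_closed [simp]:
  "0 \<in> carrier (free_alg n)" "1 \<in> carrier (free_alg n)"
  "p \<in> carrier (free_alg n) \<Longrightarrow> r \<in> carrier (free_alg n) \<Longrightarrow> p + r \<in> carrier (free_alg n)"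
  "p \<in> carrier (free_alg n) \<Longrightarrow> - p \<in> carrier (free_alg n)"
  "p \<in> carrier (free_alg n) \<Longrightarrow> r \<in> carrier (free_alg n) \<Longrightarrow> p - r \<in> carrier (free_alg n)"
  "p \<in> carrier (free_alg n) \<Longrightarrow> r \<in> carrier (free_alg n) \<Longrightarrow> p * r \<in> carrier (free_alg n)"
  "scal c \<in> carrier (free_alg n)"
proof -
  show "0 \<in> carrier (free_alg n)" "1 \<in> carrier (free_alg n)" "scal c \<in> carrier (free_alg n)"
    by (auto simp: free_alg_carrier_iff scal_def split: if_splits)
  show "p + r \<in> carrier (free_alg n)" "p - r \<in> carrier (free_alg n)"
    if "p \<in> carrier (free_alg n)" "r \<in> carrier (free_alg n)"
    using that Poly_Mapping.keys_add[of p r] keys_diff[of p r] unfolding free_alg_carrier_iff by blast+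
  show "- p \<in> carrier (free_alg n)" if "p \<in> carrier (free_alg n)"
    using that by (simp add: free_alg_carrier_iff)
  show "p * r \<in> carrier (free_alg n)" if "p \<in> carrier (free_alg n)" "r \<in> carrier (free_alg n)"
    unfolding free_alg_carrier_iff
  proof
    fix w assume "w \<in> Poly_Mapping.keys (p * r)"
    then obtain u v where "w = u + v" "u \<in> Poly_Mapping.keys p" "v \<in> Poly_Mapping.keys r"
      using keys_mult[of p r] by blast
    then show "set (letters w) \<subseteq> gens n" using that by (simp add: free_alg_carrier_iff)
  qed
qed

lemma mon_closed [simp]: "g \<in> gens n \<Longrightarrow> mon g \<in> carrier (free_alg n)"
  by (auto simp: free_alg_carrier_iff)

lemma gens_simps [simp]:
  "GT i \<in> gens n \<longleftrightarrow> i \<in> {1..<n}" "GX i \<in> gens n \<longleftrightarrow> i \<in> {1..n}"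
  "GXinv i \<in> gens n \<longleftrightarrow> i \<in> {1..n}" "GC i \<in> gens n \<longleftrightarrow> i \<in> {1..n}"
  by (auto simp: gens_def)

lemma free_alg_ring: "ring (free_alg n :: 'a::field free ring)"
proof (rule ringI)
  show "abelian_group (free_alg n :: 'a free ring)"
    by (rule abelian_groupI) (auto simp: add.assoc add.commute intro!: bexI[of _ "- _"])
  show "monoid (free_alg n :: 'a free ring)"
    by (rule monoidI) (auto simp: mult.assoc)
qed (auto simp: distrib_left distrib_right)

lemma free_alg_minus:
  assumes "p \<in> carrier (free_alg n)" "r \<in> carrier (free_alg n :: 'a::field free ring)"
  shows "p \<ominus>\<^bsub>free_alg n\<^esub> r = p - r"
proof -
  interpret ring "free_alg n :: 'a free ring" by (rule free_alg_ring)
  have "\<ominus>\<^bsub>free_alg n\<^esub> r = - r"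
    by (rule minus_equality) (use assms in auto)
  then show ?thesis by (simp add: a_minus_def)
qed

lemma hc_rel_closed:
  "(l, r) \<in> hc_rel n q \<Longrightarrow> l \<in> carrier (free_alg n) \<and> r \<in> carrier (free_alg n)"
  by (induction rule: hc_rel.induct) simp_all

lemma hc_ideal_ideal: "ideal (hc_ideal n q) (free_alg n)"
  unfolding hc_ideal_def
  by (rule ring.genideal_ideal[OF free_alg_ring]) (auto dest: hc_rel_closed)

lemma cls_hom: "cls n q \<in> ring_hom (free_alg n) (Haff n q)"
proof -
  have "cls n q = (+>\<^bsub>free_alg n\<^esub>) (hc_ideal n q)" by (simp add: cls_def fun_eq_iff)
  then show ?thesis unfolding Haff_def using ideal.rcos_ring_hom[OF hc_ideal_ideal] by metis
qed

lemmas cls_closed = ring_hom_closed[OF cls_hom]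
  and cls_mult = ring_hom_mult[OF cls_hom, simplified]
  and cls_add = ring_hom_add[OF cls_hom, simplified]
  and cls_one = ring_hom_one[OF cls_hom, simplified]

lemma carrier_Haff: "carrier (Haff n q) = cls n q ` carrier (free_alg n)"
  by (auto simp: Haff_def FactRing_def A_RCOSETS_def' cls_def)

lemma cls_eq_iff:
  assumes "p \<in> carrier (free_alg n)" "r \<in> carrier (free_alg n)"
  shows "cls n q p = cls n q r \<longleftrightarrow> p - r \<in> hc_ideal n q"
  using ring.quotient_eq_iff_same_a_r_cos[OF free_alg_ring hc_ideal_ideal assms]
  by (simp add: cls_def free_alg_minus[OF assms])

lemma cls_rel:
  assumes "(l, r) \<in> hc_rel n q"
  shows "cls n q l = cls n q r"
proof -
  have "l - r \<in> {l - r | l r. (l, r) \<in> hc_rel n q}" using assms by blast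
  moreover have "{l - r | l r. (l, r) \<in> hc_rel n q} \<subseteq> hc_ideal n q"
    unfolding hc_ideal_def by (rule ring.genideal_self[OF free_alg_ring]) (auto dest: hc_rel_closed)
  ultimately show ?thesis using cls_eq_iff hc_rel_closed[OF assms] by blast
qed

lemma scal_mon_comm: "scal c * mon g = mon g * scal c"
  by (simp add: scal_def mult_single)

lemma subspace_total:
  assumes "\<And>a. vsp.subspace (V a)"
  shows "vsp.subspace (total V)"
  unfolding total_def ssum_def by (rule vsp.subspace_sums) (rule assms)+

lemma part_subset_total:
  assumes "\<And>a. vsp.subspace (V a)"
  shows "V a \<subseteq> total V"
proof
  fix v assume v: "v \<in> V a"
  have 0: "0 \<in> V b" for b using vsp.subspace_0[OF assms] .
  have "v = v + 0" "v = 0 + v" by simp_all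
  then show "v \<in> total V"
    using v 0 unfolding total_def ssum_def by (cases a) blast+
qed

locale supermod =
  fixes n :: nat and q :: "'a::field" and V and act :: "'a action"
  assumes sm: "supermodule n q V act"
begin

lemma sub: "vsp.subspace (V a)" using sm by (auto simp: supermodule_def)

lemma graded: "g \<in> Haff_part n q b \<Longrightarrow> v \<in> V a \<Longrightarrow> act g v \<in> V (b + a)"
  using sm unfolding supermodule_def by blast

abbreviation "U \<equiv> total V"
abbreviation "A p \<equiv> act (cls n q p)"

lemma A_plus: "p \<in> carrier (free_alg n) \<Longrightarrow> v \<in> U \<Longrightarrow> w \<in> U \<Longrightarrow> A p (v + w) = A p v + A p w"
  using sm cls_closed unfolding supermodule_def by blast

lemma A_ring:
  assumes "p \<in> carrier (free_alg n)" "r \<in> carrier (free_alg n)" "v \<in> U"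
  shows "A (p + r) v = A p v + A r v" "A (p * r) v = A p (A r v)"
  using sm cls_closed[OF assms(1)] cls_closed[OF assms(2)] assms
  unfolding supermodule_def by (simp_all add: cls_add cls_mult)

lemma A_one: "v \<in> U \<Longrightarrow> A 1 v = v" and A_scal: "v \<in> U \<Longrightarrow> A (scal c) v = scl c v"
  using sm unfolding supermodule_def by (simp_all add: cls_one)

lemma mon_part: "g \<in> gens n \<Longrightarrow> cls n q (mon g) \<in> Haff_part n q (gen_parity g)"
  unfolding Haff_part_def by (intro image_eqI[OF refl]) (auto simp: word_parity_def)

text \<open>Closure is an axiom only for homogeneous vectors, so v is split into its even and its
  odd part.\<close>

lemma A_mon_closed:
  assumes g: "g \<in> gens n" and v: "v \<in> U"
  shows "A (mon g) v \<in> U"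
proof -
  obtain v0 v1 where v01: "v = v0 + v1" "v0 \<in> V 0" "v1 \<in> V 1"
    using v unfolding total_def ssum_def by blast
  have in_U: "V a \<subseteq> U" for a by (rule part_subset_total[OF sub])
  have "A (mon g) v = A (mon g) v0 + A (mon g) v1"
    unfolding v01(1) using A_plus[OF mon_closed[OF g]] v01 in_U by blast
  moreover have "A (mon g) v0 \<in> U" "A (mon g) v1 \<in> U"
    using graded[OF mon_part[OF g]] v01 in_U by blast+
  ultimately show ?thesis using vsp.subspace_add[OF subspace_total[OF sub]] by simp
qed

lemma A_scal_mult:
  assumes "p \<in> carrier (free_alg n)" "v \<in> U" "A p v \<in> U"
  shows "A (scal c * p) v = scl c (A p v)"
  using A_ring(2)[of "scal c" p v] assms by (simp add: A_scal)

lemma A_mon_lin: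
  assumes "g \<in> gens n"
  shows "lin_on U (A (mon g))"
proof -
  have "A (mon g) (scl c v) = scl c (A (mon g) v)" if "v \<in> U" for c v
    using A_ring(2)[of "mon g" "scal c" v] A_scal_mult[of "mon g" v c] A_mon_closed[OF assms that] that assms
    by (simp add: scal_mon_comm A_scal)
  then show ?thesis
    using A_mon_closed[OF assms] A_plus[OF mon_closed[OF assms]] by (auto simp: lin_on_def)
qed

lemma A_minus:
  assumes "p \<in> carrier (free_alg n)" "r \<in> carrier (free_alg n)" "v \<in> U" "A r v \<in> U"
  shows "A (p - r) v = A p v - A r v"
proof -
  have "(p - r) + r = p" by simp
  then have "A p v = A (p - r) v + A r v" using A_ring(1)[of "p - r" r v] assms by simp
  then show ?thesis by simp
qed

lemma A_rel:
  assumes "(l, r) \<in> hc_rel n q"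
  shows "A l v = A r v"
  using cls_rel[OF assms] by simp

lemma hc_module:
  "hc_module (total V) n (\<lambda>i. A (fC i)) q (\<lambda>i. A (fT i)) (\<lambda>i. A (fX i)) (\<lambda>i. A (fXinv i))"
proof -
  note U_add = vsp.subspace_add[OF subspace_total[OF sub]]
    and U_scl = vsp.subspace_scale[OF subspace_total[OF sub]]
    and U_diff = vsp.subspace_diff[OF subspace_total[OF sub]]
  have S: "A (- (p * r)) v = - A p (A r v)"
    if "p \<in> carrier (free_alg n)" "r \<in> carrier (free_alg n)" "v \<in> U" "A p (A r v) \<in> U" for p r v
    using A_minus[of 0 "p * r" v] A_minus[of "p * r" "p * r" v] that by (simp add: A_ring)
  have rel2: "x = y" if "(l, r) \<in> hc_rel n q" "A l v = x" "A r v = y" for l r v x y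
    using A_rel[OF that(1), of v] that(2,3) by simp
  note simps = A_ring A_minus A_scal A_mon_closed A_one S U_add U_scl U_diff
  show ?thesis
  proof
    show "vsp.subspace U" by (rule subspace_total[OF sub])
    show "lin_on U (A (fC i))" "lin_on U (A (fX i))" "lin_on U (A (fXinv i))" if "i \<in> {1..n}" for i
      using that by (simp_all add: A_mon_lin)
    show "lin_on U (A (fT i))" if "i \<in> {1..<n}" for i
      using that by (simp add: A_mon_lin)
    show "A (fT i) (A (fT i) v) = scl (eps q) (A (fT i) v) + v"
      if "i \<in> {1..<n}" "v \<in> U" for i v
      by (rule rel2[where v = v, OF hc_rel.T_quad[OF that(1), of q]]) (use that in \<open>simp_all add: simps\<close>)
    show "A (fT i) (A (fT j) v) = A (fT j) (A (fT i) v)"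
      if "i \<in> {1..<n}" "j \<in> {1..<n}" "\<bar>int i - int j\<bar> > 1" "v \<in> U" for i j v
      by (rule rel2[where v = v, OF hc_rel.T_comm[OF that(1) that(2) that(3), of q]]) (use that in \<open>simp_all add: simps\<close>)
    show "A (fT i) (A (fT (Suc i)) (A (fT i) v)) = A (fT (Suc i)) (A (fT i) (A (fT (Suc i)) v))"
      if "i \<in> {1..<n}" "Suc i \<in> {1..<n}" "v \<in> U" for i v
      by (rule rel2[where v = v, OF hc_rel.T_braid[of i n q]]) (use that in \<open>simp_all add: simps\<close>)
    show "A (fX i) (A (fX j) v) = A (fX j) (A (fX i) v)"
      if "i \<in> {1..n}" "j \<in> {1..n}" "v \<in> U" for i j v
      by (rule rel2[where v = v, OF hc_rel.X_comm[OF that(1) that(2), of q]]) (use that in \<open>simp_all add: simps\<close>)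
    show "A (fX i) (A (fXinv i) v) = v"
      if "i \<in> {1..n}" "v \<in> U" for i v
      by (rule rel2[where v = v, OF hc_rel.X_inv_right[OF that(1), of q]]) (use that in \<open>simp_all add: simps\<close>)
    show "A (fXinv i) (A (fX i) v) = v"
      if "i \<in> {1..n}" "v \<in> U" for i v
      by (rule rel2[where v = v, OF hc_rel.X_inv_left[OF that(1), of q]]) (use that in \<open>simp_all add: simps\<close>)
    show "A (fC i) (A (fC i) v) = v"
      if "i \<in> {1..n}" "v \<in> U" for i v
      by (rule rel2[where v = v, OF hc_rel.C_square[OF that(1), of q]]) (use that in \<open>simp_all add: simps\<close>)
    show "A (fC i) (A (fC j) v) = - A (fC j) (A (fC i) v)"
      if "i \<in> {1..n}" "j \<in> {1..n}" "i \<noteq> j" "v \<in> U" for i j v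
      by (rule rel2[where v = v, OF hc_rel.C_anticomm[OF that(1) that(2) that(3), of q]]) (use that in \<open>simp_all add: simps\<close>)
    show "A (fT i) (A (fX i) v) = A (fX (Suc i)) (A (fT i) v) -
        scl (eps q) (A (fX (Suc i)) v + A (fC i) (A (fC (Suc i)) (A (fX i) v)))"
      if "i \<in> {1..<n}" "v \<in> U" for i v
      by (rule rel2[where v = v, OF hc_rel.TX_near[OF that(1), of q]]) (use that in \<open>simp_all add: simps\<close>)
    show "A (fT i) (A (fX j) v) = A (fX j) (A (fT i) v)"
      if "i \<in> {1..<n}" "j \<in> {1..n}" "j \<noteq> i" "j \<noteq> Suc i" "v \<in> U" for i j v
      by (rule rel2[where v = v, OF hc_rel.TX_far[of i n j q]]) (use that in \<open>simp_all add: simps\<close>)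
    show "A (fT i) (A (fC i) v) = A (fC (Suc i)) (A (fT i) v)"
      if "i \<in> {1..<n}" "v \<in> U" for i v
      by (rule rel2[where v = v, OF hc_rel.TC_near[OF that(1), of q]]) (use that in \<open>simp_all add: simps\<close>)
    show "A (fT i) (A (fC (Suc i)) v) = A (fC i) (A (fT i) v) -
        scl (eps q) (A (fC i) v - A (fC (Suc i)) v)"
      if "i \<in> {1..<n}" "v \<in> U" for i v
      by (rule rel2[where v = v, OF hc_rel.TC_next[OF that(1), of q]]) (use that in \<open>simp_all add: simps\<close>)
    show "A (fT i) (A (fC j) v) = A (fC j) (A (fT i) v)"
      if "i \<in> {1..<n}" "j \<in> {1..n}" "j \<noteq> i" "j \<noteq> Suc i" "v \<in> U" for i j v
      by (rule rel2[where v = v, OF hc_rel.TC_far[of i n j q]]) (use that in \<open>simp_all add: simps\<close>)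
    show "A (fX i) (A (fC i) v) = A (fC i) (A (fXinv i) v)"
      if "i \<in> {1..n}" "v \<in> U" for i v
      by (rule rel2[where v = v, OF hc_rel.XC_same[OF that(1), of q]]) (use that in \<open>simp_all add: simps\<close>)
    show "A (fX i) (A (fC j) v) = A (fC j) (A (fX i) v)"
      if "i \<in> {1..n}" "j \<in> {1..n}" "i \<noteq> j" "v \<in> U" for i j v
      by (rule rel2[where v = v, OF hc_rel.XC_far[OF that(1) that(2) that(3), of q]]) (use that in \<open>simp_all add: simps\<close>)
  qed
qed

text \<open>Let W be the eigenspace for c and W' an invariant complement. If w' is the component of
  v in W', then (f - c) w' lies in W' and, by hypothesis, in W, so it is zero; hence w' itself lies
  in W and vanishes.\<close>

lemma ss:
  assumes "semisimple_on U f" "lin_on U f" "v \<in> U" "f (f v - scl c v) - scl c (f v - scl c v) = 0"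
  shows "f v = scl c v"
proof -
  have subU: "vsp.subspace U" by (rule subspace_total[OF sub])
  have U: "v + w \<in> U" "scl c v \<in> U" "v - w \<in> U" if "v \<in> U" "w \<in> U" for v w c
    using that by (simp_all add: vsp.subspace_add[OF subU] vsp.subspace_scale[OF subU] vsp.subspace_diff[OF subU])
  have f: "f v \<in> U" "f (scl c v) = scl c (f v)" "f (v + w) = f v + f w" if "v \<in> U" "w \<in> U" for v w c
    using assms(2) that by (auto simp: lin_on_def)
  define W where "W = {w \<in> U. f w = scl c w}"
  have f0: "f 0 = 0" using f(2)[of 0 0 0] vsp.subspace_0[OF subU] by simp
  have "vsp.subspace W"
    unfolding vsp.subspace_def W_def using vsp.subspace_0[OF subU] f0
    by (auto simp: U f vsp.scale_right_distrib mult.commute)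
  moreover have "W \<subseteq> U" "f ` W \<subseteq> W" using f U by (auto simp: W_def)
  ultimately obtain W' where W': "vsp.subspace W'" "W' \<subseteq> U" "f ` W' \<subseteq> W'" "W \<inter> W' = {0}" "ssum W W' = U"
    using assms(1) unfolding semisimple_on_def by meson
  then obtain w w' where w: "v = w + w'" "w \<in> W" "w' \<in> W'" using assms(3) unfolding ssum_def by blast
  have wU: "w \<in> U" "w' \<in> U" and fw: "f w = scl c w" using w W' by (auto simp: W_def)
  define u where "u = f w' - scl c w'"
  have u': "u \<in> W'" unfolding u_def
    using w(3) W'(1,3) vsp.subspace_diff vsp.subspace_scale by blast
  have "f v - scl c v = u" unfolding u_def w(1) using f(3)[OF wU] fw by (simp add: vsp.scale_right_distrib)
  then have "f u = scl c u" using assms(4) by simp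
  then have "u \<in> W" using u' W'(2) by (auto simp: W_def)
  then have "u = 0" using u' W'(4) by blast
  then have "w' \<in> W" using wU by (simp add: W_def u_def)
  then have "w' = 0" using w(3) W'(4) by blast
  then show ?thesis using w(1) fw by simp
qed

end

section \<open>Yang-Baxter equations for the Clifford parts\<close>

text \<open>The first identity is a partial fraction decomposition. The other three are the first
  with y, z and x inverted in turn, rewritten by \<open>aa_bb_inverse\<close>.\<close>

lemma aa_bb_product:
  fixes x y z :: "'a::field"
  assumes "x \<noteq> y" "y \<noteq> z" "x \<noteq> z" "x * y \<noteq> 1" "y * z \<noteq> 1" "x * z \<noteq> 1"
  shows "aa x y * aa y z - aa x z * (aa x y + aa y z - 1) = 0"
    "aa x z * bb y z - bb y z - bb x y * aa x z - bb x y * bb y z = 0"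
    "aa x y * bb y z - bb y z - bb x z * aa x y - bb x z * bb y z = 0"
    "aa y z * bb x z - bb x z - bb x y * aa y z - bb x y * bb x z = 0"
proof -
  have nz: "y - x \<noteq> 0" "z - y \<noteq> 0" "z - x \<noteq> 0" "1 - x * y \<noteq> 0" "1 - y * z \<noteq> 0" "1 - x * z \<noteq> 0"
    using assms by auto
  have a: "aa x y * (y - x) = y" "aa y z * (z - y) = z" "aa x z * (z - x) = z"
    "bb x y * (1 - x * y) = x * y" "bb y z * (1 - y * z) = y * z" "bb x z * (1 - x * z) = x * z"
    using nz by (simp_all add: aa_def bb_def)
  show "aa x y * aa y z - aa x z * (aa x y + aa y z - 1) = 0"
    using nz by (simp add: aa_def divide_simps) (simp add: algebra_simps)
  show "aa x z * bb y z - bb y z - bb x y * aa x z - bb x y * bb y z = 0"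
    using nz by (simp add: aa_def bb_def divide_simps) (simp add: algebra_simps)
  show "aa x y * bb y z - bb y z - bb x z * aa x y - bb x z * bb y z = 0"
    using nz by (simp add: aa_def bb_def divide_simps) (simp add: algebra_simps)
  show "aa y z * bb x z - bb x z - bb x y * aa y z - bb x y * bb x z = 0"
    using nz by (simp add: aa_def bb_def divide_simps) (simp add: algebra_simps)
qed

context clifford
begin

text \<open>The associative Yang--Baxter equation for \<^const>\<open>Aop\<close>, in its two mirror images, and the
  quantum Yang--Baxter equation.\<close>

lemma yang_baxter:
  fixes P :: "(nat \<Rightarrow> 'a) \<Rightarrow> 'a vec \<Rightarrow> bool" and A :: "nat \<Rightarrow> nat \<Rightarrow> 'a vec \<Rightarrow> 'a vec"
  assumes pqr: "p \<in> J" "q \<in> J" "r \<in> J" "p \<noteq> q" "q \<noteq> r" "p \<noteq> r"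
    and lin: "\<And>s t. s \<in> J \<Longrightarrow> t \<in> J \<Longrightarrow> lin_on U (A s t)"
    and PU: "\<And>x v. P x v \<Longrightarrow> v \<in> U"
    and PC: "\<And>x v j. P x v \<Longrightarrow> j \<in> J \<Longrightarrow> P (x(j := inverse (x j))) (C j v)"
    and PA: "\<And>x v s t. P x v \<Longrightarrow> s \<in> J \<Longrightarrow> t \<in> J \<Longrightarrow> A s t v = Aop E s t x v"
    and v: "P x v" and x: "x p \<noteq> 0" "x q \<noteq> 0" "x r \<noteq> 0"
      "x p \<noteq> x q" "x q \<noteq> x r" "x p \<noteq> x r" "x p * x q \<noteq> 1" "x q * x r \<noteq> 1" "x p * x r \<noteq> 1"
  shows "A p r (A q p v) + A p q (A q r v) = A q r (A p r v)"
    and "A p q (A p r v) = A q r (A p q v) + A p r (A r q v)"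
    and "A q r (A p r (A p q v)) = A p q (A p r (A q r v))"
proof -
  define a b c d f g where "a = aa (x p) (x q)" and "b = aa (x q) (x r)" and "c = aa (x p) (x r)"
    and "d = bb (x p) (x q)" and "f = bb (x q) (x r)" and "g = bb (x p) (x r)"
  note prod = aa_bb_product[OF x(4,5,6,7,8,9), folded a_def b_def c_def d_def f_def g_def]
  \<comment> \<open>Left sides of the four product identities, all zero. In each equation below the
    difference of the two sides is exhibited as an explicit combination of them.\<close>
  define r1 r2 r3 r4 where "r1 = a * b - c * (a + b - 1)" and "r2 = c * f - f - d * c - d * f"
    and "r3 = a * f - f - g * a - g * f" and "r4 = b * g - g - d * b - d * g"
  have rs: "r1 = 0" "r2 = 0" "r3 = 0" "r4 = 0"
    using prod by (simp_all add: r1_def r2_def r3_def r4_def)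
  note ab = aa_bb_inverse[OF x(1,2,4,7)] aa_bb_inverse[OF x(2,3,5,8)] aa_bb_inverse[OF x(1,3,6,9)]
  note [simp] = pqr pqr(4-6)[symmetric]
  define y1 where "y1 = x(q := inverse (x q), p := inverse (x p))"
  define y2 where "y2 = x(r := inverse (x r), q := inverse (x q))"
  define y3 where "y3 = x(r := inverse (x r), p := inverse (x p))"
  have vU: "v \<in> U" using PU[OF v] .
  have comm: "C q (C p w) = - C p (C q w)" "C r (C p w) = - C p (C r w)" "C r (C q w) = - C q (C r w)"
    if "w \<in> U" for w
    by (rule C_anti; use that in simp)+
  have P1: "P y1 (C p (C q v))" using PC[OF PC[OF v pqr(2)] pqr(1)] by (simp add: y1_def)
  have P2: "P y2 (C q (C r v))" using PC[OF PC[OF v pqr(3)] pqr(2)] by (simp add: y2_def)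
  have P3: "P y3 (C p (C r v))" using PC[OF PC[OF v pqr(3)] pqr(1)] by (simp add: y3_def)
  have coeffs: "aa (x p) (x q) = a" "bb (x p) (x q) = d" "aa (x q) (x r) = b" "bb (x q) (x r) = f"
      "aa (x p) (x r) = c" "bb (x p) (x r) = g"
      "aa (x q) (x p) = 1 - a" "bb (x q) (x p) = d" "aa (x r) (x q) = 1 - b" "bb (x r) (x q) = f"
      "aa (y1 p) (y1 q) = 1 - a" "bb (y1 p) (y1 q) = - 1 - d" "aa (y1 q) (y1 r) = - f" "bb (y1 q) (y1 r) = - b"
      "aa (y1 p) (y1 r) = - g" "bb (y1 p) (y1 r) = - c"
      "aa (y2 p) (y2 q) = 1 + d" "bb (y2 p) (y2 q) = a - 1" "aa (y2 q) (y2 r) = 1 - b" "bb (y2 q) (y2 r) = - 1 - f"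
      "aa (y2 p) (y2 r) = 1 + g" "bb (y2 p) (y2 r) = c - 1"
      "aa (y3 p) (y3 q) = - d" "bb (y3 p) (y3 q) = - a" "aa (y3 q) (y3 r) = 1 + f" "bb (y3 q) (y3 r) = b - 1"
    unfolding a_def b_def c_def d_def f_def g_def by (simp_all add: y1_def y2_def y3_def ab)
  have 1: "A p q v = scl (E * a) v + scl (E * d) (C p (C q v))"
      "A q r v = scl (E * b) v + scl (E * f) (C q (C r v))"
      "A p r v = scl (E * c) v + scl (E * g) (C p (C r v))"
      "A q p v = scl (E * (1 - a)) v - scl (E * d) (C p (C q v))"
      "A r q v = scl (E * (1 - b)) v - scl (E * f) (C q (C r v))"
      "A p q (C p (C q v)) = scl (E * (1 - a)) (C p (C q v)) - scl (E * (- 1 - d)) v"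
      "A q r (C p (C q v)) = scl (E * - f) (C p (C q v)) - scl (E * - b) (C p (C r v))"
      "A p r (C p (C q v)) = scl (E * - g) (C p (C q v)) + scl (E * - c) (C q (C r v))"
      "A p q (C q (C r v)) = scl (E * (1 + d)) (C q (C r v)) + scl (E * (a - 1)) (C p (C r v))"
      "A q r (C q (C r v)) = scl (E * (1 - b)) (C q (C r v)) - scl (E * (- 1 - f)) v"
      "A p r (C q (C r v)) = scl (E * (1 + g)) (C q (C r v)) - scl (E * (c - 1)) (C p (C q v))"
      "A p q (C p (C r v)) = scl (E * - d) (C p (C r v)) - scl (E * - a) (C q (C r v))"
      "A q r (C p (C r v)) = scl (E * (1 + f)) (C p (C r v)) + scl (E * (b - 1)) (C p (C q v))"
    by (simp_all only: PA[OF v] PA[OF P1] PA[OF P2] PA[OF P3] pqr Aop_def coeffs)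
      (simp_all add: comm vU)
  note expand = vU 1 U_closed C_simps pqr lin_onD[OF lin] scl_simps lookup_simps
  have 0: "s = t" if "s - t = e" "e = 0" for s t e :: 'a using that by simp
  show "A p r (A q p v) + A p q (A q r v) = A q r (A p r v)"
  proof (rule vec_eqI, rule 0)
    fix m
    let ?l = "\<lambda>w :: 'a vec. Poly_Mapping.lookup w m"
    show "?l (A p r (A q p v) + A p q (A q r v)) - ?l (A q r (A p r v)) =
      E\<^sup>2 * (r1 * ?l v + r3 * ?l (C p (C r v)) - r4 * ?l (C p (C q v)) - r2 * ?l (C q (C r v)))"
      by (simp only: expand r1_def r2_def r3_def r4_def) (simp add: algebra_simps power2_eq_square)
  qed (simp add: rs)
  show "A p q (A p r v) = A q r (A p q v) + A p r (A r q v)"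
  proof (rule vec_eqI, rule 0)
    fix m
    let ?l = "\<lambda>w :: 'a vec. Poly_Mapping.lookup w m"
    show "?l (A p q (A p r v)) - ?l (A q r (A p q v) + A p r (A r q v)) =
      E\<^sup>2 * (- r1 * ?l v + r4 * ?l (C p (C r v)) - r2 * ?l (C p (C q v)) - r3 * ?l (C q (C r v)))"
      by (simp only: expand r1_def r2_def r3_def r4_def) (simp add: algebra_simps power2_eq_square)
  qed (simp add: rs)
  show "A q r (A p r (A p q v)) = A p q (A p r (A q r v))"
  proof (rule vec_eqI, rule 0)
    fix m
    let ?l = "\<lambda>w :: 'a vec. Poly_Mapping.lookup w m"
    show "?l (A q r (A p r (A p q v))) - ?l (A p q (A p r (A q r v))) =
      E ^ 3 * (r2 * ?l v - r3 * ?l (C p (C r v)) +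
        (a * r4 + (1 - a) * r2 + d * r1 - d * r3) * ?l (C p (C q v)) +
        (a * r2 - a * r4 - d * r1 + (1 + d) * r3) * ?l (C q (C r v)))"
      by (simp only: expand r1_def r2_def r3_def r4_def) (simp add: algebra_simps power3_eq_cube)
  qed (simp add: rs)
qed

end

section \<open>Linear extension from a finite set of labels\<close>

text \<open>Modules live in the space of finitely supported sequences, so \<open>enc\<close> assigns
  a coordinate to each basis label.\<close>

locale labelled =
  fixes B :: "'b set" and enc :: "'b \<Rightarrow> nat" and field_type :: "'a::field itself"
  assumes finB: "finite B" and inj: "inj_on enc B"
begin

definition e :: "'b \<Rightarrow> 'a vec" where "e b = Poly_Mapping.single (enc b) 1"

definition space :: "'a vec set" where "space = {v. Poly_Mapping.keys v \<subseteq> enc ` B}"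

text \<open>Coordinates that belong to no label are ignored, so \<open>ext f\<close> is linear on
  all vectors and not merely on \<open>space\<close>.\<close>

definition ext :: "('b \<Rightarrow> 'a vec) \<Rightarrow> 'a vec \<Rightarrow> 'a vec" where
  "ext f v = (\<Sum>b\<in>B. scl (Poly_Mapping.lookup v (enc b)) (f b))"

lemma lookup_e: "b \<in> B \<Longrightarrow> b' \<in> B \<Longrightarrow> Poly_Mapping.lookup (e b) (enc b') = (if b = b' then 1 else 0)"
  using inj by (auto simp: e_def lookup_single inj_on_def when_def)

lemma ext_e:
  assumes "b \<in> B"
  shows "ext f (e b) = f b"
proof -
  have "(\<Sum>x\<in>B - {b}. scl (Poly_Mapping.lookup (e b) (enc x)) (f x)) = 0"
    by (rule sum.neutral) (auto simp: lookup_e assms)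
  then show ?thesis
    unfolding ext_def by (subst sum.remove[OF finB assms]) (simp add: lookup_e assms)
qed

lemma ext_add: "ext f (v + w) = ext f v + ext f w"
  and ext_scl: "ext f (scl c v) = scl c (ext f v)"
  by (simp_all add: ext_def lookup_add vsp.scale_left_distrib sum.distrib vsp.scale_sum_right)

lemma subspace_space: "vsp.subspace space"
  unfolding vsp.subspace_def space_def
proof (intro conjI allI ballI)
  fix c :: 'a and v w :: "'a vec" assume v: "v \<in> {v. Poly_Mapping.keys v \<subseteq> enc ` B}"
  show "scl c v \<in> {v. Poly_Mapping.keys v \<subseteq> enc ` B}"
    using v by (auto simp: in_keys_iff)
  assume "w \<in> {v. Poly_Mapping.keys v \<subseteq> enc ` B}"
  then show "v + w \<in> {v. Poly_Mapping.keys v \<subseteq> enc ` B}"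
    using v Poly_Mapping.keys_add[of v w] by blast
qed simp

lemma e_space: "b \<in> B \<Longrightarrow> e b \<in> space"
  by (auto simp: space_def e_def)

lemma space_expand:
  fixes v :: "'a vec"
  assumes "v \<in> space"
  shows "v = (\<Sum>b\<in>B. scl (Poly_Mapping.lookup v (enc b)) (e b))"
proof (rule vec_eqI)
  fix m
  show "Poly_Mapping.lookup v m = Poly_Mapping.lookup (\<Sum>b\<in>B. scl (Poly_Mapping.lookup v (enc b)) (e b)) m"
  proof (cases "m \<in> enc ` B")
    case True
    then obtain b where b: "b \<in> B" "m = enc b" by blast
    show ?thesis
      unfolding lookup_sum b(2)
      by (subst sum.remove[OF finB b(1)]) (use b(1) in \<open>auto simp: lookup_e intro!: sum.neutral\<close>)
  next
    case False
    then have "Poly_Mapping.lookup v m = 0" using assms by (auto simp: space_def in_keys_iff)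
    moreover have "Poly_Mapping.lookup (e b :: 'a vec) m = 0" if "b \<in> B" for b
      using False that by (auto simp: e_def lookup_single when_def)
    ultimately show ?thesis unfolding lookup_sum by (simp add: sum.neutral)
  qed
qed

lemma ext_lin:
  assumes "\<And>b. b \<in> B \<Longrightarrow> f b \<in> space"
  shows "lin_on space (ext f)"
  unfolding lin_on_def
  by (auto simp: ext_add ext_scl) (auto simp: ext_def intro!: vsp.subspace_sum vsp.subspace_scale subspace_space assms)

lemma lin_sum:
  assumes "lin_on space f" "\<And>b. b \<in> B' \<Longrightarrow> b \<in> B" "finite B'"
  shows "f (\<Sum>b\<in>B'. scl (c b) (e b)) = (\<Sum>b\<in>B'. scl (c b) (f (e b)))"
  using assms(3,2)
proof (induction B')
  case empty
  have "f (scl 0 0) = scl 0 (f 0)" using assms(1) subspace_space vsp.subspace_0 unfolding lin_on_def by blast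
  then show ?case by simp
next
  case (insert b B')
  have s: "(\<Sum>b\<in>B'. scl (c b) (e b)) \<in> space"
    by (intro vsp.subspace_sum vsp.subspace_scale subspace_space e_space) (use insert in auto)
  have b: "e b \<in> space" "scl (c b) (e b) \<in> space"
    using insert e_space vsp.subspace_scale[OF subspace_space] by auto
  have f: "f (scl (c b) (e b) + w) = scl (c b) (f (e b)) + f w" if "w \<in> space" for w
    using b that assms(1) unfolding lin_on_def by metis
  show ?case using insert s by (simp add: f)
qed

lemma lin_eqI:
  assumes "lin_on space f" "lin_on space g" "\<And>b. b \<in> B \<Longrightarrow> f (e b) = g (e b)" "v \<in> space"
  shows "f v = g v"
  by (subst (1 2) space_expand[OF assms(4)])
    (simp add: lin_sum[OF assms(1) _ finB] lin_sum[OF assms(2) _ finB] assms(3))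

lemma lin_on_comp: "lin_on space f \<Longrightarrow> lin_on space g \<Longrightarrow> lin_on space (\<lambda>v. f (g v))"
  by (auto simp: lin_on_def)

lemma lin_on_add: "lin_on space f \<Longrightarrow> lin_on space g \<Longrightarrow> lin_on space (\<lambda>v. f v + g v)"
  by (auto simp: lin_on_def vsp.scale_right_distrib intro: vsp.subspace_add[OF subspace_space])

lemma lin_on_scl: "lin_on space f \<Longrightarrow> lin_on space (\<lambda>v. scl c (f v))"
  by (auto simp: lin_on_def vsp.scale_right_distrib mult.commute intro: vsp.subspace_scale[OF subspace_space])

lemma lin_on_diff: "lin_on space f \<Longrightarrow> lin_on space g \<Longrightarrow> lin_on space (\<lambda>v. f v - g v)"
  by (auto simp: lin_on_def vsp.scale_right_diff_distrib intro: vsp.subspace_diff[OF subspace_space])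

lemma lin_on_id: "lin_on space (\<lambda>v. v)"
  by (auto simp: lin_on_def)

end

section \<open>The model\<close>

definition sdiff :: "nat set \<Rightarrow> nat \<Rightarrow> nat set" where
  "sdiff S k = (if k \<in> S then S - {k} else insert k S)"

definition csgn :: "nat \<Rightarrow> nat set \<Rightarrow> 'a::field" where
  "csgn k S = (- 1) ^ card {l \<in> S. l < k}"

text \<open>The swap reverses the product C_k C_(k+1) when both factors occur; restoring the
  increasing order costs this sign.\<close>

definition psgn :: "nat \<Rightarrow> nat set \<Rightarrow> 'a::field" where
  "psgn k S = (if k \<in> S \<and> Suc k \<in> S then - 1 else 1)"

lemma sdiff_simps [simp]: "sdiff (sdiff S k) k = S" "x \<in> sdiff S k \<longleftrightarrow> (x \<in> S) \<noteq> (x = k)"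
  by (auto simp: sdiff_def)

lemma sdiff_subset: "S \<subseteq> A \<Longrightarrow> k \<in> A \<Longrightarrow> sdiff S k \<subseteq> A"
  by (auto simp: sdiff_def)

lemma sdiff_comm: "sdiff (sdiff S k) l = sdiff (sdiff S l) k"
  by auto

lemma inj_adj_swap: "inj (adj_swap k)"
  by (rule inj_on_inverseI[of _ "adj_swap k"]) simp

lemma adj_swap_image_iff [simp]: "x \<in> adj_swap k ` S \<longleftrightarrow> adj_swap k x \<in> S"
  by (metis adj_swap_invol image_iff)

lemma adj_swap_eq_iff: "adj_swap k x = y \<longleftrightarrow> x = adj_swap k y"
  by (auto simp: adj_swap_def)

lemma adj_swap_sdiff: "adj_swap k ` sdiff S l = sdiff (adj_swap k ` S) (adj_swap k l)"
  by (rule Set.set_eqI) (simp add: adj_swap_eq_iff)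

lemma csgn_same: "csgn k (sdiff S k) = (csgn k S :: 'a::field)"
proof -
  have "{l \<in> sdiff S k. l < k} = {l \<in> S. l < k}" by auto
  then show ?thesis by (simp add: csgn_def)
qed

lemma csgn_above: "j < i \<Longrightarrow> csgn j (sdiff S i) = (csgn j S :: 'a::field)"
proof -
  assume "j < i"
  then have "{l \<in> sdiff S i. l < j} = {l \<in> S. l < j}" by auto
  then show ?thesis by (simp add: csgn_def)
qed

lemma csgn_below:
  assumes "i < j"
  shows "csgn j (sdiff S i) = - (csgn j S :: 'a::field)"
proof (cases "i \<in> S")
  case True
  have "{l \<in> S. l < j} = insert i {l \<in> sdiff S i. l < j}" using True assms by auto
  moreover have "finite {l \<in> sdiff S i. l < j}" "i \<notin> {l \<in> sdiff S i. l < j}" using True by auto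
  ultimately show ?thesis by (simp add: csgn_def)
next
  case False
  have "{l \<in> sdiff S i. l < j} = insert i {l \<in> S. l < j}" using False assms by auto
  moreover have "finite {l \<in> S. l < j}" "i \<notin> {l \<in> S. l < j}" using False by auto
  ultimately show ?thesis by (simp add: csgn_def)
qed

lemma csgn_Suc: "csgn (Suc k) S = (if k \<in> S then - csgn k S else (csgn k S :: 'a::field))"
proof (cases "k \<in> S")
  case True
  have "{l \<in> S. l < Suc k} = insert k {l \<in> S. l < k}" using True by auto
  then show ?thesis using True by (simp add: csgn_def)
next
  case False
  then have "{l \<in> S. l < Suc k} = {l \<in> S. l < k}" by (auto simp: less_Suc_eq)
  then show ?thesis using False by (simp add: csgn_def)
qed

lemma csgn_swap:
  assumes "l \<noteq> Suc k"
  shows "csgn l (adj_swap k ` S) = (csgn l S :: 'a::field)"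
proof -
  have "adj_swap k x < l \<longleftrightarrow> x < l" for x using assms by (auto simp: adj_swap_def)
  then have "{x \<in> adj_swap k ` S. x < l} = adj_swap k ` {x \<in> S. x < l}"
    by (intro Set.set_eqI) simp
  then show ?thesis
    using card_image[OF inj_on_subset[OF inj_adj_swap]] by (simp add: csgn_def)
qed

lemma csgn_sq [simp]: "csgn k S * csgn k S = (1 :: 'a::field)"
  by (simp add: csgn_def flip: power_mult_distrib)

lemma adj_swap_braid:
  "adj_swap k (adj_swap (Suc k) (adj_swap k x)) = adj_swap (Suc k) (adj_swap k (adj_swap (Suc k) x))"
  by (auto simp: adj_swap_def)

lemma adj_swap_comm: "Suc k < l \<or> Suc l < k \<Longrightarrow> adj_swap k (adj_swap l x) = adj_swap l (adj_swap k x)"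
  by (auto simp: adj_swap_def)

text \<open>The labels \<open>(j, S)\<close> of the basis stand for \<open>C\<^sub>S e\<^sub>j\<close>, with the factors of \<open>C\<^sub>S\<close> in increasing order
  and \<open>e\<^sub>j\<close> of weight \<open>j\<close>; this gives the signs \<open>csgn\<close> and \<open>psgn\<close>.  The operator \<open>D\<close> is the
  intertwiner, normalised so that it is symmetric in the two weights it connects.\<close>

locale model = quantum q h for q :: "'a::alg_closed_field" and h :: enat +
  fixes n :: nat and i0 :: "nat \<Rightarrow> nat"
  assumes idx0: "i0 \<in> {1..n} \<rightarrow>\<^sub>E index_set h" and ws0: "well_separated h n i0"
begin

abbreviation "E \<equiv> eps q"

inductive_set Orb :: "(nat \<Rightarrow> nat) set" where
  start: "i0 \<in> Orb"
| swap: "j \<in> Orb \<Longrightarrow> 1 \<le> k \<Longrightarrow> k < n \<Longrightarrow> \<not> close (j k) (j (k + 1)) \<Longrightarrow> j \<circ> adj_swap k \<in> Orb"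

lemma Orb_props:
  "j \<in> Orb \<Longrightarrow> j \<in> {1..n} \<rightarrow>\<^sub>E i0 ` {1..n} \<and> well_separated h n j"
proof (induction rule: Orb.induct)
  case start
  then show ?case using idx0 ws0 by (auto simp: PiE_iff)
next
  case (swap j k)
  have "adj_swap k x \<in> {1..n} \<longleftrightarrow> x \<in> {1..n}" for x using swap(2,3) by (auto simp: adj_swap_def)
  then have "j \<circ> adj_swap k \<in> {1..n} \<rightarrow>\<^sub>E i0 ` {1..n}"
    using swap.IH by (auto simp: PiE_iff extensional_def)
  then show ?case using swap well_separated_swap by blast
qed

lemma Orb_finite: "finite Orb"
  by (rule finite_subset[of _ "{1..n} \<rightarrow>\<^sub>E i0 ` {1..n}"]) (use Orb_props in \<open>auto intro: finite_PiE\<close>)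

lemma Orb_idx: "j \<in> Orb \<Longrightarrow> j \<in> {1..n} \<rightarrow>\<^sub>E index_set h"
proof -
  assume "j \<in> Orb"
  then have j: "j \<in> {1..n} \<rightarrow>\<^sub>E i0 ` {1..n}" using Orb_props by blast
  have "i0 ` {1..n} \<subseteq> index_set h" using idx0 by (auto simp: PiE_iff)
  then show ?thesis using j by (auto simp: PiE_iff)
qed

definition B :: "((nat \<Rightarrow> nat) \<times> nat set) set" where "B = Orb \<times> Pow {1..n}"

definition enc :: "(nat \<Rightarrow> nat) \<times> nat set \<Rightarrow> nat" where "enc = (SOME f. inj_on f B)"

lemma B_finite: "finite B" by (simp add: B_def Orb_finite)

lemma enc_inj: "inj_on enc B"
proof -
  obtain f :: "_ \<Rightarrow> nat" where "inj_on f B" using finite_imp_inj_to_nat_seg[OF B_finite] by blast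
  then show ?thesis unfolding enc_def by (rule someI[of "\<lambda>f. inj_on f B"])
qed

sublocale labelled B enc "TYPE('a)" by standard (rule B_finite enc_inj)+

definition rt :: "nat \<Rightarrow> 'a" where "rt a = (SOME x. x \<noteq> 0 \<and> x + inverse x = qval q a)"

lemma rt: "rt a \<noteq> 0" "rt a + inverse (rt a) = qval q a"
  using someI_ex[OF qval_root[of a]] by (simp_all add: rt_def)

fun xv :: "(nat \<Rightarrow> nat) \<times> nat set \<Rightarrow> nat \<Rightarrow> 'a" where
  "xv (j, S) k = (if k \<in> S then inverse (rt (j k)) else rt (j k))"

lemma xv: "xv (j, S) k \<noteq> 0" "xv (j, S) k + inverse (xv (j, S) k) = qval q (j k)"
  using rt[of "j k"] by (auto simp: add.commute)

lemma xv_sdiff: "xv (j, sdiff S k) = (xv (j, S))(k := inverse (xv (j, S) k))"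
  by (rule ext) auto

lemma xv_swap: "xv (j \<circ> adj_swap k, adj_swap k ` S) = xv (j, S) \<circ> adj_swap k"
  by (rule ext) auto

definition X :: "nat \<Rightarrow> 'a vec \<Rightarrow> 'a vec" where "X k = ext (\<lambda>b. scl (xv b k) (e b))"
definition Y :: "nat \<Rightarrow> 'a vec \<Rightarrow> 'a vec" where "Y k = ext (\<lambda>b. scl (inverse (xv b k)) (e b))"
definition C :: "nat \<Rightarrow> 'a vec \<Rightarrow> 'a vec" where
  "C k = ext (\<lambda>(j, S). scl (csgn k S) (e (j, sdiff S k)))"

text \<open>The choice depends only on the value of \<open>gg\<close>, so the symmetry of
  \<open>gg\<close> makes \<open>cc\<close> symmetric (\<open>cc_comm\<close>).\<close>

definition cc :: "nat \<Rightarrow> nat \<Rightarrow> 'a" where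
  "cc a b = (SOME c. c * c = gg E (rt a) (rt b))"

definition D :: "nat \<Rightarrow> 'a vec \<Rightarrow> 'a vec" where
  "D k = ext (\<lambda>(j, S). scl (cc (j k) (j (Suc k)) * psgn k S) (e (j \<circ> adj_swap k, adj_swap k ` S)))"

lemma rt_distinct:
  assumes "a \<in> index_set h" "b \<in> index_set h" "a \<noteq> b"
    and "x \<noteq> 0" "x + inverse x = qval q a" "y \<noteq> 0" "y + inverse y = qval q b"
  shows "x \<noteq> y" "x * y \<noteq> 1"
  using sum_inverse_eq_iff[OF assms(4,6)] qval_inj[OF assms(1,2)] assms(3,5,7) by auto

text \<open>Inverting x or y does not change the scalar, so one factor \<open>cc\<close> serves all
  labels over the same weight.\<close>

lemma gg_rt:
  assumes "a \<in> index_set h" "b \<in> index_set h" "a \<noteq> b"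
    and "x \<noteq> 0" "x + inverse x = qval q a" "y \<noteq> 0" "y + inverse y = qval q b"
  shows "gg E x y = gg E (rt a) (rt b)"
  unfolding gg_eq[OF assms(4,6) rt_distinct[OF assms]]
    gg_eq[OF rt(1) rt(1) rt_distinct[OF assms(1-3) rt rt]] assms(5,7) rt(2) ..

lemma cc_sq: "cc a b * cc a b = gg E (rt a) (rt b)"
proof -
  have "\<exists>c. c * c = z" for z :: 'a
  proof -
    have "degree [:- z, 0, 1:] > 0" by simp
    then obtain c where "poly [:- z, 0, 1:] c = 0" using alg_closed_imp_poly_has_root by blast
    then show ?thesis by (intro exI[of _ c]) (simp add: algebra_simps)
  qed
  then show ?thesis unfolding cc_def by (rule someI_ex)
qed

lemma cc_comm:
  assumes "a \<in> index_set h" "b \<in> index_set h"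
  shows "cc a b = cc b a"
proof (cases "a = b")
  case False
  note ab = rt_distinct[OF assms False rt rt]
  have "gg E (rt b) (rt a) = gg E (rt a) (rt b)"
    unfolding gg_def aa_bb_inverse(1,8)[OF rt(1) rt(1) ab] by (simp add: algebra_simps)
  then show ?thesis by (simp add: cc_def)
qed simp

lemma cc_close:
  assumes "a \<in> index_set h" "b \<in> index_set h" "a \<noteq> b" "close a b"
  shows "cc a b = 0"
proof -
  note ab = rt_distinct[OF assms(1-3) rt rt]
  have adj: "b = a + 1 \<or> a = b + 1" using assms(3,4) by (auto simp: close_def)
  have "gg E (rt a) (rt b) = 0"
  proof -
    have "(qval q a - qval q b)\<^sup>2 = E\<^sup>2 * (qval q a * qval q b - 4)"
      using link_iff[OF assms(1-3)] adj by blast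
    moreover have "qval q a - qval q b \<noteq> 0" using qval_inj[OF assms(1,2)] assms(3) by auto
    ultimately show ?thesis unfolding gg_eq[OF rt(1) rt(1) ab] rt(2) by (metis diff_self divide_self power_not_zero)
  qed
  then show ?thesis using cc_sq[of a b] by simp
qed

lemma B_iff: "(j, S) \<in> B \<longleftrightarrow> j \<in> Orb \<and> S \<subseteq> {1..n}" by (auto simp: B_def)

lemma Orb_distinct: "j \<in> Orb \<Longrightarrow> 1 \<le> k \<Longrightarrow> k < n \<Longrightarrow> j k \<noteq> j (Suc k)"
  using well_separated_distinct[of n j k] Orb_props by auto

text \<open>This makes D_k an operator on \<open>space\<close>: a swap that would leave the orbit
  carries the coefficient 0, because neighbours in an orbit weight are distinct and
  \<open>cc\<close> vanishes on distinct close values.\<close>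

lemma D_label:
  assumes "(j, S) \<in> B" "k \<in> {1..<n}"
  shows "cc (j k) (j (Suc k)) = 0 \<or> (j \<circ> adj_swap k, adj_swap k ` S) \<in> B"
proof (cases "close (j k) (j (Suc k))")
  case True
  have "j \<in> Orb" using assms by (simp add: B_iff)
  then show ?thesis
    using True cc_close[of "j k" "j (Suc k)"] Orb_idx[of j] Orb_distinct[of j k] assms(2) by (auto simp: PiE_iff)
next
  case False
  have "adj_swap k ` S \<subseteq> {1..n}"
  proof
    fix x assume "x \<in> adj_swap k ` S"
    then have "adj_swap k x \<in> {1..n}" using assms by (auto simp: B_iff)
    then show "x \<in> {1..n}" using assms(2) by (auto simp: adj_swap_def split: if_splits)
  qed
  then show ?thesis using Orb.swap[of j k] False assms by (simp add: B_iff)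
qed

lemma C_e: "(j, S) \<in> B \<Longrightarrow> C k (e (j, S)) = scl (csgn k S) (e (j, sdiff S k))"
  by (simp add: C_def ext_e)

lemma D_e: "(j, S) \<in> B \<Longrightarrow>
    D k (e (j, S)) = scl (cc (j k) (j (Suc k)) * psgn k S) (e (j \<circ> adj_swap k, adj_swap k ` S))"
  by (simp add: D_def ext_e)

lemma sdiff_B: "(j, S) \<in> B \<Longrightarrow> k \<in> {1..n} \<Longrightarrow> (j, sdiff S k) \<in> B"
  using sdiff_subset by (simp add: B_iff)

lemma space_scl: "v \<in> space \<Longrightarrow> scl c v \<in> space"
  by (rule vsp.subspace_scale[OF subspace_space])

lemma X_lin: "lin_on space (X k)" and Y_lin: "lin_on space (Y k)"
  unfolding X_def Y_def by (intro ext_lin space_scl e_space; assumption)+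

lemma C_lin: "k \<in> {1..n} \<Longrightarrow> lin_on space (C k)"
  unfolding C_def by (rule ext_lin) (auto intro!: space_scl e_space sdiff_B)

lemma D_lin: "k \<in> {1..<n} \<Longrightarrow> lin_on space (D k)"
  unfolding D_def
proof (rule ext_lin, clarify)
  fix j S assume "k \<in> {1..<n}" "(j, S) \<in> B"
  then show "scl (cc (j k) (j (Suc k)) * psgn k S) (e (j \<circ> adj_swap k, adj_swap k ` S)) \<in> space"
    using D_label[of j S k] vsp.subspace_0[OF subspace_space]
    by (cases "cc (j k) (j (Suc k)) = 0") (simp_all add: space_scl e_space)
qed

lemma CC_e: "(j, S) \<in> B \<Longrightarrow> l \<in> {1..n} \<Longrightarrow>
    C k (C l (e (j, S))) = scl (csgn l S * csgn k (sdiff S l)) (e (j, sdiff (sdiff S l) k))"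
  by (simp add: C_e C_def ext_scl ext_e sdiff_B)

sublocale clifford space "{1..n}" C
proof
  show "vsp.subspace space" by (rule subspace_space)
  show "lin_on space (C j)" if "j \<in> {1..n}" for j by (rule C_lin[OF that])
  show "C j (C j v) = v" if "j \<in> {1..n}" "v \<in> space" for j v
  proof (rule lin_eqI[OF lin_on_comp[OF C_lin C_lin] lin_on_id])
    fix b assume "b \<in> B"
    then obtain j' S where b: "b = (j', S)" "(j', S) \<in> B" by (cases b) auto
    show "C j (C j (e b)) = e b" unfolding b(1) using b(2) that by (simp add: CC_e csgn_same)
  qed (use that in simp_all)
  show "C i (C j v) = - C j (C i v)" if ij: "i \<in> {1..n}" "j \<in> {1..n}" "i \<noteq> j" and v: "v \<in> space" for i j v
  proof -
    have sgn: "csgn j S * csgn i (sdiff S j) = - (csgn i S * csgn j (sdiff S i) :: 'a)" for S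
      using ij(3) by (cases "i < j") (simp_all add: csgn_above csgn_below)
    have "C i (C j v) = scl (- 1) (C j (C i v))"
    proof (rule lin_eqI[OF lin_on_comp[OF C_lin C_lin] lin_on_scl[OF lin_on_comp[OF C_lin C_lin]]])
      fix b assume "b \<in> B"
      then obtain j' S where b: "b = (j', S)" "(j', S) \<in> B" by (cases b) auto
      show "C i (C j (e b)) = scl (- 1) (C j (C i (e b)))"
        unfolding b(1) using b(2) ij by (simp add: CC_e sgn sdiff_comm[of S i j])
    qed (use ij v in simp_all)
    then show ?thesis by simp
  qed
qed

definition Aw :: "nat \<Rightarrow> nat \<Rightarrow> 'a vec \<Rightarrow> 'a vec" where
  "Aw p r = ext (\<lambda>b. Aop E p r (xv b) (e b))"

definition T :: "nat \<Rightarrow> 'a vec \<Rightarrow> 'a vec" where "T k v = Aw k (Suc k) v + D k v"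

text \<open>The zero vector counts for every weight because D_k may vanish, and then the swapped
  weight can lie outside the orbit.\<close>

definition P :: "(nat \<Rightarrow> nat) \<Rightarrow> (nat \<Rightarrow> 'a) \<Rightarrow> 'a vec \<Rightarrow> bool" where
  "P j x v \<longleftrightarrow> v = 0 \<or> (\<exists>S c. (j, S) \<in> B \<and> v = scl c (e (j, S)) \<and> x = xv (j, S))"

lemma P_e: "(j, S) \<in> B \<Longrightarrow> P j (xv (j, S)) (e (j, S))"
  unfolding P_def by (intro disjI2 exI[of _ S] exI[of _ 1]) simp

lemma P_cases:
  assumes "P j x v"
  obtains "v = 0" | S c where "(j, S) \<in> B" "v = scl c (e (j, S))" "x = xv (j, S)"
  using assms unfolding P_def by blast

lemma P_space: "P j x v \<Longrightarrow> v \<in> space"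
  by (erule P_cases) (simp_all add: e_space)

lemma Aop_space: "p \<in> {1..n} \<Longrightarrow> r \<in> {1..n} \<Longrightarrow> v \<in> space \<Longrightarrow> Aop E p r x v \<in> space"
  by (simp add: Aop_def)

lemma Aw_lin: "p \<in> {1..n} \<Longrightarrow> r \<in> {1..n} \<Longrightarrow> lin_on space (Aw p r)"
  unfolding Aw_def by (intro ext_lin Aop_space e_space)

lemma T_lin:
  assumes "k \<in> {1..<n}"
  shows "lin_on space (T k)"
proof -
  have "k \<in> {1..n}" "Suc k \<in> {1..n}" using assms by auto
  then show ?thesis unfolding T_def by (intro lin_on_add Aw_lin D_lin[OF assms])
qed

lemmas D_simps = lin_onD[OF D_lin] and Aw_simps = lin_onD[OF Aw_lin] and T_simps = lin_onD[OF T_lin]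

lemma P_C:
  assumes "P j x v" "k \<in> {1..n}"
  shows "P j (x(k := inverse (x k))) (C k v)"
  using assms(1)
proof (cases rule: P_cases)
  case 1
  then show ?thesis using lin_onD(6)[OF C_lin[OF assms(2)]] by (simp add: P_def)
next
  case (2 S c)
  have "C k v = scl (c * csgn k S) (e (j, sdiff S k))"
    unfolding 2 using 2(1) assms(2) by (simp add: C_e e_space)
  then show ?thesis
    using sdiff_B[OF 2(1) assms(2)] unfolding P_def 2(3) xv_sdiff[symmetric] by blast
qed

lemma P_D:
  assumes "P j x v" "k \<in> {1..<n}"
  shows "P (j \<circ> adj_swap k) (x \<circ> adj_swap k) (D k v)"
  using assms(1)
proof (cases rule: P_cases)
  case 1
  then show ?thesis using lin_onD(6)[OF D_lin[OF assms(2)]] by (simp add: P_def)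
next
  case (2 S c)
  have D: "D k v = scl (c * (cc (j k) (j (Suc k)) * psgn k S)) (e (j \<circ> adj_swap k, adj_swap k ` S))"
    unfolding 2 using 2(1) assms(2) by (simp add: D_e e_space D_simps)
  from D_label[OF 2(1) assms(2)] show ?thesis
  proof
    assume "cc (j k) (j (Suc k)) = 0"
    then show ?thesis unfolding D by (simp add: P_def)
  next
    assume "(j \<circ> adj_swap k, adj_swap k ` S) \<in> B"
    then show ?thesis unfolding P_def D 2(3) xv_swap[symmetric] by blast
  qed
qed

lemma XY_P:
  assumes "P j x v"
  shows "X k v = scl (x k) v" "Y k v = scl (inverse (x k)) v"
proof -
  have "X k v = scl (x k) v \<and> Y k v = scl (inverse (x k)) v"
    using assms
  proof (cases rule: P_cases)
    case 1
    then show ?thesis using lin_onD(6)[OF X_lin] lin_onD(6)[OF Y_lin] by simp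
  next
    case (2 S c)
    then show ?thesis by (simp add: X_def Y_def ext_scl ext_e mult.commute del: xv.simps)
  qed
  then show "X k v = scl (x k) v" "Y k v = scl (inverse (x k)) v" by auto
qed

lemma Aw_P:
  assumes "P j x v" "p \<in> {1..n}" "r \<in> {1..n}"
  shows "Aw p r v = Aop E p r x v"
  using assms(1)
proof (cases rule: P_cases)
  case 1
  then show ?thesis using assms(2,3) by (simp add: Aw_simps Aop_def lin_onD(6)[OF C_lin])
next
  case (2 S c)
  then show ?thesis
    using assms(2,3) by (simp add: Aw_def ext_scl ext_e Aop_def e_space scl_simps mult.commute del: xv.simps)
qed

lemma basis_eqI:
  assumes "lin_on space f" "lin_on space g"
    and "\<And>j S. (j, S) \<in> B \<Longrightarrow> P j (xv (j, S)) (e (j, S)) \<Longrightarrow> f (e (j, S)) = g (e (j, S))" "v \<in> space"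
  shows "f v = g v"
proof (rule lin_eqI[OF assms(1,2) _ assms(4)])
  fix b assume "b \<in> B"
  then show "f (e b) = g (e b)" using assms(3) P_e by (cases b) auto
qed

lemma DC_sign:
  assumes "k \<in> {1..<n}" "l \<in> {1..n}"
  shows "csgn l S * psgn k (sdiff S l) = (psgn k S * csgn (adj_swap k l) (adj_swap k ` S) :: 'a)"
proof -
  consider "l = k" | "l = Suc k" | "l \<noteq> k" "l \<noteq> Suc k" by blast
  then show ?thesis
  proof cases
    case 1
    then show ?thesis by (simp add: csgn_Suc csgn_swap psgn_def)
  next
    case 2
    then show ?thesis by (simp add: csgn_Suc csgn_swap psgn_def)
  next
    case 3
    then show ?thesis by (simp add: csgn_swap psgn_def)
  qed
qed

lemma DC:
  assumes k: "k \<in> {1..<n}" and l: "l \<in> {1..n}" and v: "v \<in> space"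
  shows "D k (C l v) = C (adj_swap k l) (D k v)"
proof -
  have l': "adj_swap k l \<in> {1..n}" using k l by (auto simp: adj_swap_def)
  show ?thesis
  proof (rule basis_eqI[OF lin_on_comp[OF D_lin[OF k] C_lin[OF l]] lin_on_comp[OF C_lin[OF l'] D_lin[OF k]] _ v])
    fix j S assume jS: "(j, S) \<in> B"
    let ?c = "cc (j k) (j (Suc k))"
    have L: "D k (C l (e (j, S))) =
        scl (csgn l S * (?c * psgn k (sdiff S l))) (e (j \<circ> adj_swap k, adj_swap k ` sdiff S l))"
      using jS k l by (simp add: C_e D_simps e_space sdiff_B D_e)
    have R: "C (adj_swap k l) (D k (e (j, S))) =
        scl (?c * psgn k S * csgn (adj_swap k l) (adj_swap k ` S))
          (e (j \<circ> adj_swap k, sdiff (adj_swap k ` S) (adj_swap k l)))"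
    proof (cases "?c = 0")
      case True
      then show ?thesis using jS lin_onD(6)[OF C_lin[OF l']] by (simp add: D_e)
    next
      case False
      then have "(j \<circ> adj_swap k, adj_swap k ` S) \<in> B" using D_label[OF jS k] by simp
      then show ?thesis using jS l' by (simp add: D_e C_e e_space)
    qed
    have "csgn l S * (?c * psgn k (sdiff S l)) = ?c * psgn k S * csgn (adj_swap k l) (adj_swap k ` S)"
      using DC_sign[OF k l, of S] by (metis mult.assoc mult.left_commute)
    then show "D k (C l (e (j, S))) = C (adj_swap k l) (D k (e (j, S)))"
      unfolding L R adj_swap_sdiff by simp
  qed
qed

lemma DD_e:
  assumes jS: "(j, S) \<in> B" and k: "k \<in> {1..<n}" and l: "l \<in> {1..<n}"
  shows "D k (D l (e (j, S))) =
    scl (cc (j l) (j (Suc l)) * psgn l S * (cc (j (adj_swap l k)) (j (adj_swap l (Suc k))) * psgn k (adj_swap l ` S)))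
      (e (j \<circ> adj_swap l \<circ> adj_swap k, adj_swap k ` adj_swap l ` S))"
proof (cases "cc (j l) (j (Suc l)) = 0")
  case True
  then show ?thesis using jS lin_onD(6)[OF D_lin[OF k]] by (simp add: D_e)
next
  case False
  then have "(j \<circ> adj_swap l, adj_swap l ` S) \<in> B" using D_label[OF jS l] by simp
  then show ?thesis using jS k by (simp add: D_e e_space D_simps)
qed

lemma DDD_e:
  assumes jS: "(j, S) \<in> B" and k: "k \<in> {1..<n}" and l: "l \<in> {1..<n}" and m: "m \<in> {1..<n}"
  shows "D m (D k (D l (e (j, S)))) =
    scl (cc (j l) (j (Suc l)) * psgn l S * (cc (j (adj_swap l k)) (j (adj_swap l (Suc k))) * psgn k (adj_swap l ` S)) *
      (cc (j (adj_swap l (adj_swap k m))) (j (adj_swap l (adj_swap k (Suc m)))) * psgn m (adj_swap k ` adj_swap l ` S)))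
      (e (j \<circ> adj_swap l \<circ> adj_swap k \<circ> adj_swap m, adj_swap m ` adj_swap k ` adj_swap l ` S))"
proof (cases "cc (j l) (j (Suc l)) = 0")
  case True
  then show ?thesis using jS lin_onD(6)[OF D_lin[OF k]] lin_onD(6)[OF D_lin[OF m]] by (simp add: D_e)
next
  case False
  then have inB: "(j \<circ> adj_swap l, adj_swap l ` S) \<in> B" using D_label[OF jS l] by simp
  have eU: "(e (j \<circ> adj_swap l, adj_swap l ` S) :: 'a vec) \<in> space" by (rule e_space[OF inB])
  from DD_e[OF inB m k] show ?thesis
    using jS k m eU by (simp add: D_e D_simps scl_simps mult.assoc)
qed

lemma DD_P:
  assumes Pv: "P j x v" and k: "k \<in> {1..<n}"
  shows "D k (D k v) = scl (gg E (x k) (x (Suc k))) v"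
  using Pv
proof (cases rule: P_cases)
  case 1
  then show ?thesis using lin_onD(6)[OF D_lin[OF k]] by simp
next
  case (2 S c)
  have j: "j \<in> Orb" using 2 by (simp add: B_iff)
  have idx: "j k \<in> index_set h" "j (Suc k) \<in> index_set h" "j k \<noteq> j (Suc k)"
    using Orb_idx[OF j] Orb_distinct[OF j] k by (auto simp: PiE_iff)
  have "gg E (x k) (x (Suc k)) = gg E (rt (j k)) (rt (j (Suc k)))"
    unfolding 2(3) by (rule gg_rt[OF idx]) (rule xv)+
  moreover have "psgn k S * psgn k (adj_swap k ` S) = (1 :: 'a)" by (simp add: psgn_def)
  moreover have "j \<circ> adj_swap k \<circ> adj_swap k = j" "adj_swap k ` adj_swap k ` S = S"
    by (simp_all add: fun_eq_iff image_comp comp_def)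
  ultimately have "D k (D k (e (j, S))) = scl (gg E (x k) (x (Suc k))) (e (j, S))"
    unfolding DD_e[OF 2(1) k k] using cc_sq[of "j k" "j (Suc k)"] cc_comm[OF idx(1,2)]
    by (simp add: mult.assoc mult.left_commute)
  then show ?thesis unfolding 2(2) using 2(1) k by (simp add: D_simps e_space mult.commute)
qed

lemma D_comm:
  assumes k: "k \<in> {1..<n}" and l: "l \<in> {1..<n}" and far: "Suc k < l \<or> Suc l < k" and v: "v \<in> space"
  shows "D k (D l v) = D l (D k v)"
proof (rule basis_eqI[OF lin_on_comp[OF D_lin[OF k] D_lin[OF l]] lin_on_comp[OF D_lin[OF l] D_lin[OF k]] _ v])
  fix j S assume jS: "(j, S) \<in> B"
  have sw: "adj_swap l k = k" "adj_swap l (Suc k) = Suc k" "adj_swap k l = l" "adj_swap k (Suc l) = Suc l"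
    using far by (auto simp: adj_swap_def)
  have "j \<circ> adj_swap l \<circ> adj_swap k = j \<circ> adj_swap k \<circ> adj_swap l"
    "adj_swap k ` adj_swap l ` S = adj_swap l ` adj_swap k ` S"
    using adj_swap_comm[OF far] by (simp_all add: fun_eq_iff image_comp comp_def)
  moreover have "psgn k (adj_swap l ` S) = (psgn k S :: 'a)" "psgn l (adj_swap k ` S) = (psgn l S :: 'a)"
    by (simp_all add: psgn_def sw)
  ultimately show "D k (D l (e (j, S))) = D l (D k (e (j, S)))"
    unfolding DD_e[OF jS k l] DD_e[OF jS l k] sw by (simp add: mult_ac)
qed

text \<open>Both sides reach the same label, and each collects one factor \<open>cc\<close> for
  every pair among the three entries, so the coefficients agree up to the signs, which are compared
  separately.\<close>

lemma D_braid:
  assumes k: "k \<in> {1..<n}" and k': "Suc k \<in> {1..<n}" and v: "v \<in> space"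
  shows "D k (D (Suc k) (D k v)) = D (Suc k) (D k (D (Suc k) v))"
proof (rule basis_eqI[OF lin_on_comp[OF D_lin[OF k] lin_on_comp[OF D_lin[OF k'] D_lin[OF k]]]
      lin_on_comp[OF D_lin[OF k'] lin_on_comp[OF D_lin[OF k] D_lin[OF k']]] _ v])
  fix j S assume jS: "(j, S) \<in> B"
  have sw: "adj_swap k (Suc (Suc k)) = Suc (Suc k)" "adj_swap (Suc k) k = k" by (auto simp: adj_swap_def)
  have "j \<circ> adj_swap k \<circ> adj_swap (Suc k) \<circ> adj_swap k = j \<circ> adj_swap (Suc k) \<circ> adj_swap k \<circ> adj_swap (Suc k)"
    "adj_swap k ` adj_swap (Suc k) ` adj_swap k ` S = adj_swap (Suc k) ` adj_swap k ` adj_swap (Suc k) ` S"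
    by (simp_all add: fun_eq_iff image_comp comp_def adj_swap_braid)
  moreover have "psgn k S * psgn (Suc k) (adj_swap k ` S) * psgn k (adj_swap (Suc k) ` adj_swap k ` S) =
      (psgn (Suc k) S * psgn k (adj_swap (Suc k) ` S) * psgn (Suc k) (adj_swap k ` adj_swap (Suc k) ` S) :: 'a)"
    by (simp add: psgn_def sw)
  ultimately show "D k (D (Suc k) (D k (e (j, S)))) = D (Suc k) (D k (D (Suc k) (e (j, S))))"
    unfolding DDD_e[OF jS k' k k] DDD_e[OF jS k k' k'] by (simp add: sw mult_ac)
qed

text \<open>D_k permutes both the eigenvalues and the Clifford generators by the transposition, so
  the coefficients of \<open>Aop\<close> move along with it.\<close>

lemma D_Aw:
  assumes k: "k \<in> {1..<n}" and p: "p \<in> {1..n}" and r: "r \<in> {1..n}" and v: "v \<in> space"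
  shows "D k (Aw p r v) = Aw (adj_swap k p) (adj_swap k r) (D k v)"
proof -
  have p': "adj_swap k p \<in> {1..n}" "adj_swap k r \<in> {1..n}" using k p r by (auto simp: adj_swap_def)
  show ?thesis
  proof (rule basis_eqI[OF lin_on_comp[OF D_lin[OF k] Aw_lin[OF p r]] lin_on_comp[OF Aw_lin[OF p'] D_lin[OF k]] _ v])
    fix j S assume jS: "(j, S) \<in> B" and Pe: "P j (xv (j, S)) (e (j, S))"
    show "D k (Aw p r (e (j, S))) = Aw (adj_swap k p) (adj_swap k r) (D k (e (j, S)))"
      unfolding Aw_P[OF Pe p r] Aw_P[OF P_D[OF Pe k] p']
      using jS k p r p' by (simp add: Aop_def D_simps DC e_space del: xv.simps)
  qed
qed

lemma T_P:
  assumes "P j x v" "k \<in> {1..<n}"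
  shows "T k v = Aop E k (Suc k) x v + D k v"
  using assms Aw_P[OF assms(1), of k "Suc k"] by (simp add: T_def)

end

section \<open>The defining relations hold in the model\<close>

context model
begin

lemma xv_distinct:
  assumes "(j, S) \<in> B" "k \<in> {1..n}" "l \<in> {1..n}" "j k \<noteq> j l"
  shows "xv (j, S) k \<noteq> xv (j, S) l" "xv (j, S) k * xv (j, S) l \<noteq> 1"
proof -
  have "j k \<in> index_set h" "j l \<in> index_set h"
    using Orb_idx[of j] assms by (auto simp: B_iff PiE_iff)
  note d = rt_distinct[OF this assms(4)]
  show "xv (j, S) k \<noteq> xv (j, S) l" "xv (j, S) k * xv (j, S) l \<noteq> 1"
    by (rule d; rule xv)+
qed

lemma CC_comm:
  assumes "w \<in> space" "k \<in> {1..<n}"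
  shows "C (Suc k) (C k w) = - C k (C (Suc k) w)"
  by (rule C_anti) (use assms in auto)

lemma C_pair:
  assumes "a \<in> {1..n}" "b \<in> {1..n}" "c \<in> {1..n}" "a \<noteq> b" "a \<noteq> c" "w \<in> space"
  shows "C a (C b (C c w)) = C b (C c (C a w))"
proof -
  have "C a (C b (C c w)) = - C b (C a (C c w))" by (rule C_anti) (use assms in simp_all)
  also have "C a (C c w) = - C c (C a w)" by (rule C_anti) (use assms in simp_all)
  finally show ?thesis using assms by simp
qed

text \<open>The Clifford part alone violates the quadratic relation by \<open>gg\<close>, which is
  what the square of D_k supplies. The third identity turns the mixed terms into E D_k.\<close>

lemma Aw_product:
  assumes Pv: "P j x v" and p: "p \<in> {1..n}" "r \<in> {1..n}" "p \<noteq> r"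
    and x: "x p \<noteq> 0" "x r \<noteq> 0" "x p \<noteq> x r" "x p * x r \<noteq> 1"
  shows "Aw r p (Aw p r v) = scl (gg E (x p) (x r) - 1) v"
    and "Aw p r (Aw p r v) = scl E (Aw p r v) + v - scl (gg E (x p) (x r)) v"
    and "Aw p r v + Aw r p v = scl E v"
proof -
  define a d where "a = aa (x p) (x r)" and "d = bb (x p) (x r)"
  note ab = aa_bb_inverse[OF x]
  have vU: "v \<in> space" by (rule P_space[OF Pv])
  have anti: "C r (C p w) = - C p (C r w)" if "w \<in> space" for w
    by (rule C_anti) (use p that in auto)
  define y where "y = x(r := inverse (x r), p := inverse (x p))"
  have Py: "P j y (C p (C r v))" using P_C[OF P_C[OF Pv p(2)] p(1)] p(3) by (simp add: y_def)
  have coeffs: "aa (x p) (x r) = a" "bb (x p) (x r) = d" "aa (x r) (x p) = 1 - a" "bb (x r) (x p) = d"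
    "aa (y p) (y r) = 1 - a" "bb (y p) (y r) = - 1 - d" "aa (y r) (y p) = a" "bb (y r) (y p) = - 1 - d"
    unfolding a_def d_def using p(3) aa_bb_inverse(2,5)[OF x(2,1)] x(3,4) by (auto simp: y_def ab mult.commute)
  have 1: "Aw p r v = scl (E * a) v + scl (E * d) (C p (C r v))"
    "Aw r p v = scl (E * (1 - a)) v - scl (E * d) (C p (C r v))"
    "Aw p r (C p (C r v)) = scl (E * (1 - a)) (C p (C r v)) - scl (E * (- 1 - d)) v"
    "Aw r p (C p (C r v)) = scl (E * a) (C p (C r v)) + scl (E * (- 1 - d)) v"
    by (simp_all only: Aw_P[OF Pv] Aw_P[OF Py] p Aop_def coeffs) (use p vU in \<open>simp_all add: anti\<close>)
  note ex = vU 1 U_closed C_simps p Aw_simps scl_simps lookup_simps gg_def coeffs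
  show "Aw r p (Aw p r v) = scl (gg E (x p) (x r) - 1) v"
    by (rule vec_eqI, simp only: ex) (simp add: algebra_simps power2_eq_square)
  show "Aw p r (Aw p r v) = scl E (Aw p r v) + v - scl (gg E (x p) (x r)) v"
    by (rule vec_eqI, simp only: ex) (simp add: algebra_simps power2_eq_square)
  show "Aw p r v + Aw r p v = scl E v"
    by (rule vec_eqI, simp only: ex) (simp add: algebra_simps)
qed

lemma T_quad_e:
  assumes jS: "(j, S) \<in> B" and k: "k \<in> {1..<n}"
  shows "T k (T k (e (j, S))) = scl E (T k (e (j, S))) + e (j, S)"
proof -
  let ?v = "e (j, S)" and ?x = "xv (j, S)"
  have k': "k \<in> {1..n}" "Suc k \<in> {1..n}" "k \<noteq> Suc k" using k by auto
  have ne: "j k \<noteq> j (Suc k)" using Orb_distinct[of j k] jS k by (auto simp: B_iff)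
  note x1 = xv(1)[of j S k] xv(1)[of j S "Suc k"] xv_distinct[OF jS k'(1,2) ne]
  note Pv = P_e[OF jS]
  have vU: "?v \<in> space" by (rule e_space[OF jS])
  have PD: "P (j \<circ> adj_swap k) (?x \<circ> adj_swap k) (D k ?v)" by (rule P_D[OF Pv k])
  have DU: "D k ?v \<in> space" by (rule P_space[OF PD])
  have flip: "Aw k (Suc k) (D k ?v) + Aw (Suc k) k (D k ?v) = scl E (D k ?v)"
    by (rule Aw_product(3)[OF PD k']) (use x1 x1(3)[symmetric] in \<open>simp_all add: mult.commute del: xv.simps\<close>)
  have DA: "D k (Aw k (Suc k) ?v) = Aw (Suc k) k (D k ?v)"
    using D_Aw[OF k k'(1,2) vU] by simp
  have "T k (T k ?v) = Aw k (Suc k) (Aw k (Suc k) ?v) + (Aw k (Suc k) (D k ?v) + Aw (Suc k) k (D k ?v)) + D k (D k ?v)"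
    unfolding T_def using k k'(1,2) vU DU by (simp add: Aw_simps D_simps DA)
  also have "\<dots> = scl E (Aw k (Suc k) ?v + D k ?v) + ?v"
    unfolding flip Aw_product(2)[OF Pv k' x1] DD_P[OF Pv k] by (simp add: scl_simps)
  finally show ?thesis unfolding T_def .
qed

lemma TX_near_e:
  assumes jS: "(j, S) \<in> B" and k: "k \<in> {1..<n}"
  shows "T k (X k (e (j, S))) = X (Suc k) (T k (e (j, S))) -
    scl E (X (Suc k) (e (j, S)) + C k (C (Suc k) (X k (e (j, S)))))"
proof -
  let ?v = "e (j, S)" and ?x = "xv (j, S)"
  have k': "k \<in> {1..n}" "Suc k \<in> {1..n}" "k \<noteq> Suc k" using k by auto
  have ne: "j k \<noteq> j (Suc k)" using Orb_distinct[of j k] jS k by (auto simp: B_iff)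
  define s t where "s = ?x k" and "t = ?x (Suc k)"
  have st: "s \<noteq> 0" "t \<noteq> 0" "t - s \<noteq> 0" "1 - s * t \<noteq> 0"
    using xv(1)[of j S k] xv(1)[of j S "Suc k"] xv_distinct[OF jS k'(1,2) ne] unfolding s_def t_def by auto
  \<comment> \<open>Two of the identities that determined the coefficients in \<open>eig_sg\<close>,
    now read in the opposite direction.\<close>
  have c1: "t * aa s t - s * aa s t = t" "bb s t * inverse t - s * bb s t = s"
    using st by (simp_all add: aa_def bb_def divide_simps) (simp_all add: algebra_simps)
  note Pv = P_e[OF jS]
  have vU: "?v \<in> space" by (rule e_space[OF jS])
  have PD: "P (j \<circ> adj_swap k) (?x \<circ> adj_swap k) (D k ?v)" by (rule P_D[OF Pv k])
  have DU: "D k ?v \<in> space" by (rule P_space[OF PD])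
  have PC: "P j (?x(Suc k := inverse t, k := inverse s)) (C k (C (Suc k) ?v))"
    using P_C[OF P_C[OF Pv k'(2)] k'(1)] by (simp add: s_def t_def del: xv.simps)
  have Xs: "X k ?v = scl s ?v" "X (Suc k) ?v = scl t ?v" "X (Suc k) (D k ?v) = scl s (D k ?v)"
    "X (Suc k) (C k (C (Suc k) ?v)) = scl (inverse t) (C k (C (Suc k) ?v))"
    using XY_P(1)[OF Pv] XY_P(1)[OF PD, of "Suc k"] XY_P(1)[OF PC, of "Suc k"]
    by (simp_all add: s_def t_def del: xv.simps)
  have Tv: "T k ?v = scl (E * aa s t) ?v + scl (E * bb s t) (C k (C (Suc k) ?v)) + D k ?v"
    using T_P[OF Pv k] unfolding Aop_def s_def t_def .
  have m: "s * (E * aa s t) * m1 + s * (E * bb s t) * m2 =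
      t * (E * aa s t) * m1 + inverse t * (E * bb s t) * m2 - E * t * m1 - E * s * m2" for m1 m2
  proof -
    have "t * (E * aa s t) * m1 + inverse t * (E * bb s t) * m2 - E * t * m1 - E * s * m2 -
        (s * (E * aa s t) * m1 + s * (E * bb s t) * m2) =
      E * m1 * ((t * aa s t - s * aa s t) - t) + E * m2 * ((bb s t * inverse t - s * bb s t) - s)"
      by (simp add: algebra_simps)
    also have "\<dots> = 0" unfolding c1 by simp
    finally show ?thesis by simp
  qed
  show ?thesis
  proof (rule vec_eqI)
    fix i
    show "Poly_Mapping.lookup (T k (X k ?v)) i = Poly_Mapping.lookup (X (Suc k) (T k ?v) -
      scl E (X (Suc k) ?v + C k (C (Suc k) (X k ?v)))) i"
      unfolding Xs(1) using k k'(1,2) vU DU m[of "Poly_Mapping.lookup ?v i" "Poly_Mapping.lookup (C k (C (Suc k) ?v)) i"]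
      by (simp add: T_simps Tv Xs lin_onD[OF X_lin] lookup_simps algebra_simps del: xv.simps)
  qed
qed

lemma TX_far_e:
  assumes jS: "(j, S) \<in> B" and k: "k \<in> {1..<n}" and l: "l \<in> {1..n}" "l \<noteq> k" "l \<noteq> Suc k"
  shows "T k (X l (e (j, S))) = X l (T k (e (j, S)))"
proof -
  let ?v = "e (j, S)" and ?x = "xv (j, S)"
  have k': "k \<in> {1..n}" "Suc k \<in> {1..n}" using k by auto
  note Pv = P_e[OF jS]
  have vU: "?v \<in> space" by (rule e_space[OF jS])
  have PD: "P (j \<circ> adj_swap k) (?x \<circ> adj_swap k) (D k ?v)" by (rule P_D[OF Pv k])
  have DU: "D k ?v \<in> space" by (rule P_space[OF PD])
  note PC = P_C[OF P_C[OF Pv k'(2)] k'(1)]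
  show ?thesis
    using XY_P(1)[OF Pv, of l] XY_P(1)[OF PD, of l] XY_P(1)[OF PC, of l] k k' l vU DU
    by (simp add: T_simps T_P[OF Pv k] Aop_def lin_onD[OF X_lin] scl_simps mult.commute del: xv.simps)
qed

lemma TC_e:
  assumes jS: "(j, S) \<in> B" and k: "k \<in> {1..<n}"
  shows "T k (C k (e (j, S))) = C (Suc k) (T k (e (j, S)))"
    and "T k (C (Suc k) (e (j, S))) = C k (T k (e (j, S))) - scl E (C k (e (j, S)) - C (Suc k) (e (j, S)))"
    and "l \<in> {1..n} \<Longrightarrow> l \<noteq> k \<Longrightarrow> l \<noteq> Suc k \<Longrightarrow> T k (C l (e (j, S))) = C l (T k (e (j, S)))"
proof -
  let ?v = "e (j, S)" and ?x = "xv (j, S)"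
  have k': "k \<in> {1..n}" "Suc k \<in> {1..n}" "k \<noteq> Suc k" using k by auto
  have ne: "j k \<noteq> j (Suc k)" using Orb_distinct[of j k] jS k by (auto simp: B_iff)
  define s t where "s = ?x k" and "t = ?x (Suc k)"
  have st: "s \<noteq> 0" "t \<noteq> 0" "s \<noteq> t" "s * t \<noteq> 1"
    using xv(1)[of j S k] xv(1)[of j S "Suc k"] xv_distinct[OF jS k'(1,2) ne] unfolding s_def t_def by auto
  note ab = aa_bb_inverse[OF st]
  note Pv = P_e[OF jS]
  have vU: "?v \<in> space" by (rule e_space[OF jS])
  have DU: "D k ?v \<in> space" using P_space[OF P_D[OF Pv k]] .
  have Tv: "T k ?v = scl (E * aa s t) ?v + scl (E * bb s t) (C k (C (Suc k) ?v)) + D k ?v"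
    using T_P[OF Pv k] unfolding Aop_def s_def t_def .
  have T1: "T k (C k ?v) = scl (E * - bb s t) (C k ?v) + scl (E * - aa s t) (C k (C (Suc k) (C k ?v))) + D k (C k ?v)"
    using T_P[OF P_C[OF Pv k'(1)] k] by (simp add: Aop_def ab flip: s_def t_def del: xv.simps)
  have T2: "T k (C (Suc k) ?v) = scl (E * (1 + bb s t)) (C (Suc k) ?v) + scl (E * (aa s t - 1)) (C k (C (Suc k) (C (Suc k) ?v))) + D k (C (Suc k) ?v)"
    using T_P[OF P_C[OF Pv k'(2)] k] by (simp add: Aop_def ab flip: s_def t_def del: xv.simps)
  show "T k (C k ?v) = C (Suc k) (T k ?v)"
    unfolding T1 Tv using k k'(1,2) vU DU by (simp add: DC CC_comm scl_simps)
  show "T k (C (Suc k) ?v) = C k (T k ?v) - scl E (C k ?v - C (Suc k) ?v)"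
    unfolding T2 Tv using k k'(1,2) vU DU
    by (intro vec_eqI) (simp add: DC lookup_simps algebra_simps)
  assume l: "l \<in> {1..n}" "l \<noteq> k" "l \<noteq> Suc k"
  have T3: "T k (C l ?v) = scl (E * aa s t) (C l ?v) + scl (E * bb s t) (C k (C (Suc k) (C l ?v))) + D k (C l ?v)"
    using T_P[OF P_C[OF Pv l(1)] k] l by (simp add: Aop_def flip: s_def t_def del: xv.simps)
  have sw: "C k (C (Suc k) (C l ?v)) = C l (C k (C (Suc k) ?v))"
    using C_anti[OF k'(2) l(1) _ vU] C_anti[OF k'(1) l(1), of "C (Suc k) ?v"] l k' vU by simp
  show "T k (C l ?v) = C l (T k ?v)"
    unfolding T3 Tv sw using k k'(1,2) l vU DU by (simp add: DC scl_simps)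
qed

text \<open>Both sides are expanded with all D moved to the right by \<open>D_Aw\<close>. Triple D
  terms agree by \<open>D_braid\<close>, and terms with two different D agree literally. Terms with
  a single D are the two associative Yang-Baxter equations, applied to \<open>D p v\<close> and
  \<open>D q v\<close>. The terms without D combine with those containing a squared D, in
  \<open>ee\<close>.\<close>

lemma braid_generic:
  assumes jS: "(j, S) \<in> B" and k: "k \<in> {1..<n}" "Suc k \<in> {1..<n}" and ne: "j k \<noteq> j (Suc (Suc k))"
  shows "T k (T (Suc k) (T k (e (j, S)))) = T (Suc k) (T k (T (Suc k) (e (j, S))))"
proof -
  define p q r where "p = k" and "q = Suc k" and "r = Suc (Suc k)"
  define v where "v = e (j, S)"
  define x where "x = xv (j, S)"
  have mem: "p \<in> {1..n}" "q \<in> {1..n}" "r \<in> {1..n}" "p \<noteq> q" "q \<noteq> r" "p \<noteq> r" and kq: "p \<in> {1..<n}" "q \<in> {1..<n}"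
    using k by (auto simp: p_def q_def r_def)
  have sw: "adj_swap p p = q" "adj_swap p q = p" "adj_swap p r = r" "adj_swap q p = p" "adj_swap q q = r" "adj_swap q r = q"
    by (auto simp: p_def q_def r_def adj_swap_def)
  have jne: "j p \<noteq> j q" "j q \<noteq> j r" "j p \<noteq> j r"
    using Orb_distinct[of j k] Orb_distinct[of j "Suc k"] jS k ne by (auto simp: B_iff p_def q_def r_def)
  have x: "x p \<noteq> 0" "x q \<noteq> 0" "x r \<noteq> 0" "x p \<noteq> x q" "x q \<noteq> x r" "x p \<noteq> x r"
    "x p * x q \<noteq> 1" "x q * x r \<noteq> 1" "x p * x r \<noteq> 1"
    unfolding x_def by (rule xv xv_distinct[OF jS] mem jne)+
  have x': "x q * x p \<noteq> 1" "x r * x q \<noteq> 1" "x r * x p \<noteq> 1" using x by (simp_all add: mult.commute)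
  have Pv: "P j x v" using P_e[OF jS] by (simp add: v_def x_def)
  have vU: "v \<in> space" by (rule P_space[OF Pv])
  note YB = yang_baxter[where A = Aw and E = E and p = p and q = q and r = r, OF mem Aw_lin]
  \<comment> \<open>The associative equations as properties of w. They are linear in w, so they pass
    from weight vectors to the combinations \<open>Aw p q v\<close> and
    \<open>Aw q r v\<close>.\<close>
  define I where "I w \<longleftrightarrow> Aw p r (Aw q p w) + Aw p q (Aw q r w) = Aw q r (Aw p r w)" for w
  define I' where "I' w \<longleftrightarrow> Aw p q (Aw p r w) = Aw q r (Aw p q w) + Aw p r (Aw r q w)" for w
  have I: "I w" and I': "I' w" and Y: "Aw q r (Aw p r (Aw p q w)) = Aw p q (Aw p r (Aw q r w))"
    if "P j' y w" "y p \<noteq> 0" "y q \<noteq> 0" "y r \<noteq> 0" "y p \<noteq> y q" "y q \<noteq> y r" "y p \<noteq> y r"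
      "y p * y q \<noteq> 1" "y q * y r \<noteq> 1" "y p * y r \<noteq> 1" for j' y w
    unfolding I_def I'_def
    by (rule yang_baxter[where A = Aw and E = E and p = p and q = q and r = r and P = "P j'" and x = y];
        (assumption | rule mem Aw_lin that P_C Aw_P | erule P_space)+)+
  have lin: "lin_on space (Aw s t)" if "s \<in> {p, q, r}" "t \<in> {p, q, r}" for s t
    using that mem by (auto intro: Aw_lin)
  have comb: "f (scl a u + scl b w) = g (scl a u + scl b w)"
    if "lin_on space f" "lin_on space g" "f u = g u" "f w = g w" "u \<in> space" "w \<in> space" for f g a b u w
    using that by (simp add: lin_onD[OF that(1)] lin_onD[OF that(2)])
  have I_comb: "I (scl a u + scl b w)" if "I u" "I w" "u \<in> space" "w \<in> space" for a b u w
    unfolding I_def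
    by (rule comb[of "\<lambda>w. Aw p r (Aw q p w) + Aw p q (Aw q r w)" "\<lambda>w. Aw q r (Aw p r w)"])
      (rule lin_on_add lin_on_comp[OF lin lin] insertI1 insertI2 that[unfolded I_def] | simp)+
  have I'_comb: "I' (scl a u + scl b w)" if "I' u" "I' w" "u \<in> space" "w \<in> space" for a b u w
    unfolding I'_def
    by (rule comb[of "\<lambda>w. Aw p q (Aw p r w)" "\<lambda>w. Aw q r (Aw p q w) + Aw p r (Aw r q w)"])
      (rule lin_on_add lin_on_comp[OF lin lin] insertI1 insertI2 that[unfolded I'_def] | simp)+
  have inv: "inverse s \<noteq> inverse t" "inverse s \<noteq> t" "s \<noteq> inverse t" "inverse s * inverse t \<noteq> 1" "inverse s * t \<noteq> 1" "s * inverse t \<noteq> 1"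
    if "s \<noteq> 0" "t \<noteq> 0" "s \<noteq> t" "s * t \<noteq> 1" for s t :: 'a
    using that by (auto simp: field_simps)
  have Apq: "I (Aw p q v)"
    unfolding Aw_P[OF Pv mem(1,2)] Aop_def
  proof (rule I_comb)
    show "I v" by (rule I[OF Pv x])
    show "I (C p (C q v))"
      by (rule I[OF P_C[OF P_C[OF Pv mem(2)] mem(1)]])
        (use x inv[OF x(1,2,4,7)] inv[OF x(2,3,5,8)] inv[OF x(1,3,6,9)] mem in simp_all)
  qed (use vU mem in simp_all)
  have Aqr: "I' (Aw q r v)"
    unfolding Aw_P[OF Pv mem(2,3)] Aop_def
  proof (rule I'_comb)
    show "I' v" by (rule I'[OF Pv x])
    show "I' (C q (C r v))"
      by (rule I'[OF P_C[OF P_C[OF Pv mem(3)] mem(2)]])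
        (use x inv[OF x(1,2,4,7)] inv[OF x(2,3,5,8)] inv[OF x(1,3,6,9)] mem in simp_all)
  qed (use vU mem in simp_all)
  note A_U = lin_onD(1)[OF Aw_lin]
  \<comment> \<open>By \<open>Aw_product\<close> the squared D is
    \<open>Aw q p (Aw p q v) + v\<close>, or the analogue for q and r. So I at
    \<open>Aw p q v\<close> and I' at \<open>Aw q r v\<close>, joined by the quantum Yang-Baxter
    equation, give the claim; the two copies of \<open>Aw p r v\<close> cancel.\<close>
  have ee: "Aw p q (Aw q r (Aw p q v)) + Aw p r (D p (D p v)) = Aw q r (Aw p q (Aw q r v)) + Aw p r (D q (D q v))"
  proof -
    have DD: "D p (D p v) = scl (gg E (x p) (x q)) v" "D q (D q v) = scl (gg E (x q) (x r)) v"
      using DD_P[OF Pv kq(1)] DD_P[OF Pv kq(2)] by (simp_all add: p_def q_def r_def)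
    have sub: "Aw p r (scl (c - 1) v) = Aw p r (scl c v) - Aw p r v" for c
      using vU mem by (simp add: Aw_simps vsp.scale_left_diff_distrib)
    have 1: "Aw p r (scl (gg E (x p) (x q)) v) - Aw p r v + Aw p q (Aw q r (Aw p q v)) = Aw q r (Aw p r (Aw p q v))"
      using Apq unfolding I_def Aw_product(1)[OF Pv mem(1,2,4) x(1,2,4,7)] sub .
    have 2: "Aw p q (Aw p r (Aw q r v)) = Aw q r (Aw p q (Aw q r v)) + (Aw p r (scl (gg E (x q) (x r)) v) - Aw p r v)"
      using Aqr unfolding I'_def Aw_product(1)[OF Pv mem(2,3,5) x(2,3,5,8)] sub .
    have gen: "b1 + a1 = b2 + a2" if "a1 - z + b1 = b2 + (a2 - z)" for a1 a2 b1 b2 z :: "'a vec"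
      using that by (simp add: algebra_simps)
    show ?thesis unfolding DD by (rule gen[OF trans[OF 1 trans[OF Y[OF Pv x] 2]]])
  qed
  have PDp: "P (j \<circ> adj_swap p) (x \<circ> adj_swap p) (D p v)" by (rule P_D[OF Pv kq(1)])
  have PDq: "P (j \<circ> adj_swap q) (x \<circ> adj_swap q) (D q v)" by (rule P_D[OF Pv kq(2)])
  have qS: "Suc p = q" "Suc q = r" by (simp_all add: p_def q_def r_def)
  have ID: "I (D p v)"
    by (rule I[OF PDp]) (use x x' x(4-6)[symmetric] in \<open>simp_all add: sw qS\<close>)
  have ID': "I' (D q v)"
    by (rule I'[OF PDq]) (use x x' x(4-6)[symmetric] in \<open>simp_all add: sw qS\<close>)
  have DA: "D p (Aw s t w) = Aw (adj_swap p s) (adj_swap p t) (D p w)" "D q (Aw s t w) = Aw (adj_swap q s) (adj_swap q t) (D q w)"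
    if "s \<in> {p, q, r}" "t \<in> {p, q, r}" "w \<in> space" for s t w
    using D_Aw[OF kq(1) _ _ that(3)] D_Aw[OF kq(2) _ _ that(3)] that mem by blast+
  have DA': "D p (Aw p q w) = Aw q p (D p w)" "D p (Aw q r w) = Aw p r (D p w)" "D p (Aw p r w) = Aw q r (D p w)"
    "D q (Aw p q w) = Aw p r (D q w)" "D q (Aw p r w) = Aw p q (D q w)" "D q (Aw q r w) = Aw r q (D q w)"
    if "w \<in> space" for w
    by (simp_all only: DA[OF _ _ that] insert_iff simp_thms sw)
  have Tp: "T p w = Aw p q w + D p w" and Tq: "T q w = Aw q r w + D q w" for w
    by (simp_all add: T_def p_def q_def r_def)
  have L: "T p (T q (T p v)) = Aw p q (Aw q r (Aw p q v)) + Aw p r (D p (D p v)) +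
      (Aw p r (Aw q p (D p v)) + Aw p q (Aw q r (D p v))) + Aw p q (Aw p r (D q v)) +
      Aw p q (D q (D p v)) + Aw q r (D p (D q v)) + D p (D q (D p v))"
    unfolding Tp Tq using mem kq vU by (simp add: Aw_simps D_simps DA')
  have R: "T q (T p (T q v)) = Aw q r (Aw p q (Aw q r v)) + Aw p r (D q (D q v)) +
      Aw q r (Aw p r (D p v)) + (Aw q r (Aw p q (D q v)) + Aw p r (Aw r q (D q v))) +
      Aw p q (D q (D p v)) + Aw q r (D p (D q v)) + D q (D p (D q v))"
    unfolding Tp Tq using mem kq vU by (simp add: Aw_simps D_simps DA')
  have "D p (D q (D p v)) = D q (D p (D q v))"
    using D_braid[OF k vU] by (simp add: p_def q_def)
  then have "T p (T q (T p v)) = T q (T p (T q v))"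
    unfolding L R ee ID[unfolded I_def] ID'[unfolded I'_def] by simp
  then show ?thesis by (simp add: p_def q_def v_def)
qed

text \<open>The middle entry is linked to both outer ones, so \<open>D p v\<close> and
  \<open>D m v\<close> vanish and, by \<open>D_Aw\<close>, only the Clifford parts act. The relation
  then holds because \<open>tight\<close> annihilates the braid defect.\<close>

lemma braid_special:
  assumes jS: "(j, S) \<in> B" and k: "k \<in> {1..<n}" "Suc k \<in> {1..<n}" and eq: "j k = j (Suc (Suc k))"
  shows "T k (T (Suc k) (T k (e (j, S)))) = T (Suc k) (T k (T (Suc k) (e (j, S))))"
proof -
  define p m r where "p = k" and "m = Suc k" and "r = Suc (Suc k)"
  define v where "v = e (j, S)"
  define x where "x = xv (j, S)"
  have mem: "p \<in> {1..n}" "m \<in> {1..n}" "r \<in> {1..n}" "p \<noteq> m" "m \<noteq> r" "p \<noteq> r" and km: "p \<in> {1..<n}" "m \<in> {1..<n}"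
    using k by (auto simp: p_def m_def r_def)
  have sw: "adj_swap p p = m" "adj_swap p m = p" "adj_swap p r = r" "adj_swap m p = p" "adj_swap m m = r" "adj_swap m r = m"
    by (auto simp: p_def m_def r_def adj_swap_def)
  have j: "j \<in> Orb" using jS by (simp add: B_iff)
  have idx: "j p \<in> index_set h" "j m \<in> index_set h" using Orb_idx[OF j] mem by (auto simp: PiE_iff)
  have jne: "j p \<noteq> j m" using Orb_distinct[of j k] j k by (auto simp: p_def m_def)
  have tight: "tight h (j p) (j m)"
    using well_separated_triple[of n j k] Orb_props[OF j] k eq by (auto simp: p_def m_def)
  have adj: "j m = j p + 1 \<or> j p = j m + 1" using tight by (auto simp: tight_def)
  have cc0: "cc (j p) (j m) = 0" "cc (j m) (j r) = 0"
    using cc_close[of "j p" "j m"] cc_close[of "j m" "j p"] idx jne adj eq by (auto simp: close_def p_def r_def)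
  have D0: "D p v = 0" "D m v = 0"
    using cc0 D_e[OF jS] by (simp_all add: v_def p_def m_def r_def)
  have x: "x p \<noteq> 0" "x m \<noteq> 0" "x p \<noteq> x m" "x p * x m \<noteq> 1"
    unfolding x_def by (rule xv xv_distinct[OF jS] mem jne)+
  have xs: "x p + inverse (x p) = qval q (j p)" "x m + inverse (x m) = qval q (j m)"
    "x r \<noteq> 0" "x r + inverse (x r) = x p + inverse (x p)"
    unfolding x_def using xv eq by (simp_all add: p_def r_def del: xv.simps)
  have Pv: "P j x v" using P_e[OF jS] by (simp add: v_def x_def)
  have vU: "v \<in> space" by (rule P_space[OF Pv])
  \<comment> \<open>End indices satisfy the first factor of \<open>defect_factor\<close>; the
    pattern at the top of the odd index set satisfies the second.\<close>
  have K0: "aa (x p) (x m) * (1 - aa (x p) (x m)) * (2 * aa (x p) (x m) - 1) -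
      (1 + bb (x p) (x m)) * bb (x p) (x m) * (2 * bb (x p) (x m) + 1) = 0"
  proof (subst defect_factor[OF x])
    have end_case: "x p * x p = 1" if "end_index (j p)"
      using that self_inverse_iff[OF idx(1) x(1) xs(1)] x(1) by (metis right_inverse)
    show "x p * x p = 1 \<or> (x m + inverse (x m)) * (x p + inverse (x p) + (x m + inverse (x m))) = 8"
      using tight unfolding tight_def
    proof (elim disjE exE conjE)
      assume "j p = 0"
      then show ?thesis using end_case by (simp add: end_index_def)
    next
      fix h' assume "h = enat h'" "odd h'" "j m = j p + 1" "j m = (h' - 1) div 2"
      then have "odd_special (j p) (j m)" unfolding odd_special_def by blast
      then show ?thesis unfolding xs(1,2) using special_iff[OF idx adj] by blast
    next
      fix h' assume "h = enat h'" "even h'" "j p = h' div 2 - 1"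
      then have "end_index (j p)" unfolding end_index_def by blast
      then show ?thesis using end_case by simp
    qed
  qed
  have "x r = x p \<or> x r = inverse (x p)"
    using sum_inverse_eq_iff[OF xs(3) x(1)] xs(4) by (auto simp: inverse_unique mult.commute)
  moreover have "Aw p m (Aw m r (Aw p m v)) - Aw m r (Aw p m (Aw m r v)) = scl (E ^ 3 * 0) v" if "x r = x p"
    by (rule braid_defect(1)[where P = "P j" and x = x and p = p and q = m and r = r and E = E, OF mem _ _ _ _ _ _ _ x refl refl _ that];
        (rule Aw_lin Aw_P P_C Pv mem | assumption | erule P_space | simp only: K0)+)
  moreover have "Aw p m (Aw m r (Aw p m v)) - Aw m r (Aw p m (Aw m r v)) = scl (E ^ 3 * 0) (C p (C r v))" if "x r = inverse (x p)"
    by (rule braid_defect(2)[where P = "P j" and x = x and p = p and q = m and r = r and E = E, OF mem _ _ _ _ _ _ _ x refl refl _ that];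
        (rule Aw_lin Aw_P P_C Pv mem | assumption | erule P_space | simp only: K0)+)
  ultimately have A: "Aw p m (Aw m r (Aw p m v)) = Aw m r (Aw p m (Aw m r v))" by auto
  have DA: "D p (Aw s t w) = Aw (adj_swap p s) (adj_swap p t) (D p w)" "D m (Aw s t w) = Aw (adj_swap m s) (adj_swap m t) (D m w)"
    if "s \<in> {p, m, r}" "t \<in> {p, m, r}" "w \<in> space" for s t w
    using D_Aw[OF km(1) _ _ that(3)] D_Aw[OF km(2) _ _ that(3)] that mem by blast+
  have Tp: "T p w = Aw p m w + D p w" and Tm: "T m w = Aw m r w + D m w" for w
    by (simp_all add: T_def p_def m_def r_def)
  have "T p (T m (T p v)) = T m (T p (T m v))"
    unfolding Tp Tm using mem km vU A by (simp add: Aw_simps D_simps DA sw D0)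
  then show ?thesis by (simp add: p_def m_def v_def)
qed

lemma hc_module: "hc_module space n C q T X Y"
proof unfold_locales
  show "lin_on space (T i)" if "i \<in> {1..<n}" for i by (rule T_lin[OF that])
  show "lin_on space (X i)" "lin_on space (Y i)" for i by (rule X_lin Y_lin)+
  show "T i (T i v) = scl E (T i v) + v" if i: "i \<in> {1..<n}" and v: "v \<in> space" for i v
    by (rule basis_eqI[OF lin_on_comp[OF T_lin[OF i] T_lin[OF i]] lin_on_add[OF lin_on_scl[OF T_lin[OF i]] lin_on_id] _ v])
      (rule T_quad_e[OF _ i])
  show "T i (T j v) = T j (T i v)"
    if ij: "i \<in> {1..<n}" "j \<in> {1..<n}" "\<bar>int i - int j\<bar> > 1" and v: "v \<in> space" for i j v
  proof -
    have far: "Suc i < j \<or> Suc j < i" using ij(3) by auto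
    have mem: "i \<in> {1..n}" "Suc i \<in> {1..n}" "j \<in> {1..n}" "Suc j \<in> {1..n}" using ij by auto
    have sw: "adj_swap i j = j" "adj_swap i (Suc j) = Suc j" "adj_swap j i = i" "adj_swap j (Suc i) = Suc i"
      using far by (auto simp: adj_swap_def)
    have ne: "i \<noteq> j" "Suc i \<noteq> j" "i \<noteq> Suc j" using far by auto
    have AA: "Aw i (Suc i) (Aw j (Suc j) v) = Aw j (Suc j) (Aw i (Suc i) v)"
    proof (rule basis_eqI[OF lin_on_comp[OF Aw_lin Aw_lin] lin_on_comp[OF Aw_lin Aw_lin] _ v])
      fix j' S assume jS: "(j', S) \<in> B" and Pe: "P j' (xv (j', S)) (e (j', S))"
      have vU: "e (j', S) \<in> space" by (rule e_space[OF jS])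
      have "C i (C (Suc i) (C j (C (Suc j) (e (j', S))))) = C j (C (Suc j) (C i (C (Suc i) (e (j', S)))))"
        using C_pair[of "Suc i" j "Suc j" "e (j', S)"] C_pair[of i j "Suc j" "C (Suc i) (e (j', S))"] mem far vU ne
        by simp
      then show "Aw i (Suc i) (Aw j (Suc j) (e (j', S))) = Aw j (Suc j) (Aw i (Suc i) (e (j', S)))"
        using mem vU ne
        by (simp add: Aw_P[OF Pe] Aw_P[OF P_C[OF P_C[OF Pe mem(2)] mem(1)]] Aw_P[OF P_C[OF P_C[OF Pe mem(4)] mem(3)]]
            Aop_def Aw_simps scl_simps mult_ac add_ac del: xv.simps)
    qed (use mem in simp_all)
    show ?thesis
      unfolding T_def using ij mem v
      by (simp add: Aw_simps D_simps D_Aw sw AA D_comm[OF ij(1,2) far] add_ac)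
  qed
  show "T i (T (Suc i) (T i v)) = T (Suc i) (T i (T (Suc i) v))"
    if i: "i \<in> {1..<n}" "Suc i \<in> {1..<n}" and v: "v \<in> space" for i v
  proof (rule basis_eqI[OF lin_on_comp[OF T_lin[OF i(1)] lin_on_comp[OF T_lin[OF i(2)] T_lin[OF i(1)]]]
      lin_on_comp[OF T_lin[OF i(2)] lin_on_comp[OF T_lin[OF i(1)] T_lin[OF i(2)]]] _ v])
    fix j S assume jS: "(j, S) \<in> B"
    show "T i (T (Suc i) (T i (e (j, S)))) = T (Suc i) (T i (T (Suc i) (e (j, S))))"
      using braid_generic[OF jS i] braid_special[OF jS i] by blast
  qed
  show "X i (X j v) = X j (X i v)" if "v \<in> space" for i j v
    by (rule basis_eqI[OF lin_on_comp[OF X_lin X_lin] lin_on_comp[OF X_lin X_lin] _ that])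
      (simp add: XY_P(1) lin_onD[OF X_lin] e_space scl_simps mult.commute del: xv.simps)
  show "X i (Y i v) = v" if "v \<in> space" for i v
    by (rule basis_eqI[OF lin_on_comp[OF X_lin Y_lin] lin_on_id _ that])
      (simp add: XY_P lin_onD[OF X_lin] e_space xv(1) del: xv.simps)
  show "Y i (X i v) = v" if "v \<in> space" for i v
    by (rule basis_eqI[OF lin_on_comp[OF Y_lin X_lin] lin_on_id _ that])
      (simp add: XY_P lin_onD[OF Y_lin] e_space xv(1) del: xv.simps)
  show "T i (X i v) = X (Suc i) (T i v) - scl E (X (Suc i) v + C i (C (Suc i) (X i v)))"
    if i: "i \<in> {1..<n}" and v: "v \<in> space" for i v
  proof -
    have mem: "i \<in> {1..n}" "Suc i \<in> {1..n}" using i by auto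
    show ?thesis
      by (rule basis_eqI[OF lin_on_comp[OF T_lin[OF i] X_lin] lin_on_diff[OF lin_on_comp[OF X_lin T_lin[OF i]]
          lin_on_scl[OF lin_on_add[OF X_lin lin_on_comp[OF C_lin[OF mem(1)] lin_on_comp[OF C_lin[OF mem(2)] X_lin]]]]] _ v])
        (rule TX_near_e[OF _ i])
  qed
  show "T i (X j v) = X j (T i v)"
    if i: "i \<in> {1..<n}" and j: "j \<in> {1..n}" "j \<noteq> i" "j \<noteq> Suc i" and v: "v \<in> space" for i j v
    by (rule basis_eqI[OF lin_on_comp[OF T_lin[OF i] X_lin] lin_on_comp[OF X_lin T_lin[OF i]] _ v])
      (rule TX_far_e[OF _ i j])
  show "T i (C i v) = C (Suc i) (T i v)"
    "T i (C (Suc i) v) = C i (T i v) - scl E (C i v - C (Suc i) v)" if i: "i \<in> {1..<n}" and v: "v \<in> space" for i v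
  proof -
    have mem: "i \<in> {1..n}" "Suc i \<in> {1..n}" using i by auto
    show "T i (C i v) = C (Suc i) (T i v)"
      by (rule basis_eqI[OF lin_on_comp[OF T_lin[OF i] C_lin[OF mem(1)]] lin_on_comp[OF C_lin[OF mem(2)] T_lin[OF i]] _ v])
        (rule TC_e(1)[OF _ i])
    show "T i (C (Suc i) v) = C i (T i v) - scl E (C i v - C (Suc i) v)"
      by (rule basis_eqI[OF lin_on_comp[OF T_lin[OF i] C_lin[OF mem(2)]]
          lin_on_diff[OF lin_on_comp[OF C_lin[OF mem(1)] T_lin[OF i]] lin_on_scl[OF lin_on_diff[OF C_lin[OF mem(1)] C_lin[OF mem(2)]]]] _ v])
        (rule TC_e(2)[OF _ i])
  qed
  show "T i (C j v) = C j (T i v)"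
    if i: "i \<in> {1..<n}" and j: "j \<in> {1..n}" "j \<noteq> i" "j \<noteq> Suc i" and v: "v \<in> space" for i j v
    by (rule basis_eqI[OF lin_on_comp[OF T_lin[OF i] C_lin[OF j(1)]] lin_on_comp[OF C_lin[OF j(1)] T_lin[OF i]] _ v])
      (rule TC_e(3)[OF _ i j])
  show "X i (C i v) = C i (Y i v)" if i: "i \<in> {1..n}" and v: "v \<in> space" for i v
  proof (rule basis_eqI[OF lin_on_comp[OF X_lin C_lin[OF i]] lin_on_comp[OF C_lin[OF i] Y_lin] _ v])
    fix j S assume jS: "(j, S) \<in> B" and Pe: "P j (xv (j, S)) (e (j, S))"
    show "X i (C i (e (j, S))) = C i (Y i (e (j, S)))"
      using XY_P(1)[OF P_C[OF Pe i], of i] XY_P(2)[OF Pe, of i] e_space[OF jS] i by (simp del: xv.simps)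
  qed
  show "X i (C j v) = C j (X i v)" if i: "i \<in> {1..n}" "j \<in> {1..n}" "i \<noteq> j" and v: "v \<in> space" for i j v
  proof (rule basis_eqI[OF lin_on_comp[OF X_lin C_lin[OF i(2)]] lin_on_comp[OF C_lin[OF i(2)] X_lin] _ v])
    fix l S assume jS: "(l, S) \<in> B" and Pe: "P l (xv (l, S)) (e (l, S))"
    show "X i (C j (e (l, S))) = C j (X i (e (l, S)))"
      using XY_P(1)[OF P_C[OF Pe i(2)], of i] XY_P(1)[OF Pe, of i] e_space[OF jS] i by (simp del: xv.simps)
  qed
qed

end

section \<open>Joint eigenvectors inside generalised weight spaces\<close>

context hc_module
begin

lemma X_Y_comm:
  assumes "i \<in> {1..n}" "j \<in> {1..n}" "v \<in> U"
  shows "X i (Y j v) = Y j (X i v)"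
proof -
  have "X j (X i (Y j v)) = X i v"
    using X_comm[of j i "Y j v"] XY[of j v] assms by simp
  then have "Y j (X j (X i (Y j v))) = Y j (X i v)" by simp
  then show ?thesis using YX[of j "X i (Y j v)"] assms by simp
qed

definition wshift :: "nat \<Rightarrow> 'a \<Rightarrow> 'a vec \<Rightarrow> 'a vec" where
  "wshift k c v = X k v + Y k v - scl c v"

lemma wshift_lin: "k \<in> {1..n} \<Longrightarrow> lin_on U (wshift k c)"
  by (auto simp: lin_on_def wshift_def scl_simps mult.commute)

lemma wshift_commute:
  assumes "lin_on U g" "\<And>v. v \<in> U \<Longrightarrow> g (X k v) = X k (g v)" "\<And>v. v \<in> U \<Longrightarrow> g (Y k v) = Y k (g v)"
    "k \<in> {1..n}" "v \<in> U"
  shows "g ((wshift k c ^^ N) v) = (wshift k c ^^ N) (g v) \<and> (wshift k c ^^ N) v \<in> U"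
proof (induction N)
  case (Suc N)
  then show ?case using assms by (simp add: wshift_def lin_onD[OF assms(1)])
qed (use assms in simp)

lemma Y_comm:
  assumes "i \<in> {1..n}" "j \<in> {1..n}" "v \<in> U"
  shows "Y i (Y j v) = Y j (Y i v)"
proof -
  have "X i (Y j (Y i v)) = Y j v"
    using X_Y_comm[of i j "Y i v"] XY[of i v] assms by simp
  then have "Y i (X i (Y j (Y i v))) = Y i (Y j v)" by simp
  then show ?thesis using YX[of i "Y j (Y i v)"] assms by simp
qed

lemma wshift_power_lin: "k \<in> {1..n} \<Longrightarrow> lin_on U (wshift k c ^^ N)"
proof (induction N)
  case 0
  then show ?case by (auto simp: lin_on_def)
next
  case (Suc N)
  then show ?case using wshift_lin[of k c] by (auto simp: lin_on_def)
qed

text \<open>The last nonzero iterate u of the shift satisfies (X - y)(X - inverse y) u = 0. So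
  either u is an eigenvector for \<open>inverse y\<close>, or X u - inverse y u is one for
  y.\<close>

lemma ex_eigenvector:
  assumes S: "vsp.subspace S" "S \<subseteq> U" "\<And>v. v \<in> S \<Longrightarrow> X k v \<in> S" "\<And>v. v \<in> S \<Longrightarrow> Y k v \<in> S"
    and k: "k \<in> {1..n}" and v: "v \<in> S" "v \<noteq> 0" "(wshift k (y + inverse y) ^^ N) v = 0" and y: "y \<noteq> 0"
  shows "\<exists>u x. u \<in> S \<and> u \<noteq> 0 \<and> x \<noteq> 0 \<and> x + inverse x = y + inverse y \<and> X k u = scl x u"
proof -
  have wfS: "wshift k c u \<in> S" if "u \<in> S" for u c
    unfolding wshift_def using that by (intro vsp.subspace_diff vsp.subspace_add vsp.subspace_scale S)
  have "\<exists>u\<in>S. u \<noteq> 0 \<and> wshift k (y + inverse y) u = 0"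
    using v
  proof (induction N arbitrary: v)
    case (Suc N)
    show ?case
    proof (cases "wshift k (y + inverse y) v = 0")
      case False
      have "(wshift k (y + inverse y) ^^ N) (wshift k (y + inverse y) v) = 0"
        using Suc.prems(3) by (simp add: funpow_swap1)
      then show ?thesis using Suc.IH[OF wfS[OF Suc.prems(1)] False] by simp
    qed (use Suc.prems in blast)
  qed simp
  then obtain u where u: "u \<in> S" "u \<noteq> 0" "wshift k (y + inverse y) u = 0" by blast
  have uU: "u \<in> U" using u(1) S(2) by blast
  define w where "w = X k u - scl (inverse y) u"
  have wS: "w \<in> S" unfolding w_def using u(1) by (intro vsp.subspace_diff vsp.subspace_scale S)
  show ?thesis
  proof (cases "w = 0")
    case True
    then show ?thesis using u y by (intro exI[of _ u] exI[of _ "inverse y"]) (simp add: w_def add.commute)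
  next
    case False
    have Yu: "Y k u = scl (y + inverse y) u - X k u" using u(3) by (simp add: wshift_def algebra_simps)
    have "u = X k (scl (y + inverse y) u - X k u)" using XY[OF k uU] unfolding Yu by simp
    also have "\<dots> = scl (y + inverse y) (X k u) - X k (X k u)" using k uU by simp
    finally have XX: "X k (X k u) = scl (y + inverse y) (X k u) - u" by (simp add: algebra_simps)
    have "X k w = X k (X k u) - scl (inverse y) (X k u)" unfolding w_def using k uU by simp
    also have "\<dots> = scl y w"
      unfolding XX w_def using y by (simp add: scl_simps vsp.scale_left_distrib)
    finally show ?thesis using wS False y by blast
  qed
qed

text \<open>The operators X_1, ..., X_m are diagonalised one after the other, while the vector stays
  in the common generalised weight space of all of them.\<close>

lemma joint_eigenvector:
  assumes z: "z \<in> U" "z \<noteq> 0" "\<And>k. k \<in> {1..n} \<Longrightarrow> (wshift k (y k + inverse (y k)) ^^ N) z = 0"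
    and y: "\<And>k. y k \<noteq> 0"
  shows "\<exists>x v. eig x v \<and> v \<noteq> 0 \<and> (\<forall>k\<in>{1..n}. x k + inverse (x k) = y k + inverse (y k))"
proof -
  have "\<exists>x v. v \<in> U \<and> v \<noteq> 0 \<and> (\<forall>k\<in>{1..n}. (wshift k (y k + inverse (y k)) ^^ N) v = 0) \<and>
      (\<forall>k\<in>{1..m}. x k \<noteq> 0 \<and> X k v = scl (x k) v \<and> x k + inverse (x k) = y k + inverse (y k))" if "m \<le> n" for m
    using that
  proof (induction m)
    case 0
    then show ?case using z by auto
  next
    case (Suc m)
    then obtain x v where v: "v \<in> U" "v \<noteq> 0" "\<And>k. k \<in> {1..n} \<Longrightarrow> (wshift k (y k + inverse (y k)) ^^ N) v = 0"
      and x: "\<And>k. k \<in> {1..m} \<Longrightarrow> x k \<noteq> 0 \<and> X k v = scl (x k) v \<and> x k + inverse (x k) = y k + inverse (y k)"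
      by (metis Suc_leD)
    \<comment> \<open>All that has been achieved so far, as a subspace; it is stable under the next
      X and Y because these commute with all the others.\<close>
    define S where "S = {u \<in> U. (\<forall>k\<in>{1..n}. (wshift k (y k + inverse (y k)) ^^ N) u = 0) \<and> (\<forall>k\<in>{1..m}. X k u = scl (x k) u)}"
    have mn: "k \<in> {1..n}" if "k \<in> {1..m}" for k using that Suc.prems by auto
    have Sm: "Suc m \<in> {1..n}" using Suc.prems by simp
    note wl = lin_onD[OF wshift_power_lin]
    have sub: "vsp.subspace S"
      unfolding vsp.subspace_def S_def
      using mn by (auto simp: wl lin_onD[OF X_lin] scl_simps mult.commute)
    have closed: "g u \<in> S" if g: "lin_on U g" "\<And>k u. k \<in> {1..n} \<Longrightarrow> u \<in> U \<Longrightarrow> g (X k u) = X k (g u)"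
      "\<And>k u. k \<in> {1..n} \<Longrightarrow> u \<in> U \<Longrightarrow> g (Y k u) = Y k (g u)" and u: "u \<in> S" for g u
    proof -
      have uU: "u \<in> U" "g u \<in> U" using u lin_onD(1)[OF g(1)] by (auto simp: S_def)
      have "(wshift k (y k + inverse (y k)) ^^ N) (g u) = 0" if k: "k \<in> {1..n}" for k
        using wshift_commute[OF g(1) g(2)[OF k] g(3)[OF k] k uU(1), where c = "y k + inverse (y k)" and N = N] u k lin_onD(6)[OF g(1)]
        by (simp add: S_def)
      moreover have "X k (g u) = scl (x k) (g u)" if k: "k \<in> {1..m}" for k
        using g(2)[OF mn[OF k] uU(1), symmetric] u k lin_onD(3)[OF g(1) uU(1)] by (simp add: S_def)
      ultimately show ?thesis using uU by (simp add: S_def)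
    qed
    have X: "X (Suc m) u \<in> S" and Y: "Y (Suc m) u \<in> S" if "u \<in> S" for u
      using that closed[OF X_lin[OF Sm] X_comm[OF Sm] X_Y_comm[OF Sm]]
        closed[OF Y_lin[OF Sm] X_Y_comm[OF _ Sm, symmetric] Y_comm[OF Sm]] by blast+
    have vS: "v \<in> S" using v x by (auto simp: S_def)
    have SU: "S \<subseteq> U" by (auto simp: S_def)
    from ex_eigenvector[OF sub SU X Y Sm vS v(2) v(3)[OF Sm] y]
    obtain u x' where u: "u \<in> S" "u \<noteq> 0" and x': "x' \<noteq> 0" "x' + inverse x' = y (Suc m) + inverse (y (Suc m))"
        "X (Suc m) u = scl x' u" by blast
    show ?case
    proof (intro exI[of _ "x(Suc m := x')"] exI[of _ u] conjI ballI)
      show "u \<in> U" "u \<noteq> 0" using u SU by auto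
      fix k
      show "(wshift k (y k + inverse (y k)) ^^ N) u = 0" if "k \<in> {1..n}" using that u by (simp add: S_def)
      assume k: "k \<in> {1..Suc m}"
      show "(x(Suc m := x')) k \<noteq> 0" "X k u = scl ((x(Suc m := x')) k) u"
        "(x(Suc m := x')) k + inverse ((x(Suc m := x')) k) = y k + inverse (y k)"
        using k x' x[of k] u(1) by (cases "k = Suc m"; auto simp: S_def)+
    qed
  qed
  from this[OF le_refl] show ?thesis unfolding eig_def by blast
qed

end

locale quantum_supermod = quantum q h + supermod n q V act
  for q :: "'a::alg_closed_field" and h n V act
begin

lemma cs_module:
  assumes "completely_splittable n q V act"
  shows "cs_module (total V) n (\<lambda>i. A (fC i)) q (\<lambda>i. A (fT i)) (\<lambda>i. A (fX i)) (\<lambda>i. A (fXinv i)) h"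
proof -
  interpret H: hc_module "total V" n "\<lambda>i. A (fC i)" q "\<lambda>i. A (fT i)" "\<lambda>i. A (fX i)" "\<lambda>i. A (fXinv i)"
    by (rule hc_module)
  show ?thesis
  proof
    fix j v c assume j: "j \<in> {1..n}" and v: "v \<in> total V"
      and 0: "A (fX j) (A (fX j) v - scl c v) - scl c (A (fX j) v - scl c v) = 0"
    have "semisimple_on (total V) (A (fX j))" using assms j by (simp add: completely_splittable_def)
    from ss[OF this H.X_lin[OF j] v 0] show "A (fX j) v = scl c v" .
  qed
qed

lemma X_plus_Xinv_wshift:
  assumes "hc_module (total V) n (\<lambda>i. A (fC i)) q (\<lambda>i. A (fT i)) (\<lambda>i. A (fX i)) (\<lambda>i. A (fXinv i))"
  shows "(\<lambda>v. X_plus_Xinv n q act k v - scl c v) = hc_module.wshift (\<lambda>i. A (fX i)) (\<lambda>i. A (fXinv i)) k c"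
  by (simp add: fun_eq_iff X_plus_Xinv_def hc_module.wshift_def[OF assms])

lemma eigen_weight_if_weight:
  assumes "completely_splittable n q V act" "is_weight n q h V act i"
  shows "cs_module.eigen_weight (total V) n q (\<lambda>i. A (fX i)) h i"
proof -
  interpret H: cs_module "total V" n "\<lambda>i. A (fC i)" q "\<lambda>i. A (fT i)" "\<lambda>i. A (fX i)" "\<lambda>i. A (fXinv i)" h
    by (rule cs_module[OF assms(1)])
  have i: "i \<in> {1..n} \<rightarrow>\<^sub>E index_set h" and ne: "weight_space n q V act i \<noteq> {0}"
    using assms(2) by (auto simp: is_weight_def)
  note wshift = X_plus_Xinv_wshift[OF H.hc_module_axioms]
  have ws: "z \<in> weight_space n q V act i \<longleftrightarrow> z \<in> total V \<and> (\<forall>\<^sub>F N in sequentially. \<forall>k \<in> {1..n}. (H.wshift k (qval q (i k)) ^^ N) z = 0)" for z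
    by (simp add: weight_space_def wshift)
  have "0 \<in> weight_space n q V act i"
    unfolding ws by (simp add: H.lin_onD(6)[OF H.wshift_power_lin])
  then obtain z where z: "z \<in> weight_space n q V act i" "z \<noteq> 0" using ne by blast
  then obtain N where N: "z \<in> total V" "\<And>k. k \<in> {1..n} \<Longrightarrow> (H.wshift k (qval q (i k)) ^^ N) z = 0"
    unfolding ws eventually_sequentially by blast
  have "\<forall>k. \<exists>y. y \<noteq> 0 \<and> y + inverse y = qval q (i k)" using qval_root by blast
  then obtain y where y: "\<And>k. y k \<noteq> 0" "\<And>k. y k + inverse (y k) = qval q (i k)" by metis
  from H.joint_eigenvector[where z = z and y = y and N = N] have "\<exists>x v. H.eig x v \<and> v \<noteq> 0 \<and> (\<forall>k\<in>{1..n}. x k + inverse (x k) = qval q (i k))"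
    using N z(2) y by simp
  then show ?thesis using i by (simp add: H.eigen_weight_def)
qed

lemma weight_if_eigen_weight:
  assumes "cs_module (total V) n (\<lambda>i. A (fC i)) q (\<lambda>i. A (fT i)) (\<lambda>i. A (fX i)) (\<lambda>i. A (fXinv i)) h"
    and "cs_module.eigen_weight (total V) n q (\<lambda>i. A (fX i)) h i"
  shows "is_weight n q h V act i"
proof -
  interpret H: cs_module "total V" n "\<lambda>i. A (fC i)" q "\<lambda>i. A (fT i)" "\<lambda>i. A (fX i)" "\<lambda>i. A (fXinv i)" h
    by (rule assms(1))
  obtain x v where v: "H.eig x v" "v \<noteq> 0" and x: "\<And>j. j \<in> {1..n} \<Longrightarrow> x j + inverse (x j) = qval q (i j)"
    and i: "i \<in> {1..n} \<rightarrow>\<^sub>E index_set h"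
    using assms(2) unfolding H.eigen_weight_def by blast
  note wshift = X_plus_Xinv_wshift[OF H.hc_module_axioms]
  have "(H.wshift k (qval q (i k)) ^^ N) v = 0" if k: "k \<in> {1..n}" and N: "1 \<le> N" for k N
  proof -
    have "H.wshift k (qval q (i k)) v = 0"
      unfolding H.wshift_def H.eigD(2)[OF v(1) k] H.eig_Y[OF v(1) k] x[OF k, symmetric]
      by (simp add: vsp.scale_left_distrib)
    moreover obtain N' where "N = Suc N'" using N by (cases N) auto
    ultimately show ?thesis using H.lin_onD(6)[OF H.wshift_power_lin[OF k]] by (simp add: funpow_swap1)
  qed
  then have "v \<in> weight_space n q V act i"
    unfolding weight_space_def mem_Collect_eq wshift
    using H.eigD(1)[OF v(1)] by (intro conjI eventually_sequentiallyI[of 1]) auto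
  then show ?thesis using v(2) i by (auto simp: is_weight_def)
qed

end

section \<open>Graded submodules and the existence of irreducible ones\<close>

context supermod
begin

lemma graded_submodule_supermodule:
  assumes W: "graded_submodule n q V act W"
  shows "supermodule n q (\<lambda>a. W \<inter> V a) act" "total (\<lambda>a. W \<inter> V a) = W"
proof -
  have sW: "vsp.subspace W" "W \<subseteq> U" and dec: "W = ssum (W \<inter> V 0) (W \<inter> V 1)"
    and cl: "\<And>h w. h \<in> carrier (Haff n q) \<Longrightarrow> w \<in> W \<Longrightarrow> act h w \<in> W"
    using W by (auto simp: graded_submodule_def)
  show tot: "total (\<lambda>a. W \<inter> V a) = W" unfolding total_def using dec by simp
  have part: "h \<in> carrier (Haff n q)" if "h \<in> Haff_part n q b" for h b
    using that by (auto simp: Haff_part_def carrier_Haff)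
  have inU: "w \<in> U" if "w \<in> W" for w using that sW(2) by blast
  show "supermodule n q (\<lambda>a. W \<inter> V a) act"
    unfolding supermodule_def tot
  proof (intro conjI allI ballI)
    show "vsp.subspace (W \<inter> V a)" for a by (rule vsp.subspace_inter[OF sW(1) sub])
    show "W \<inter> V 0 \<inter> (W \<inter> V 1) = {0}"
    proof -
      have "V 0 \<inter> V 1 = {0}" using sm by (simp add: supermodule_def)
      moreover have "0 \<in> W" using vsp.subspace_0[OF sW(1)] .
      ultimately show ?thesis by blast
    qed
    show "act h v \<in> W \<inter> V (b + a)" if "h \<in> Haff_part n q b" "v \<in> W \<inter> V a" for a b h v
      using that cl[OF part] graded by blast
  next
    fix h v w assume "h \<in> carrier (Haff n q)" "v \<in> W" "w \<in> W"
    then show "act h (v + w) = act h v + act h w"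
      using sm inU unfolding supermodule_def by blast
  next
    fix g h v assume "g \<in> carrier (Haff n q)" "h \<in> carrier (Haff n q)" "v \<in> W"
    then show "act (g \<oplus>\<^bsub>Haff n q\<^esub> h) v = act g v + act h v" "act (g \<otimes>\<^bsub>Haff n q\<^esub> h) v = act g (act h v)"
      using sm inU unfolding supermodule_def by blast+
  next
    fix v assume "v \<in> W"
    then show "act \<one>\<^bsub>Haff n q\<^esub> v = v" "act (cls n q (scal c)) v = scl c v" for c
      using sm inU unfolding supermodule_def by blast+
  qed
qed

lemma graded_submodule_trans:
  assumes W: "graded_submodule n q V act W" and W': "graded_submodule n q (\<lambda>a. W \<inter> V a) act W'"
  shows "graded_submodule n q V act W'" "W' \<subseteq> W"
proof -
  have "W' \<subseteq> total (\<lambda>a. W \<inter> V a)" using W' by (simp add: graded_submodule_def)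
  then show sub: "W' \<subseteq> W" unfolding graded_submodule_supermodule(2)[OF W] .
  have "W' \<inter> (W \<inter> V a) = W' \<inter> V a" for a using sub by blast
  moreover have "W' \<subseteq> U" using sub W unfolding graded_submodule_def by blast
  ultimately show "graded_submodule n q V act W'"
    using W' unfolding graded_submodule_def by simp
qed

text \<open>The ambient space has infinite dimension, so strict growth of the dimension is derived
  from a finite spanning set.\<close>

lemma subspace_dim_less:
  assumes "vsp.subspace W'" "W' \<subset> W" "W \<subseteq> vsp.span S" "finite S"
  shows "vsp.dim W' < vsp.dim W"
proof -
  obtain B where B: "B \<subseteq> W" "vsp.independent B" "W \<subseteq> vsp.span B" "card B = vsp.dim W"
    using vsp.basis_exists[of W] by blast
  obtain B' where B': "B' \<subseteq> W'" "vsp.independent B'" "W' \<subseteq> vsp.span B'" "card B' = vsp.dim W'"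
    using vsp.basis_exists[of W'] by blast
  have finB: "finite B"
    using vsp.independent_span_bound[OF assms(4) B(2)] B(1) assms(3) by blast
  obtain w where w: "w \<in> W" "w \<notin> W'" using assms(2) by blast
  have "vsp.span B' = W'" using B' assms(1) vsp.span_minimal by blast
  then have ind: "vsp.independent (insert w B')" using vsp.independent_insertI[OF _ B'(2)] w(2) by simp
  have "insert w B' \<subseteq> vsp.span B" using w(1) B'(1) assms(2) B(3) by blast
  from vsp.independent_span_bound[OF finB ind this]
  have "finite (insert w B')" "card (insert w B') \<le> card B" by simp_all
  moreover have "w \<notin> B'" using w(2) B'(1) by blast
  ultimately show ?thesis using B(4) B'(4) by simp
qed

text \<open>A nonzero graded submodule of least dimension has no proper nonzero graded
  submodule.\<close>

lemma exists_irreducible: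
  assumes "finite S" "vsp.span S = U" "U \<noteq> {0}"
  shows "\<exists>W. graded_submodule n q V act W \<and> W \<noteq> {0} \<and> irreducible_module n q (\<lambda>a. W \<inter> V a) act"
proof -
  let ?P = "\<lambda>W. graded_submodule n q V act W \<and> W \<noteq> {0}"
  have "?P U"
  proof -
    have V_U: "V a \<subseteq> U" for a by (rule part_subset_total[OF sub])
    then have "U \<inter> V a = V a" for a by blast
    moreover have "act h w \<in> U" if h: "h \<in> carrier (Haff n q)" and w: "w \<in> U" for h w
    proof -
      obtain p where p: "p \<in> carrier (free_alg n)" "h = cls n q p" using h by (auto simp: carrier_Haff)
      \<comment> \<open>Only homogeneous elements are known to map V 0 and V 1 into graded parts, so
        p is split into its even and its odd words.\<close>
      define p0 p1 where "p0 = Abs_poly_mapping (\<lambda>w. if word_parity w = 0 then Poly_Mapping.lookup p w else 0)"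
        and "p1 = Abs_poly_mapping (\<lambda>w. if word_parity w = 0 then 0 else Poly_Mapping.lookup p w)"
      have fin: "finite {w. (if word_parity w = 0 then Poly_Mapping.lookup p w else 0) \<noteq> 0}"
        "finite {w. (if word_parity w = 0 then 0 else Poly_Mapping.lookup p w) \<noteq> 0}"
        by (rule finite_subset[OF _ finite_keys[of p]], auto simp: in_keys_iff)+
      have l: "Poly_Mapping.lookup p0 = (\<lambda>w. if word_parity w = 0 then Poly_Mapping.lookup p w else 0)"
        "Poly_Mapping.lookup p1 = (\<lambda>w. if word_parity w = 0 then 0 else Poly_Mapping.lookup p w)"
        unfolding p0_def p1_def using fin by (simp_all add: Abs_poly_mapping_inverse)
      have p01: "p = p0 + p1" by (rule poly_mapping_eqI) (simp add: lookup_add l)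
      have c: "p0 \<in> carrier (free_alg n)" "p1 \<in> carrier (free_alg n)"
        using p(1) by (auto simp: free_alg_carrier_iff in_keys_iff l split: if_splits)
      have "cls n q p0 \<in> Haff_part n q 0" "cls n q p1 \<in> Haff_part n q 1"
        unfolding Haff_part_def using c
        by (auto intro!: imageI simp: in_keys_iff l split: if_splits)
      moreover obtain v0 v1 where v: "w = v0 + v1" "v0 \<in> V 0" "v1 \<in> V 1"
        using w unfolding total_def ssum_def by blast
      ultimately have in_V: "A p0 v0 \<in> U" "A p0 v1 \<in> U" "A p1 v0 \<in> U" "A p1 v1 \<in> U"
        using graded V_U by blast+
      have vU: "v0 \<in> U" "v1 \<in> U" using v V_U by blast+
      have "A p w = (A p0 v0 + A p0 v1) + (A p1 v0 + A p1 v1)"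
        unfolding p01 using A_ring(1)[OF c w] A_plus[OF c(1) vU] A_plus[OF c(2) vU] v(1) by simp
      then show ?thesis unfolding p(2)
        using in_V vsp.subspace_add[OF subspace_total[OF sub]] by simp
    qed
    ultimately show ?thesis
      using assms(3) subspace_total[OF sub] by (simp add: graded_submodule_def total_def)
  qed
  then obtain W where W: "?P W" and min: "\<And>W'. ?P W' \<Longrightarrow> vsp.dim W \<le> vsp.dim W'"
    using ex_has_least_nat[of ?P U vsp.dim] by blast
  have "irreducible_module n q (\<lambda>a. W \<inter> V a) act"
    unfolding irreducible_module_def graded_submodule_supermodule(2)[OF conjunct1[OF W]]
  proof (intro conjI allI impI)
    show "supermodule n q (\<lambda>a. W \<inter> V a) act" using graded_submodule_supermodule(1) W by blast
    show "W \<noteq> {0}" using W by blast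
    fix W' assume "graded_submodule n q (\<lambda>a. W \<inter> V a) act W'"
    from graded_submodule_trans[OF conjunct1[OF W] this]
    have W': "graded_submodule n q V act W'" "W' \<subseteq> W" .
    show "W' = {0} \<or> W' = W"
    proof (rule ccontr)
      assume "\<not> ?thesis"
      then have "?P W'" "W' \<subset> W" using W' by auto
      moreover have "vsp.subspace W'" "W \<subseteq> vsp.span S"
        using W' W assms(2) by (auto simp: graded_submodule_def)
      ultimately have "vsp.dim W' < vsp.dim W" using subspace_dim_less assms(1) by blast
      then show False using min[OF \<open>?P W'\<close>] by simp
    qed
  qed
  then show ?thesis using W by blast
qed

end

section \<open>Semisimplicity of restrictions and of diagonal operators\<close>

lemma finite_span_subspace:
  assumes "vsp.subspace W" "W \<subseteq> vsp.span S" "finite S"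
  shows "\<exists>A. finite A \<and> vsp.span A = W"
proof -
  obtain A where A: "A \<subseteq> W" "vsp.independent A" "W \<subseteq> vsp.span A" "card A = vsp.dim W"
    using vsp.basis_exists[of W] by blast
  have "A \<subseteq> vsp.span S" using A(1) assms(2) by (rule subset_trans)
  from vsp.independent_span_bound[OF assms(3) A(2) this] have "finite A" by (rule conjunct1)
  moreover have "vsp.span A = W" using vsp.span_minimal[OF A(1) assms(1)] A(3) by (rule subset_antisym)
  ultimately show ?thesis by (intro exI conjI)
qed

text \<open>A complement of W0 in U, intersected with W, is a complement in W, by the modular
  law.\<close>

lemma semisimple_on_subspace:
  assumes "semisimple_on U f" "vsp.subspace W" "W \<subseteq> U" "f ` W \<subseteq> W"
  shows "semisimple_on W f"
  unfolding semisimple_on_def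
proof (intro allI impI)
  fix W0 assume W0: "vsp.subspace W0 \<and> W0 \<subseteq> W \<and> f ` W0 \<subseteq> W0"
  then have "vsp.subspace W0 \<and> W0 \<subseteq> U \<and> f ` W0 \<subseteq> W0" using assms(3) by blast
  then obtain W' where W': "vsp.subspace W'" "W' \<subseteq> U" "f ` W' \<subseteq> W'" "W0 \<inter> W' = {0}" "ssum W0 W' = U"
    using assms(1) unfolding semisimple_on_def by meson
  show "\<exists>W'. vsp.subspace W' \<and> W' \<subseteq> W \<and> f ` W' \<subseteq> W' \<and> W0 \<inter> W' = {0} \<and> ssum W0 W' = W"
  proof (intro exI[of _ "W' \<inter> W"] conjI)
    show "vsp.subspace (W' \<inter> W)" by (rule vsp.subspace_inter[OF W'(1) assms(2)])
    show "f ` (W' \<inter> W) \<subseteq> W' \<inter> W" using W'(3) assms(4) by blast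
    show "W0 \<inter> (W' \<inter> W) = {0}" using W'(4) W0 by blast
    show "ssum W0 (W' \<inter> W) = W"
    proof
      show "ssum W0 (W' \<inter> W) \<subseteq> W"
        unfolding ssum_def using W0 vsp.subspace_add[OF assms(2)] by blast
      show "W \<subseteq> ssum W0 (W' \<inter> W)"
      proof
        fix w assume w: "w \<in> W"
        then have "w \<in> ssum W0 W'" using assms(3) W'(5) by blast
        then obtain a b where ab: "w = a + b" "a \<in> W0" "b \<in> W'" unfolding ssum_def by blast
        have "b = w - a" using ab(1) by simp
        then have "b \<in> W" using vsp.subspace_diff[OF assms(2) w] ab(2) W0 by blast
        then show "w \<in> ssum W0 (W' \<inter> W)" unfolding ssum_def using ab by blast
      qed
    qed
  qed simp
qed

context labelled
begin

lemma lookup_ext_diagonal: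
  assumes "b \<in> B"
  shows "Poly_Mapping.lookup (ext (\<lambda>b. scl (c b) (e b)) v) (enc b) = c b * Poly_Mapping.lookup v (enc b)"
  unfolding ext_def lookup_sum
  by (subst sum.remove[OF finB assms]) (use assms in \<open>auto simp: lookup_e intro!: sum.neutral\<close>)

lemma space_span: "space = vsp.span (e ` B)"
proof
  show "space \<subseteq> vsp.span (e ` B)"
  proof
    fix v assume "v \<in> space"
    then show "v \<in> vsp.span (e ` B)"
      by (subst space_expand, assumption)
        (rule vsp.span_sum, rule vsp.span_scale, rule vsp.span_base, rule imageI)
  qed
  show "vsp.span (e ` B) \<subseteq> space"
    by (rule vsp.span_minimal) (use e_space subspace_space in auto)
qed

text \<open>The complement is spanned by basis vectors and is therefore invariant. A largest set of
  labels whose span meets W trivially suffices: adding any further label creates an intersection,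
  which puts that basis vector into the sum.\<close>

lemma semisimple_on_diagonal:
  assumes lin: "lin_on space f" and diag: "\<And>b. b \<in> B \<Longrightarrow> \<exists>c. f (e b) = scl c (e b)"
  shows "semisimple_on space f"
  unfolding semisimple_on_def
proof (intro allI impI)
  fix W assume W: "vsp.subspace W \<and> W \<subseteq> space \<and> f ` W \<subseteq> W"
  let ?Q = "\<lambda>B'. B' \<subseteq> B \<and> W \<inter> vsp.span (e ` B') = {0}"
  have Q0: "?Q {}" using vsp.subspace_0 W by auto
  have "\<forall>y. ?Q y \<longrightarrow> card y < Suc (card B)" using card_mono[OF finB] by (simp add: less_Suc_eq_le)
  from ex_has_greatest_nat[of ?Q "{}" card, OF Q0 this]
  obtain B' where B'_max: "?Q B' \<and> (\<forall>y. ?Q y \<longrightarrow> card y \<le> card B')" by (elim exE)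
  then have B': "?Q B'" by (rule conjunct1)
  have max: "card B'' \<le> card B'" if "?Q B''" for B''
    using conjunct2[OF B'_max, THEN spec, THEN mp, OF that] .
  define W' where "W' = vsp.span (e ` B')"
  have subW': "vsp.subspace W'" by (simp add: W'_def)
  have W'_space: "W' \<subseteq> space" unfolding W'_def space_span by (rule vsp.span_mono) (use B' in auto)
  have sums: "vsp.subspace (ssum W W')" unfolding ssum_def by (rule vsp.subspace_sums) (use W subW' in auto)
  have eb: "e b \<in> ssum W W'" if b: "b \<in> B" for b
  proof (cases "b \<in> B'")
    case True
    then have "e b \<in> W'" unfolding W'_def by (intro vsp.span_base) auto
    moreover have "0 \<in> W" "e b = 0 + e b" using W vsp.subspace_0 by auto
    ultimately show ?thesis unfolding ssum_def by blast
  next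
    case False
    have "\<not> ?Q (insert b B')"
    proof
      assume "?Q (insert b B')"
      from max[OF this] show False using False finite_subset[OF _ finB] B' by simp
    qed
    then have "W \<inter> vsp.span (insert (e b) (e ` B')) \<noteq> {0}" using B' b by simp
    moreover have "0 \<in> W \<inter> vsp.span (insert (e b) (e ` B'))" using W vsp.subspace_0 vsp.span_zero by blast
    ultimately obtain w where w: "w \<in> W" "w \<in> vsp.span (insert (e b) (e ` B'))" "w \<noteq> 0" by blast
    obtain k where k: "w - scl k (e b) \<in> W'" using w(2) vsp.span_breakdown_eq unfolding W'_def by blast
    have "k \<noteq> 0"
    proof
      assume "k = 0"
      then have "w \<in> W \<inter> vsp.span (e ` B')" using k w(1) by (simp add: W'_def)
      then show False using B' w(3) by blast
    qed
    then have "e b = scl (inverse k) w + scl (- inverse k) (w - scl k (e b))"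
      by (simp add: scl_simps)
    moreover have "scl (inverse k) w \<in> W" using W w(1) vsp.subspace_scale by blast
    moreover have "scl (- inverse k) (w - scl k (e b)) \<in> W'" using k subW' vsp.subspace_scale by blast
    ultimately show ?thesis unfolding ssum_def by blast
  qed
  show "\<exists>W'. vsp.subspace W' \<and> W' \<subseteq> space \<and> f ` W' \<subseteq> W' \<and> W \<inter> W' = {0} \<and> ssum W W' = space"
  proof (intro exI[of _ W'] conjI)
    show "W \<inter> W' = {0}" using B' by (simp add: W'_def)
    show "f ` W' \<subseteq> W'"
    proof
      fix y assume "y \<in> f ` W'"
      then obtain v where v: "v \<in> W'" "y = f v" by blast
      have "v \<in> W' \<and> f v \<in> W'"
        using v(1)[unfolded W'_def]
      proof (induction rule: vsp.span_induct_alt)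
        case base
        have "f 0 = 0" using lin vsp.subspace_0[OF subspace_space] unfolding lin_on_def
          by (metis vsp.scale_zero_left)
        then show ?case using vsp.subspace_0[OF subW'] by simp
      next
        case (step c x v)
        then obtain b where b: "x = e b" "b \<in> B'" by blast
        then have bB: "b \<in> B" using B' by blast
        obtain d where d: "f (e b) = scl d (e b)" using diag[OF bB] by blast
        have eW: "e b \<in> W'" unfolding W'_def using b(2) by (intro vsp.span_base) auto
        have "f (scl c (e b) + v) = scl c (f (e b)) + f v"
          using lin e_space[OF bB] step(2) W'_space vsp.subspace_scale[OF subspace_space] unfolding lin_on_def
          by (metis subsetD)
        then show ?case unfolding b(1) d
          using step(2) eW by (simp add: vsp.subspace_add[OF subW'] vsp.subspace_scale[OF subW'])
      qed
      then show "y \<in> W'" using v(2) by simp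
    qed
    show "ssum W W' = space"
    proof
      show "ssum W W' \<subseteq> space"
        unfolding ssum_def using W W'_space vsp.subspace_add[OF subspace_space] by blast
      show "space \<subseteq> ssum W W'"
        unfolding space_span by (rule vsp.span_minimal[OF _ sums]) (use eb in auto)
    qed
  qed (use subW' W'_space in auto)
qed

text \<open>A nonzero vector w of W with smallest support works: subtracting from
  \<open>F k w\<close> the multiple of w that matches at one coordinate b shrinks the support, so
  the difference must vanish.\<close>

lemma joint_eigenvector_in_subspace:
  assumes W: "vsp.subspace W" "W \<subseteq> space" "W \<noteq> {0}"
    and F: "\<And>k w. k \<in> K \<Longrightarrow> w \<in> W \<Longrightarrow> F k w \<in> W"
    and diag: "\<And>k w b. k \<in> K \<Longrightarrow> w \<in> space \<Longrightarrow> b \<in> B \<Longrightarrow>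
      Poly_Mapping.lookup (F k w) (enc b) = x b k * Poly_Mapping.lookup w (enc b)"
  shows "\<exists>w\<in>W. w \<noteq> 0 \<and> (\<exists>b\<in>B. \<forall>k\<in>K. F k w = scl (x b k) w)"
proof -
  let ?s = "\<lambda>w. card (Poly_Mapping.keys w)"
  obtain w0 where "w0 \<in> W \<and> w0 \<noteq> 0" using W(3) vsp.subspace_0[OF W(1)] by blast
  from ex_has_least_nat[of "\<lambda>w. w \<in> W \<and> w \<noteq> 0" w0 ?s, OF this]
  obtain w where w: "w \<in> W" "w \<noteq> 0" and min: "\<And>w'. w' \<in> W \<Longrightarrow> w' \<noteq> 0 \<Longrightarrow> ?s w \<le> ?s w'" by blast
  have ws: "w \<in> space" using w W(2) by blast
  obtain m where m: "m \<in> Poly_Mapping.keys w" using w(2) by (metis all_not_in_conv keys_eq_empty)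
  then obtain b where b: "b \<in> B" "m = enc b" using ws by (auto simp: space_def)
  have "F k w = scl (x b k) w" if k: "k \<in> K" for k
  proof (rule ccontr)
    assume ne: "F k w \<noteq> scl (x b k) w"
    define u where "u = F k w - scl (x b k) w"
    have uW: "u \<in> W" unfolding u_def
      using F[OF k w(1)] w(1) vsp.subspace_diff[OF W(1)] vsp.subspace_scale[OF W(1)] by blast
    have "Poly_Mapping.keys u \<subseteq> Poly_Mapping.keys w - {m}"
    proof
      fix l assume l: "l \<in> Poly_Mapping.keys u"
      then obtain b' where b': "b' \<in> B" "l = enc b'" using uW W(2) by (auto simp: space_def)
      have "Poly_Mapping.lookup u l = (x b' k - x b k) * Poly_Mapping.lookup w l"
        unfolding u_def b'(2) using diag[OF k ws b'(1)] by (simp add: lookup_minus algebra_simps)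
      then show "l \<in> Poly_Mapping.keys w - {m}"
        using l b b' inj by (auto simp: in_keys_iff inj_on_def)
    qed
    then have "?s u < ?s w" using m by (metis card_Diff1_less card_mono finite_Diff finite_keys le_less_trans)
    moreover have "u \<noteq> 0" using ne by (simp add: u_def)
    ultimately show False using min[OF uW] by simp
  qed
  then show ?thesis using w b(1) by blast
qed

end

section \<open>Extension of an action of the generators to the free algebra\<close>

locale generator_action =
  fixes opg :: "gen \<Rightarrow> 'a::field vec \<Rightarrow> 'a vec"
  assumes opg_add: "opg g (v + w) = opg g v + opg g w" and opg_scl: "opg g (scl c v) = scl c (opg g v)"
begin

definition wop :: "gword \<Rightarrow> 'a vec \<Rightarrow> 'a vec" where "wop w v = foldr opg (letters w) v"

definition rho :: "'a free \<Rightarrow> 'a vec \<Rightarrow> 'a vec" where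
  "rho p v = (\<Sum>w\<in>Poly_Mapping.keys p. scl (Poly_Mapping.lookup p w) (wop w v))"

lemma wop_add: "wop w (u + v) = wop w u + wop w v"
proof -
  have "foldr opg gs (u + v) = foldr opg gs u + foldr opg gs v" for gs
    by (induction gs) (simp_all add: opg_add)
  then show ?thesis by (simp add: wop_def)
qed

lemma wop_scl: "wop w (scl c v) = scl c (wop w v)"
proof -
  have "foldr opg gs (scl c v) = scl c (foldr opg gs v)" for gs
    by (induction gs) (simp_all add: opg_scl)
  then show ?thesis by (simp add: wop_def)
qed

lemma wop_plus: "wop (u + w) v = wop u (wop w v)"
  by (simp add: wop_def)

lemma wop_sum: "wop w (\<Sum>a\<in>A. f a) = (\<Sum>a\<in>A. wop w (f a))"
proof (induction A rule: infinite_finite_induct)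
  have "wop w 0 = 0" using wop_scl[of w 0 0] by simp
  then show "wop w (\<Sum>a\<in>{}. f a) = (\<Sum>a\<in>{}. wop w (f a))" by simp
  then show "wop w (\<Sum>a\<in>A. f a) = (\<Sum>a\<in>A. wop w (f a))" if "infinite A" for A using that by simp
qed (simp add: wop_add)

lemma rho_superset:
  assumes "finite A" "Poly_Mapping.keys p \<subseteq> A"
  shows "rho p v = (\<Sum>w\<in>A. scl (Poly_Mapping.lookup p w) (wop w v))"
  unfolding rho_def by (rule sum.mono_neutral_left) (use assms in \<open>auto simp: in_keys_iff\<close>)

lemma rho_plus: "rho (p + r) v = rho p v + rho r v"
proof -
  let ?A = "Poly_Mapping.keys p \<union> Poly_Mapping.keys r"
  have A: "finite ?A" "Poly_Mapping.keys p \<subseteq> ?A" "Poly_Mapping.keys r \<subseteq> ?A" "Poly_Mapping.keys (p + r) \<subseteq> ?A"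
    using Poly_Mapping.keys_add[of p r] by auto
  show ?thesis
    unfolding rho_superset[OF A(1,2)] rho_superset[OF A(1,3)] rho_superset[OF A(1,4)]
    by (simp add: lookup_add vsp.scale_left_distrib sum.distrib)
qed

lemma rho_single: "rho (Poly_Mapping.single w c) v = scl c (wop w v)"
  by (cases "c = 0") (simp_all add: rho_def)

lemma rho_sum: "rho (\<Sum>a\<in>A. f a) v = (\<Sum>a\<in>A. rho (f a) v)"
  by (induction A rule: infinite_finite_induct) (simp_all add: rho_plus, simp_all add: rho_def)

lemma poly_mapping_sum_single:
  "p = (\<Sum>w\<in>Poly_Mapping.keys p. Poly_Mapping.single w (Poly_Mapping.lookup p w))"
proof (rule poly_mapping_eqI)
  fix k
  show "Poly_Mapping.lookup p k =
    Poly_Mapping.lookup (\<Sum>w\<in>Poly_Mapping.keys p. Poly_Mapping.single w (Poly_Mapping.lookup p w)) k"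
    by (simp add: lookup_sum lookup_single when_def in_keys_iff)
qed

lemma rho_times: "rho (p * r) v = rho p (rho r v)"
proof -
  have "p * r = (\<Sum>u\<in>Poly_Mapping.keys p. \<Sum>w\<in>Poly_Mapping.keys r.
      Poly_Mapping.single (u + w) (Poly_Mapping.lookup p u * Poly_Mapping.lookup r w))"
  proof -
    have "p * r = (\<Sum>u\<in>Poly_Mapping.keys p. Poly_Mapping.single u (Poly_Mapping.lookup p u)) *
        (\<Sum>w\<in>Poly_Mapping.keys r. Poly_Mapping.single w (Poly_Mapping.lookup r w))"
      by (rule arg_cong2[where f = "(*)"]) (rule poly_mapping_sum_single)+
    then show ?thesis by (simp only: sum_product mult_single)
  qed
  then have "rho (p * r) v = (\<Sum>u\<in>Poly_Mapping.keys p. \<Sum>w\<in>Poly_Mapping.keys r.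
      scl (Poly_Mapping.lookup p u * Poly_Mapping.lookup r w) (wop u (wop w v)))"
    by (simp only: rho_sum rho_single wop_plus)
  also have "\<dots> = rho p (rho r v)"
    by (simp only: rho_def wop_sum wop_scl vsp.scale_sum_right vsp.scale_scale)
  finally show ?thesis .
qed

lemma rho_mon: "rho (mon g) v = opg g v"
  by (simp add: rho_single wop_def)

lemma rho_scal: "rho (scal c) v = scl c v"
  by (simp add: scal_def rho_single wop_def)

lemma rho_one: "rho 1 v = v"
  using rho_scal[of 1 v] by (simp add: scal_def)

lemma rho_uminus: "rho (- p) v = - rho p v"
proof -
  have "rho (- p) v + rho p v = 0" using rho_plus[of "- p" p v] by (simp add: rho_def)
  then show ?thesis by (simp add: eq_neg_iff_add_eq_0)
qed

lemma rho_minus: "rho (p - r) v = rho p v - rho r v"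
  using rho_plus[of p "- r" v] by (simp add: rho_uminus)

lemma rho_add: "rho p (u + v) = rho p u + rho p v"
  by (simp add: rho_def wop_add scl_simps sum.distrib)

lemmas rho_simps = rho_plus rho_times rho_minus rho_uminus rho_one rho_scal rho_mon

end

section \<open>The model as a supermodule over the quotient algebra\<close>

context model
begin

fun opg :: "gen \<Rightarrow> 'a vec \<Rightarrow> 'a vec" where
  "opg (GT k) = T k" | "opg (GX k) = X k" | "opg (GXinv k) = Y k" | "opg (GC k) = C k"

sublocale generator_action opg
proof
  fix g v w c
  have "T k (v + w) = T k v + T k w" "T k (scl c v) = scl c (T k v)" for k
    by (simp_all add: T_def Aw_def D_def ext_add ext_scl scl_simps)
  moreover have "X k (v + w) = X k v + X k w" "X k (scl c v) = scl c (X k v)"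
    "Y k (v + w) = Y k v + Y k w" "Y k (scl c v) = scl c (Y k v)" for k
    by (simp_all add: X_def Y_def ext_add ext_scl)
  moreover have "C k (v + w) = C k v + C k w" "C k (scl c v) = scl c (C k v)" for k
    unfolding C_def by (rule ext_add ext_scl)+
  ultimately show "opg g (v + w) = opg g v + opg g w" "opg g (scl c v) = scl c (opg g v)"
    by (cases g; simp)+
qed

lemma opg_lin: "g \<in> gens n \<Longrightarrow> lin_on space (opg g)"
  by (cases g) (auto intro: T_lin X_lin Y_lin C_lin)

lemma wop_space:
  assumes "set (letters w) \<subseteq> gens n" "v \<in> space"
  shows "wop w v \<in> space"
proof -
  have "foldr opg gs v \<in> space" if "set gs \<subseteq> gens n" for gs
    using that
  proof (induction gs)
    case (Cons g gs)
    then have "g \<in> gens n" "foldr opg gs v \<in> space" by simp_all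
    then show ?case using lin_onD(1)[OF opg_lin] by simp
  qed (simp add: assms(2))
  then show ?thesis using assms(1) by (simp add: wop_def)
qed

lemma rho_space: "p \<in> carrier (free_alg n) \<Longrightarrow> v \<in> space \<Longrightarrow> rho p v \<in> space"
  unfolding rho_def free_alg_carrier_iff
  by (intro vsp.subspace_sum vsp.subspace_scale subspace_space wop_space) auto

lemma rho_rel:
  assumes "(l, r) \<in> hc_rel n q" "v \<in> space"
  shows "rho l v = rho r v"
proof -
  interpret H: hc_module space n C q T X Y by (rule hc_module)
  note s = rho_simps opg.simps Suc_eq_plus1[symmetric]
  show ?thesis
    using assms(1)
  proof cases
    case (T_quad i)
    then show ?thesis using H.T_quad[OF T_quad(3) assms(2)] by (simp only: s)
  next
    case (T_comm i j)
    show ?thesis using H.T_comm[OF T_comm(3,4,5) assms(2)] by (simp only: T_comm(1,2) s)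
  next
    case (T_braid i)
    show ?thesis using H.T_braid[OF T_braid(3) _ assms(2)] T_braid(4) by (simp only: T_braid(1,2) s)
  next
    case (X_comm i j)
    show ?thesis using H.X_comm[OF X_comm(3,4) assms(2)] by (simp only: X_comm(1,2) s)
  next
    case (X_inv_right i)
    show ?thesis using H.XY[OF X_inv_right(3) assms(2)] by (simp only: X_inv_right(1,2) s)
  next
    case (X_inv_left i)
    show ?thesis using H.YX[OF X_inv_left(3) assms(2)] by (simp only: X_inv_left(1,2) s)
  next
    case (C_square i)
    show ?thesis using C_sq[OF C_square(3) assms(2)] by (simp only: C_square(1,2) s)
  next
    case (C_anticomm i j)
    show ?thesis using C_anti[OF C_anticomm(3,4,5) assms(2)] by (simp only: C_anticomm(1,2) s)
  next
    case (TX_near i)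
    show ?thesis using H.TX_near[OF TX_near(3) assms(2)] by (simp only: TX_near(1,2) s)
  next
    case (TX_far i j)
    show ?thesis using H.TX_far[OF TX_far(3,4,5) _ assms(2)] TX_far(6) by (simp only: TX_far(1,2) s simp_thms)
  next
    case (TC_near i)
    show ?thesis using H.TC_near[OF TC_near(3) assms(2)] by (simp only: TC_near(1,2) s)
  next
    case (TC_next i)
    show ?thesis using H.TC_next[OF TC_next(3) assms(2)] by (simp only: TC_next(1,2) s)
  next
    case (TC_far i j)
    show ?thesis using H.TC_far[OF TC_far(3,4,5) _ assms(2)] TC_far(6) by (simp only: TC_far(1,2) s simp_thms)
  next
    case (XC_same i)
    show ?thesis using H.XC_same[OF XC_same(3) assms(2)] by (simp only: XC_same(1,2) s)
  next
    case (XC_far i j)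
    show ?thesis using H.XC_far[OF XC_far(3,4,5) assms(2)] by (simp only: XC_far(1,2) s)
  qed
qed

text \<open>The elements of the free algebra that act as zero on \<open>space\<close> form a
  two-sided ideal containing all relations, hence the ideal generated by them.\<close>

lemma rho_ideal:
  assumes "p \<in> hc_ideal n q" "v \<in> space"
  shows "rho p v = 0"
proof -
  let ?R = "free_alg n :: 'a free ring"
  define K where "K = {p \<in> carrier ?R. \<forall>v\<in>space. rho p v = 0}"
  have rho0: "rho r 0 = 0" for r
  proof -
    have "rho r 0 = rho r 0 + rho r 0" using rho_add[of r 0 0] by (simp only: add_0)
    then show ?thesis by (simp only: add_cancel_right_right)
  qed
  interpret R: ring ?R by (rule free_alg_ring)
  have neg: "inv\<^bsub>add_monoid ?R\<^esub> p = - p" if "p \<in> carrier ?R" for p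
    using R.minus_equality[of "- p" p] that by (simp add: a_inv_def)
  have "ideal K ?R"
  proof (rule idealI[OF free_alg_ring])
    show "subgroup K (add_monoid ?R)"
    proof (rule subgroup.intro)
      show "K \<subseteq> carrier (add_monoid ?R)" by (auto simp: K_def)
      show "x \<otimes>\<^bsub>add_monoid ?R\<^esub> y \<in> K" if "x \<in> K" "y \<in> K" for x y
        using that by (simp add: K_def rho_plus)
      show "\<one>\<^bsub>add_monoid ?R\<^esub> \<in> K" by (simp add: K_def rho_def)
      show "inv\<^bsub>add_monoid ?R\<^esub> x \<in> K" if "x \<in> K" for x
      proof -
        have "x \<in> carrier ?R" using that by (simp add: K_def)
        then show ?thesis using that neg by (simp add: K_def rho_uminus)
      qed
    qed
    show "x \<otimes>\<^bsub>?R\<^esub> a \<in> K" "a \<otimes>\<^bsub>?R\<^esub> x \<in> K" if "a \<in> K" "x \<in> carrier ?R" for a x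
      using that rho_space[of x] by (simp_all add: K_def rho_times rho0)
  qed
  moreover have "{l - r | l r. (l, r) \<in> hc_rel n q} \<subseteq> K"
  proof (rule subsetI)
    fix x :: "'a free" assume "x \<in> {l - r | l r. (l, r) \<in> hc_rel n q}"
    then obtain l r where x: "x = l - r" "(l, r) \<in> hc_rel n q" by blast
    then show "x \<in> K" using rho_rel[OF x(2)] hc_rel_closed[OF x(2)] by (simp add: K_def rho_minus)
  qed
  ultimately have "hc_ideal n q \<subseteq> K" unfolding hc_ideal_def by (rule R.genideal_minimal)
  then show ?thesis using assms by (auto simp: K_def)
qed

text \<open>The representative of a class is arbitrary; \<open>act_cls\<close> shows that on
  \<open>space\<close> every other one acts in the same way.\<close>

definition act :: "'a action" where
  "act A v = rho (SOME p. p \<in> carrier (free_alg n) \<and> cls n q p = A) v"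

lemma act_cls:
  assumes "p \<in> carrier (free_alg n)" "v \<in> space"
  shows "act (cls n q p) v = rho p v"
proof -
  define p' where "p' = (SOME r. r \<in> carrier (free_alg n) \<and> cls n q r = cls n q p)"
  have p': "p' \<in> carrier (free_alg n)" "cls n q p' = cls n q p"
    unfolding p'_def using someI[of "\<lambda>r. r \<in> carrier (free_alg n) \<and> cls n q r = cls n q p" p] assms(1) by auto
  then have "p' - p \<in> hc_ideal n q" using cls_eq_iff[OF p'(1) assms(1)] by simp
  then have "rho (p' - p) v = 0" using rho_ideal assms(2) by blast
  then show ?thesis unfolding act_def p'_def[symmetric] by (simp add: rho_minus)
qed

definition par :: "nat set \<Rightarrow> bit" where "par S = of_nat (card S)"

text \<open>The grading counts the Clifford factors of C_S modulo 2, with e_j even.\<close>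

definition V :: "bit \<Rightarrow> 'a vec set" where
  "V a = {v \<in> space. \<forall>j S. (j, S) \<in> B \<and> Poly_Mapping.lookup v (enc (j, S)) \<noteq> 0 \<longrightarrow> par S = a}"

lemma subspace_V: "vsp.subspace (V a)"
  unfolding vsp.subspace_def V_def
proof (intro conjI ballI allI)
  show "0 \<in> {v \<in> space. \<forall>j S. (j, S) \<in> B \<and> Poly_Mapping.lookup v (enc (j, S)) \<noteq> 0 \<longrightarrow> par S = a}" by simp
  fix v assume v: "v \<in> {v \<in> space. \<forall>j S. (j, S) \<in> B \<and> Poly_Mapping.lookup v (enc (j, S)) \<noteq> 0 \<longrightarrow> par S = a}"
  show "scl c v \<in> {v \<in> space. \<forall>j S. (j, S) \<in> B \<and> Poly_Mapping.lookup v (enc (j, S)) \<noteq> 0 \<longrightarrow> par S = a}" for c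
    using v by auto
  fix w assume w: "w \<in> {v \<in> space. \<forall>j S. (j, S) \<in> B \<and> Poly_Mapping.lookup v (enc (j, S)) \<noteq> 0 \<longrightarrow> par S = a}"
  have "par S = a" if "(j, S) \<in> B" "Poly_Mapping.lookup (v + w) (enc (j, S)) \<noteq> 0" for j S
    using v w that by (cases "Poly_Mapping.lookup v (enc (j, S)) = 0") (auto simp: lookup_add)
  then show "v + w \<in> {v \<in> space. \<forall>j S. (j, S) \<in> B \<and> Poly_Mapping.lookup v (enc (j, S)) \<noteq> 0 \<longrightarrow> par S = a}"
    using v w by auto
qed

lemma e_V: "(j, S) \<in> B \<Longrightarrow> e (j, S) \<in> V (par S)"
  by (auto simp: V_def e_space lookup_e split: if_splits)

lemma V_map:
  assumes f: "lin_on space f" and fe: "\<And>j S. (j, S) \<in> B \<Longrightarrow> f (e (j, S)) \<in> V (b + par S)" and v: "v \<in> V a"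
  shows "f v \<in> V (b + a)"
proof -
  have vs: "v \<in> space" using v by (simp add: V_def)
  have "f v = (\<Sum>x\<in>B. scl (Poly_Mapping.lookup v (enc x)) (f (e x)))"
    by (subst space_expand[OF vs]) (rule lin_sum[OF f _ finB], assumption)
  also have "\<dots> \<in> V (b + a)"
  proof (rule vsp.subspace_sum[OF subspace_V])
    fix x assume "x \<in> B"
    then obtain j S where x: "x = (j, S)" "(j, S) \<in> B" by (cases x) auto
    show "scl (Poly_Mapping.lookup v (enc x)) (f (e x)) \<in> V (b + a)"
    proof (cases "Poly_Mapping.lookup v (enc x) = 0")
      case True
      then show ?thesis using vsp.subspace_0[OF subspace_V] by simp
    next
      case False
      then have "par S = a" using v x by (auto simp: V_def)
      then show ?thesis using fe[OF x(2)] x(1) by (simp add: vsp.subspace_scale[OF subspace_V])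
    qed
  qed
  finally show ?thesis .
qed

lemma par_sdiff: "finite S \<Longrightarrow> par (sdiff S k) = 1 + par S"
proof (cases "k \<in> S")
  case True
  assume "finite S"
  then have "card S = Suc (card (S - {k}))" using True by (rule card.remove)
  then have "par S = 1 + par (S - {k})" by (simp add: par_def)
  moreover have "1 + (1 + b) = b" for b :: bit by (cases b) simp_all
  ultimately show ?thesis using True by (simp add: sdiff_def)
next
  case False
  assume "finite S"
  then show ?thesis using False by (simp add: sdiff_def par_def)
qed

lemma B_finite_set: "(j, S) \<in> B \<Longrightarrow> finite S"
  by (auto simp: B_iff intro: finite_subset)

lemma C_V: "k \<in> {1..n} \<Longrightarrow> v \<in> V a \<Longrightarrow> C k v \<in> V (1 + a)"
proof (rule V_map[OF C_lin])
  fix j S assume k: "k \<in> {1..n}" and jS: "(j, S) \<in> B"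
  show "C k (e (j, S)) \<in> V (1 + par S)"
    using e_V[OF sdiff_B[OF jS k]] by (simp add: C_e[OF jS] par_sdiff B_finite_set[OF jS] vsp.subspace_scale[OF subspace_V])
qed

lemma opg_V:
  assumes "g \<in> gens n" "v \<in> V a"
  shows "opg g v \<in> V (gen_parity g + a)"
proof (cases g)
  case (GT k)
  then have k: "k \<in> {1..<n}" "k \<in> {1..n}" "Suc k \<in> {1..n}" using assms(1) by auto
  have "T k v \<in> V (0 + a)"
  proof (rule V_map[OF T_lin[OF k(1)] _ assms(2)])
    fix j S assume jS: "(j, S) \<in> B"
    have CC: "C k (C (Suc k) (e (j, S))) \<in> V (par S)"
      using C_V[OF k(2) C_V[OF k(3) e_V[OF jS]]] by (cases "par S") simp_all
    have D: "D k (e (j, S)) \<in> V (par S)"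
      using D_label[OF jS k(1)]
    proof
      assume "cc (j k) (j (Suc k)) = 0"
      then show ?thesis using vsp.subspace_0[OF subspace_V] by (simp add: D_e[OF jS])
    next
      assume "(j \<circ> adj_swap k, adj_swap k ` S) \<in> B"
      from e_V[OF this] have "e (j \<circ> adj_swap k, adj_swap k ` S) \<in> V (par S)"
        by (simp add: par_def card_image inj_on_subset[OF inj_adj_swap])
      then show ?thesis by (simp add: D_e[OF jS] vsp.subspace_scale[OF subspace_V])
    qed
    have "T k (e (j, S)) \<in> V (par S)"
      unfolding T_P[OF P_e[OF jS] k(1)] Aop_def
      by (intro vsp.subspace_add[OF subspace_V] vsp.subspace_scale[OF subspace_V] CC D e_V[OF jS])
    then show "T k (e (j, S)) \<in> V (0 + par S)" by (simp only: add_0)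
  qed
  then show ?thesis by (simp only: GT opg.simps gen_parity.simps)
next
  case (GX k)
  have "X k v \<in> V (0 + a)"
    by (rule V_map[OF X_lin _ assms(2)])
      (simp only: XY_P(1)[OF P_e] e_V vsp.subspace_scale[OF subspace_V] add_0)
  then show ?thesis by (simp only: GX opg.simps gen_parity.simps)
next
  case (GXinv k)
  have "Y k v \<in> V (0 + a)"
    by (rule V_map[OF Y_lin _ assms(2)])
      (simp only: XY_P(2)[OF P_e] e_V vsp.subspace_scale[OF subspace_V] add_0)
  then show ?thesis by (simp only: GXinv opg.simps gen_parity.simps)
next
  case (GC k)
  then have "k \<in> {1..n}" using assms(1) by simp
  from C_V[OF this assms(2)] show ?thesis by (simp only: GC opg.simps gen_parity.simps)
qed

lemma wop_V:
  assumes "set (letters w) \<subseteq> gens n" "v \<in> V a"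
  shows "wop w v \<in> V (word_parity w + a)"
proof -
  have "foldr opg gs v \<in> V (sum_list (map gen_parity gs) + a)" if "set gs \<subseteq> gens n" for gs
    using that
  proof (induction gs)
    case Nil
    show ?case using assms(2) by (simp only: foldr.simps id_apply list.map sum_list.Nil add_0)
  next
    case (Cons g gs)
    then have "opg g (foldr opg gs v) \<in> V (gen_parity g + (sum_list (map gen_parity gs) + a))"
      by (intro opg_V) simp_all
    then show ?case by (simp only: foldr.simps comp_apply list.map sum_list.Cons add.assoc)
  qed
  from this[OF assms(1)] show ?thesis by (simp only: wop_def word_parity_def)
qed

lemma total_V: "total V = space"
proof
  have sub: "V a \<subseteq> space" for a by (auto simp: V_def)
  show "total V \<subseteq> space"
    unfolding total_def ssum_def using sub vsp.subspace_add[OF subspace_space] by blast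
  show "space \<subseteq> total V"
  proof
    fix v assume v: "v \<in> space"
    have sub: "vsp.subspace (total V)" by (rule subspace_total) (rule subspace_V)
    have V_total: "V a \<subseteq> total V" for a by (rule part_subset_total) (rule subspace_V)
    have eb: "e b \<in> total V" if "b \<in> B" for b
    proof (cases b)
      case (Pair j S)
      then have "(j, S) \<in> B" using that by simp
      from subsetD[OF V_total e_V[OF this]] show ?thesis unfolding Pair .
    qed
    show "v \<in> total V"
      by (subst space_expand[OF v], rule vsp.subspace_sum[OF sub], rule vsp.subspace_scale[OF sub], rule eb)
  qed
qed

lemma supermodule: "supermodule n q V act"
  unfolding supermodule_def total_V
proof (intro conjI allI ballI)
  show "vsp.subspace (V a)" for a by (rule subspace_V)
  show "V 0 \<inter> V 1 = {0}"
  proof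
    show "V 0 \<inter> V 1 \<subseteq> {0}"
    proof
      fix v assume v: "v \<in> V 0 \<inter> V 1"
      have "Poly_Mapping.lookup v (enc b) = 0" if "b \<in> B" for b
        using v that by (cases b) (auto simp: V_def)
      then have "v = 0" using space_expand[of v] v by (simp add: V_def)
      then show "v \<in> {0}" by simp
    qed
  qed (use vsp.subspace_0[OF subspace_V] in auto)
  show "act h v \<in> V (b + a)" if hb: "h \<in> Haff_part n q b" and vV: "v \<in> V a" for a b h v
  proof -
    obtain p where p: "h = cls n q p" "p \<in> carrier (free_alg n)" "\<forall>w \<in> Poly_Mapping.keys p. word_parity w = b"
      using hb by (auto simp: Haff_part_def)
    have "v \<in> space" using vV by (simp add: V_def)
    then have "act h v = rho p v" using act_cls p by simp
    also have "\<dots> \<in> V (b + a)"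
      unfolding rho_def
    proof (intro vsp.subspace_sum[OF subspace_V] vsp.subspace_scale[OF subspace_V])
      fix w assume w: "w \<in> Poly_Mapping.keys p"
      then have "set (letters w) \<subseteq> gens n" using p(2) by (simp add: free_alg_carrier_iff)
      from wop_V[OF this vV] show "wop w v \<in> V (b + a)" by (simp only: bspec[OF p(3) w])
    qed
    finally show ?thesis .
  qed
next
  fix h v w assume "h \<in> carrier (Haff n q)" "v \<in> space" "w \<in> space"
  then show "act h (v + w) = act h v + act h w"
    by (auto simp: carrier_Haff act_cls rho_add)
next
  fix g h v assume "g \<in> carrier (Haff n q)" "h \<in> carrier (Haff n q)" and v: "v \<in> space"
  then obtain p r where p: "g = cls n q p" "p \<in> carrier (free_alg n)" and r: "h = cls n q r" "r \<in> carrier (free_alg n)"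
    by (auto simp: carrier_Haff)
  show "act (g \<oplus>\<^bsub>Haff n q\<^esub> h) v = act g v + act h v"
    using p r v by (simp add: cls_add[symmetric] act_cls rho_plus)
  show "act (g \<otimes>\<^bsub>Haff n q\<^esub> h) v = act g (act h v)"
    using p r v by (simp add: cls_mult[symmetric] act_cls rho_times rho_space)
next
  fix v assume v: "v \<in> space"
  show "act \<one>\<^bsub>Haff n q\<^esub> v = v"
    using v by (simp add: cls_one[symmetric] act_cls rho_one)
  show "act (cls n q (scal c)) v = scl c v" for c
    using v by (simp add: act_cls rho_scal)
qed

lemma act_X: "k \<in> {1..n} \<Longrightarrow> v \<in> space \<Longrightarrow> act (cls n q (fX k)) v = X k v"
  and act_Y: "k \<in> {1..n} \<Longrightarrow> v \<in> space \<Longrightarrow> act (cls n q (fXinv k)) v = Y k v"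
  by (simp_all add: act_cls rho_mon)

lemma lookup_X: "b \<in> B \<Longrightarrow> Poly_Mapping.lookup (X k v) (enc b) = xv b k * Poly_Mapping.lookup v (enc b)"
  and lookup_Y: "b \<in> B \<Longrightarrow> Poly_Mapping.lookup (Y k v) (enc b) = inverse (xv b k) * Poly_Mapping.lookup v (enc b)"
  unfolding X_def Y_def by (rule lookup_ext_diagonal, assumption)+

lemma space_nonzero:
  assumes "v \<in> space" "v \<noteq> 0"
  shows "\<exists>b\<in>B. Poly_Mapping.lookup v (enc b) \<noteq> 0"
proof (rule ccontr)
  assume "\<not> ?thesis"
  then have "(\<Sum>b\<in>B. scl (Poly_Mapping.lookup v (enc b)) (e b)) = 0" by (intro sum.neutral) simp
  then show False using space_expand[OF assms(1)] assms(2) by simp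
qed

lemma eigenvalue_qval:
  assumes "v \<in> space" "v \<noteq> 0" "X k v + Y k v = scl c v" "k \<in> {1..n}"
  shows "c \<in> qval q ` index_set h"
proof -
  obtain b where b: "b \<in> B" "Poly_Mapping.lookup v (enc b) \<noteq> 0" using space_nonzero assms by blast
  obtain j S where jS: "b = (j, S)" by (cases b)
  have "xv b k * Poly_Mapping.lookup v (enc b) + inverse (xv b k) * Poly_Mapping.lookup v (enc b)
      = c * Poly_Mapping.lookup v (enc b)"
    using arg_cong[OF assms(3), of "\<lambda>u. Poly_Mapping.lookup u (enc b)"]
    by (simp only: lookup_add lookup_X[OF b(1)] lookup_Y[OF b(1)] lookup_scl)
  then have "(xv b k + inverse (xv b k)) * Poly_Mapping.lookup v (enc b) = c * Poly_Mapping.lookup v (enc b)"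
    by (simp only: distrib_right)
  then have "c = xv b k + inverse (xv b k)" using b(2) by simp
  then have "c = qval q (j k)" unfolding jS by (simp only: xv)
  moreover have "j k \<in> index_set h"
    using Orb_idx[of j] b(1) assms(4) by (auto simp: jS B_iff PiE_iff)
  ultimately show ?thesis by blast
qed

lemma semisimple_X: "k \<in> {1..n} \<Longrightarrow> semisimple_on space (act (cls n q (fX k)))"
  and semisimple_Y: "k \<in> {1..n} \<Longrightarrow> semisimple_on space (act (cls n q (fXinv k)))"
proof -
  interpret M: supermod n q V act by unfold_locales (rule supermodule)
  assume k: "k \<in> {1..n}"
  have XY: "\<exists>c. X k (e b) = scl c (e b)" "\<exists>c. Y k (e b) = scl c (e b)" if "b \<in> B" for b
    unfolding X_def Y_def using that by (auto simp: ext_e)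
  have lin: "lin_on space (act (cls n q (fX k)))" "lin_on space (act (cls n q (fXinv k)))"
    using M.A_mon_lin[of "GX k"] M.A_mon_lin[of "GXinv k"] k unfolding total_V by simp_all
  show "semisimple_on space (act (cls n q (fX k)))"
    using semisimple_on_diagonal[OF lin(1)] XY(1) act_X[OF k e_space] by simp
  show "semisimple_on space (act (cls n q (fXinv k)))"
    using semisimple_on_diagonal[OF lin(2)] XY(2) act_Y[OF k e_space] by simp
qed

text \<open>The submodule W found inside the model inherits complete splittability and the
  eigenvalue restriction, but it is not known in advance which orbit weights occur in it; hence the
  return from j to i0.\<close>

lemma weight_realised:
  "\<exists>V act. irreducible_module n q V act \<and> completely_splittable n q V act \<and>
     in_RepI n q h V act \<and> is_weight n q h V act i0"
proof -
  interpret M: supermod n q V act by unfold_locales (rule supermodule)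
  have "(i0, {}) \<in> B" by (simp add: B_iff Orb.start)
  then have e0: "e (i0, {}) \<in> space" "Poly_Mapping.lookup (e (i0, {})) (enc (i0, {})) \<noteq> 0"
    by (simp_all add: e_space lookup_e)
  then have "e (i0, {}) \<noteq> 0" by (intro notI) simp
  then have "total V \<noteq> {0}" using e0(1) unfolding total_V by blast
  moreover have "vsp.span (e ` B) = total V" unfolding total_V by (rule space_span[symmetric])
  ultimately have "\<exists>W. graded_submodule n q V act W \<and> W \<noteq> {0} \<and> irreducible_module n q (\<lambda>a. W \<inter> V a) act"
    using M.exists_irreducible[OF finite_imageI[OF finB]] by simp
  then obtain W
    where W: "graded_submodule n q V act W" "W \<noteq> {0}" and irr: "irreducible_module n q (\<lambda>a. W \<inter> V a) act"
    by (elim exE conjE)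
  define V' where "V' = (\<lambda>a. W \<inter> V a)"
  have tot: "total V' = W" and sm': "supermodule n q V' act"
    unfolding V'_def by (rule M.graded_submodule_supermodule[OF W(1)])+
  have sW: "vsp.subspace W" "W \<subseteq> space"
    using W(1) total_V by (auto simp: graded_submodule_def)
  interpret N: quantum_supermod q h n V' act by unfold_locales (rule sm')
  have cl: "act (cls n q (mon g)) w \<in> W" if "g \<in> gens n" "w \<in> W" for g w
    using N.A_mon_closed[OF that(1)] that(2) unfolding tot .
  have cs: "completely_splittable n q V' act"
    unfolding completely_splittable_def tot
  proof (intro ballI conjI)
    fix k assume k: "k \<in> {1..n}"
    show "semisimple_on W (act (cls n q (fX k)))"
    proof (rule semisimple_on_subspace[OF semisimple_X[OF k] sW], rule image_subsetI)
      show "act (cls n q (fX k)) w \<in> W" if "w \<in> W" for w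
        by (rule cl[OF _ that]) (simp only: gens_simps k)
    qed
    show "semisimple_on W (act (cls n q (fXinv k)))"
    proof (rule semisimple_on_subspace[OF semisimple_Y[OF k] sW], rule image_subsetI)
      show "act (cls n q (fXinv k)) w \<in> W" if "w \<in> W" for w
        by (rule cl[OF _ that]) (simp only: gens_simps k)
    qed
  qed
  have rep: "in_RepI n q h V' act"
    unfolding in_RepI_def tot
  proof (intro conjI ballI allI impI)
    show "\<exists>A. finite A \<and> vsp.span A = W"
      by (rule finite_span_subspace[OF sW(1) _ finite_imageI[OF finB, of e]])
        (simp only: space_span[symmetric] sW(2))
    fix k c assume k: "k \<in> {1..n}" and "\<exists>v\<in>W. v \<noteq> 0 \<and> X_plus_Xinv n q act k v = scl c v"
    then obtain v where v: "v \<in> W" "v \<noteq> 0" "X_plus_Xinv n q act k v = scl c v" by blast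
    have vs: "v \<in> space" using v(1) sW(2) by blast
    have "X k v + Y k v = scl c v"
      using v(3) by (simp only: X_plus_Xinv_def act_X[OF k vs] act_Y[OF k vs])
    from eigenvalue_qval[OF vs v(2) this k] show "c \<in> qval q ` index_set h" .
  qed (rule sm')
  note csm = N.cs_module[OF cs]
  interpret H: cs_module "total V'" n "\<lambda>i. N.A (fC i)" q "\<lambda>i. N.A (fT i)" "\<lambda>i. N.A (fX i)" "\<lambda>i. N.A (fXinv i)" h
    by (rule csm)
  have "\<exists>w\<in>W. w \<noteq> 0 \<and> (\<exists>b\<in>B. \<forall>k\<in>{1..n}. N.A (fX k) w = scl (xv b k) w)"
  proof (rule joint_eigenvector_in_subspace[OF sW W(2)])
    fix k w assume k: "k \<in> {1..n}"
    show "N.A (fX k) w \<in> W" if "w \<in> W" using cl[of "GX k" w] k that by simp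
    assume w: "w \<in> space"
    show "Poly_Mapping.lookup (N.A (fX k) w) (enc b) = xv b k * Poly_Mapping.lookup w (enc b)" if "b \<in> B" for b
      unfolding act_X[OF k w] by (rule lookup_X[OF that])
  qed
  then obtain w b where w: "w \<in> W" "w \<noteq> 0" "b \<in> B" "\<forall>k\<in>{1..n}. N.A (fX k) w = scl (xv b k) w"
    by (elim bexE conjE)
  obtain j S where jS: "b = (j, S)" by (cases b)
  have "H.eig (xv b) w"
    unfolding H.eig_def
  proof (intro conjI ballI)
    show "w \<in> total V'" unfolding tot by (rule w(1))
    show "xv b k \<noteq> 0" for k unfolding jS by (rule xv)
    show "N.A (fX k) w = scl (xv b k) w" if "k \<in> {1..n}" for k by (rule bspec[OF w(4) that])
  qed
  moreover have "\<forall>k\<in>{1..n}. xv b k + inverse (xv b k) = qval q (j k)"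
    unfolding jS by (intro ballI xv)
  moreover have jO: "j \<in> Orb" using w(3) by (simp add: jS B_iff)
  ultimately have ewj: "H.eigen_weight j"
    unfolding H.eigen_weight_def using w(2) Orb_idx[OF jO] by (intro conjI exI)
  \<comment> \<open>Admissible swaps are their own inverses and stay admissible, so the path from i0
    to j is retraced with \<open>eigen_weight_swap\<close> inside W.\<close>
  have "H.eigen_weight j \<Longrightarrow> H.eigen_weight i0"
    using jO
  proof (induction rule: Orb.induct)
    case (swap j k)
    have "\<not> close ((j \<circ> adj_swap k) k) ((j \<circ> adj_swap k) (k + 1))"
      using swap.hyps(4) by (simp add: close_def conj_commute)
    from H.eigen_weight_swap[OF swap.prems swap.hyps(2,3) this]
    have "H.eigen_weight (j \<circ> adj_swap k \<circ> adj_swap k)" .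
    moreover have "j \<circ> adj_swap k \<circ> adj_swap k = j" by (simp add: fun_eq_iff)
    ultimately show ?case using swap.IH by (simp only:)
  qed
  from N.weight_if_eigen_weight[OF csm this[OF ewj]] have "is_weight n q h V' act i0" .
  with irr[folded V'_def] cs rep show ?thesis by (intro exI conjI)
qed

end

theorem corollary4p6:
  fixes q :: "'a::alg_closed_field" and h :: enat and n :: nat
  assumes "CHAR('a) \<noteq> 2"
    and "q \<noteq> 0" and "q \<noteq> 1" and "q \<noteq> -1"
    and "quantum_char q h" and "3 \<le> h"
  shows "{i. \<exists>V act. irreducible_module n q V act \<and> completely_splittable n q V act \<and>
               in_RepI n q h V act \<and> is_weight n q h V act i} =
    {i \<in> {1..n} \<rightarrow>\<^sub>E index_set h.
       (\<forall>k. 1 \<le> k \<and> k + 1 \<le> n \<longrightarrow> i k \<noteq> i (k + 1)) \<and>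
       (\<forall>m. h = enat m \<and> odd m \<longrightarrow> card {k \<in> {1..n}. i k = (m - 1) div 2} \<le> 1) \<and>
       (\<forall>k l. 1 \<le> k \<and> k < l \<and> l \<le> n \<and> i k = 0 \<and> i l = 0 \<longrightarrow> 1 \<in> i ` {k<..<l}) \<and>
       (h = \<infinity> \<longrightarrow>
          (\<forall>k l. 1 \<le> k \<and> k < l \<and> l \<le> n \<and> i k = i l \<and> 1 \<le> i k \<longrightarrow>
             {i k - 1, i k + 1} \<subseteq> i ` {k<..<l})) \<and>
       (\<forall>m. h = enat m \<and> odd m \<longrightarrow>
          (\<forall>k l. 1 \<le> k \<and> k < l \<and> l \<le> n \<and> i k = i l \<and> 1 \<le> i k \<longrightarrow>
             {i k - 1, i k + 1} \<subseteq> i ` {k<..<l} \<or> odd_sequence m i k l)) \<and>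
       (\<forall>m. h = enat m \<and> even m \<longrightarrow>
          (\<forall>k l. 1 \<le> k \<and> k < l \<and> l \<le> n \<and> i k = i l \<and> 1 \<le> i k \<longrightarrow>
             (i k < m div 2 - 1 \<longrightarrow> {i k - 1, i k + 1} \<subseteq> i ` {k<..<l}) \<and>
             (i k = m div 2 - 1 \<longrightarrow>
                i k - 1 \<in> i ` {k<..<l} \<and> even_unique_array m i k l)))}"
proof -
  interpret quantum q h by (rule quantum.intro[OF assms])
  have eq: "(\<exists>V act. irreducible_module n q V act \<and> completely_splittable n q V act \<and>
      in_RepI n q h V act \<and> is_weight n q h V act i) \<longleftrightarrow>
    i \<in> {1..n} \<rightarrow>\<^sub>E index_set h \<and> weight_conditions h n i" (is "?L \<longleftrightarrow> ?R") for i
  proof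
    assume ?L
    then obtain V act where irr: "irreducible_module n q V act" and cs: "completely_splittable n q V act"
      and wt: "is_weight n q h V act i" by (elim exE conjE)
    interpret M: quantum_supermod q h n V act
      by unfold_locales (use irr in \<open>simp add: irreducible_module_def\<close>)
    show ?R
      using cs_module.eigen_weight_conditions[OF M.cs_module[OF cs] M.eigen_weight_if_weight[OF cs wt]] wt
      by (simp add: is_weight_def)
  next
    assume R: ?R
    then have "well_separated h n i"
      using well_separated_if_conditions[of n i] by (auto simp: PiE_iff)
    with R interpret model q h n i by unfold_locales simp_all
    show ?L by (rule weight_realised)
  qed
  show ?thesis
    by (rule Set.set_eqI) (simp only: mem_Collect_eq eq weight_conditions_def)
qed

end
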